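(* Let $0<\beta_0<1/2$ and $k\in\mathbb{N}$. Then there is a constant $K$ depending only on $\beta_0$ and $k$ such that for every $N\ge 1$, every $1\le i\le N$, every $0<\beta\le\beta_0$ and every $h\in\mathbb{R}$, $$E\left[\langle\sigma_i\rangle-\tanh\left(\frac{\beta}{\sqrt N}\sum_{j\le N,\,j\ne i}g_{ij}\langle\sigma_j\rangle+h-\beta^2(1-q)\langle\sigma_i\rangle\right)\right]^{2k}\le\frac{K}{N^k}.$$
   Context: Sherrington-Kirkpatrick (SK) model: $\Sigma_N=\{-1,+1\}^N$; $\{g_{ij}\}_{1\le i<j\le N}$ are i.i.d. standard Gaussian random variables (the disorder), $g_{ij}=g_{ji}$. For inverse temperature $\beta>0$ and external field $h\in\mathbb{R}$ the Hamiltonian is given by $-H_N(\sigma)=\frac{\beta}{\sqrt N}\sum_{i<j\le N}g_{ij}\sigma_i\sigma_j+h\sum_{i\le N}\sigma_i$ for $\sigma=(\sigma_1,\dots,\sigma_N)\in\Sigma_N$, and the Gibbs measure is $G_N(\{\sigma\})=\exp(-H_N(\sigma))/Z_N$ with $Z_N=\sum_{\sigma}\exp(-H_N(\sigma))$. For a function $f$ on $\Sigma_N$, $\langle f\rangle=\sum_\sigma f(\sigma)G_N(\{\sigma\})$. $E$ denotes expectation over the disorder. $q$ is the unique solution of $q=E\tanh^2(\beta z\sqrt q+h)$, where $z$ is a standard Gaussian random variable. *)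

theory Defs
  imports "HOL-Probability.Probability"
begin

definition std_gaussian :: "real measure" where
  "std_gaussian = density lborel (\<lambda>x. ennreal (std_normal_density x))"

definition spin_pairs :: "nat \<Rightarrow> (nat \<times> nat) set" where
  "spin_pairs N = {(i, j). 1 \<le> i \<and> i < j \<and> j \<le> N}"

text \<open>The disorder is realised on its canonical space: a sample point \<open>g\<close> is the array of the
  couplings \<open>g (i, j)\<close> with \<open>i < j\<close>, and the product measure is its law.\<close>

definition disorder :: "nat \<Rightarrow> (nat \<times> nat \<Rightarrow> real) measure" where
  "disorder N = (\<Pi>\<^sub>M p\<in>spin_pairs N. std_gaussian)"

text \<open>The symmetric extension \<open>g\<^sub>i\<^sub>j = g\<^sub>j\<^sub>i\<close>; only used for \<open>i \<noteq> j\<close>.\<close>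

definition coupling :: "(nat \<times> nat \<Rightarrow> real) \<Rightarrow> nat \<Rightarrow> nat \<Rightarrow> real" where
  "coupling g i j = g (min i j, max i j)"

definition spin_configs :: "nat \<Rightarrow> (nat \<Rightarrow> real) set" where
  "spin_configs N = {1..N} \<rightarrow>\<^sub>E {-1, 1}"

definition hamiltonian ::
    "real \<Rightarrow> real \<Rightarrow> nat \<Rightarrow> (nat \<times> nat \<Rightarrow> real) \<Rightarrow> (nat \<Rightarrow> real) \<Rightarrow> real" where
  "hamiltonian \<beta> h N g \<sigma> =
     - (\<beta> / sqrt (real N) * (\<Sum>(i, j)\<in>spin_pairs N. coupling g i j * \<sigma> i * \<sigma> j)
        + h * (\<Sum>i\<in>{1..N}. \<sigma> i))"

definition partition_function ::
    "real \<Rightarrow> real \<Rightarrow> nat \<Rightarrow> (nat \<times> nat \<Rightarrow> real) \<Rightarrow> real" where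
  "partition_function \<beta> h N g = (\<Sum>\<sigma>\<in>spin_configs N. exp (- hamiltonian \<beta> h N g \<sigma>))"

definition gibbs_weight ::
    "real \<Rightarrow> real \<Rightarrow> nat \<Rightarrow> (nat \<times> nat \<Rightarrow> real) \<Rightarrow> (nat \<Rightarrow> real) \<Rightarrow> real" where
  "gibbs_weight \<beta> h N g \<sigma> =
     exp (- hamiltonian \<beta> h N g \<sigma>) / partition_function \<beta> h N g"

definition gibbs_avg ::
    "real \<Rightarrow> real \<Rightarrow> nat \<Rightarrow> (nat \<times> nat \<Rightarrow> real) \<Rightarrow> ((nat \<Rightarrow> real) \<Rightarrow> real) \<Rightarrow> real" where
  "gibbs_avg \<beta> h N g f = (\<Sum>\<sigma>\<in>spin_configs N. f \<sigma> * gibbs_weight \<beta> h N g \<sigma>)"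

definition overlap_q :: "real \<Rightarrow> real \<Rightarrow> real" where
  "overlap_q \<beta> h =
     (THE q. 0 \<le> q \<and> q = (LINT z|std_gaussian. (tanh (\<beta> * z * sqrt q + h))\<^sup>2))"

end

theory Submission
  imports Defs
begin

text \<open>
  Fix the site \<open>i\<close> and call the system without \<open>i\<close> the cavity system. Its Gibbs measure \<open>\<langle>\<cdot>\<rangle>\<^sub>0\<close> does not
  involve the couplings of \<open>i\<close>, which enter only through the cavity field \<open>l\<close>, a linear form in these
  couplings with coefficients \<open>\<beta> \<sigma>\<^sub>j / sqrt N\<close>. Summing over the spin at \<open>i\<close> expresses everything through
  \<open>\<Lambda> t = ln \<langle>exp (t l)\<rangle>\<^sub>0\<close>: the magnetisation at \<open>i\<close> is \<open>tanh (h + (\<Lambda> 1 - \<Lambda> (-1)) / 2)\<close>, and the mean of \<open>l\<close> in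
  the whole system is a mixture of \<open>\<Lambda>' 1\<close> and \<open>\<Lambda>' (-1)\<close>. If \<open>\<Lambda>''\<close> were constant, equal to
  \<open>\<kappa> = \<beta>\<^sup>2 (1 - q)\<close>, the TAP equation would hold exactly. In general its error is at most an integral of
  \<open>\<bar>\<Lambda>'' t - \<kappa>\<bar>\<close> over \<open>\<bar>t\<bar> \<le> 1\<close> (\<open>mean_field_error\<close>, \<open>tap_error_pointwise\<close>). So it suffices to bound the
  \<open>2 k\<close>-th moments of \<open>\<Lambda>'' t - \<kappa>\<close>, where \<open>\<Lambda>'' t\<close> is the variance of \<open>l\<close> under the tilted cavity measure.

  This power is bounded by a sum over replicas of the cavity system of products of factors
  \<open>(l \<sigma> - l \<tau>)\<^sup>2 / 2 - \<kappa>\<close> and exponentials of cavity fields (\<open>tilted_variance_power_le\<close>). For fixed replicas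
  the cavity fields are jointly Gaussian with covariance \<open>\<beta>\<^sup>2\<close> times the overlap. If all overlaps of distinct
  replicas are close to \<open>q\<close>, the differences are nearly independent of one another and of the exponent,
  and their variances are nearly \<open>2 \<kappa>\<close>. Every factor is then nearly a second Hermite polynomial, and
  integration by parts shows that the expectation of the product of \<open>2 k\<close> factors has the order of the
  \<open>2 k\<close>-th power of the overlap deviations (\<open>hermite_product_bound\<close>, \<open>centred_squares_bound\<close>,
  \<open>replica_cavity_expectation\<close>).

  It remains to see that the overlap \<open>R\<close> of two replicas of the cavity system concentrates:
  \<open>E \<langle>(R - q)\<^sup>2\<^sup>k\<rangle>\<^sub>0 \<le> K / N\<^sup>k\<close> (\<open>overlap_moments\<close>). The proof is Latala's: \<open>E \<langle>exp (\<lambda> N (R - q)\<^sup>2)\<rangle>\<close> is compared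
  along Guerra's interpolation between the cavity system and independent spins in Gaussian fields of variance
  \<open>\<beta>\<^sup>2 q\<close>. The derivative along the path is controlled by \<open>N (R - q)\<^sup>2\<close> times the exponential itself,
  which a decrease of the coefficient \<open>\<lambda>\<close> by \<open>2 \<beta>\<^sup>2\<close> in total compensates; for independent spins every
  \<open>\<lambda> < 1/2\<close> is admissible, which leaves a positive coefficient when \<open>\<beta> < 1/2\<close>. The number \<open>q\<close> enters as the mean
  of the product of the two replicas of one such spin: this is its fixed point equation, whose right-hand side
  is a contraction (\<open>overlap_q_fixed_point\<close>).
\<close>

section \<open>Gaussian integrals\<close>

lemma sets_std_gaussian [measurable_cong, simp]: "sets std_gaussian = sets borel"
  by (simp add: std_gaussian_def)

lemma space_std_gaussian [simp]: "space std_gaussian = UNIV"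
  by (simp add: std_gaussian_def)

lemma prob_space_std_gaussian: "prob_space std_gaussian"
  unfolding std_gaussian_def by (rule prob_space_normal_density) simp

lemma integrable_std_gaussian_iff:
  fixes f :: "real \<Rightarrow> real"
  assumes "f \<in> borel_measurable borel"
  shows "integrable std_gaussian f \<longleftrightarrow> integrable lborel (\<lambda>z. std_normal_density z * f z)"
  unfolding std_gaussian_def using assms by (subst integrable_real_density) auto

lemma integral_std_gaussian:
  fixes f :: "real \<Rightarrow> real"
  assumes "f \<in> borel_measurable borel"
  shows "(LINT z|std_gaussian. f z) = (LINT z|lborel. std_normal_density z * f z)"
  unfolding std_gaussian_def using assms by (subst integral_real_density) auto

lemma std_normal_density_times_exp:
  "std_normal_density z * exp (c * z) = exp (c\<^sup>2 / 2) * normal_density c 1 z"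
proof -
  have "- z\<^sup>2 / 2 + c * z = c\<^sup>2 / 2 + - (z - c)\<^sup>2 / 2"
    by (simp add: power2_eq_square field_simps)
  then have "exp (- z\<^sup>2 / 2) * exp (c * z) = exp (c\<^sup>2 / 2) * exp (- (z - c)\<^sup>2 / 2)"
    by (simp only: exp_add[symmetric])
  then show ?thesis
    by (simp add: normal_density_def)
qed

lemma integrable_std_gaussian_exp: "integrable std_gaussian (\<lambda>z. exp (c * z))"
  by (subst integrable_std_gaussian_iff) (simp_all add: std_normal_density_times_exp)

lemma integral_std_gaussian_exp: "(LINT z|std_gaussian. exp (c * z)) = exp (c\<^sup>2 / 2)"
  by (subst integral_std_gaussian) (simp_all add: std_normal_density_times_exp)

lemma exp_abs_le: "exp (c * \<bar>z\<bar>) \<le> exp (c * z) + exp (- c * z)" for z c :: real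
  by (cases "z \<ge> 0") (auto simp: abs_if)

lemma integrable_std_gaussian_exp_abs: "integrable std_gaussian (\<lambda>z. exp (c * \<bar>z\<bar>))"
proof (rule Bochner_Integration.integrable_bound)
  show "integrable std_gaussian (\<lambda>z. exp (c * z) + exp (- c * z))"
    using integrable_std_gaussian_exp[of c] integrable_std_gaussian_exp[of "-c"]
    by (intro Bochner_Integration.integrable_add) auto
  show "AE z in std_gaussian. norm (exp (c * \<bar>z\<bar>)) \<le> norm (exp (c * z) + exp (- c * z))"
  proof (intro AE_I2)
    fix z
    have "exp (c * z) + exp (- c * z) \<ge> 0" by (simp add: add_nonneg_nonneg)
    then show "norm (exp (c * \<bar>z\<bar>)) \<le> norm (exp (c * z) + exp (- c * z))"
      using exp_abs_le[of c z] by simp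
  qed
qed simp

lemma integrable_std_gaussian_exp_bound:
  fixes F :: "real \<Rightarrow> real"
  assumes "F \<in> borel_measurable borel" "\<And>z. \<bar>F z\<bar> \<le> K * exp (c * \<bar>z\<bar>)"
  shows "integrable std_gaussian F"
proof (rule Bochner_Integration.integrable_bound)
  show "integrable std_gaussian (\<lambda>z. K * exp (c * \<bar>z\<bar>))"
    by (intro integrable_mult_right integrable_std_gaussian_exp_abs)
  show "AE z in std_gaussian. norm (F z) \<le> norm (K * exp (c * \<bar>z\<bar>))"
    using assms(2) by (intro AE_I2) (auto intro: order_trans[OF _ abs_ge_self])
qed (use assms in simp)

lemma abs_le_exp_abs: "\<bar>z\<bar> \<le> exp \<bar>z\<bar>" for z :: real
  using exp_ge_add_one_self[of "\<bar>z\<bar>"] by linarith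

lemma std_normal_density_exp_tendsto_0:
  assumes "\<And>z. \<bar>F z\<bar> \<le> K * exp (c * \<bar>z\<bar>)"
  shows "((\<lambda>z. F z * std_normal_density z) \<longlongrightarrow> 0) at_top"
    and "((\<lambda>z. F z * std_normal_density z) \<longlongrightarrow> 0) at_bot"
proof -
  have b: "norm (F z * std_normal_density z)
      \<le> exp (- \<bar>z\<bar>) * (\<bar>K\<bar> * exp ((c + 1)\<^sup>2 / 2) / sqrt (2 * pi))" for z
  proof -
    \<comment> \<open>Completing the square trades the quadratic decay for \<open>exp (- \<bar>z\<bar>)\<close> and a constant.\<close>
    have "c * \<bar>z\<bar> + - z\<^sup>2 / 2 \<le> - \<bar>z\<bar> + (c + 1)\<^sup>2 / 2"
      using zero_le_power2[of "\<bar>z\<bar> - (c + 1)"] by (simp add: power2_eq_square algebra_simps)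
    then have "exp (c * \<bar>z\<bar>) * exp (- z\<^sup>2 / 2) \<le> exp (- \<bar>z\<bar>) * exp ((c + 1)\<^sup>2 / 2)"
      by (simp only: exp_add[symmetric] exp_le_cancel_iff)
    then have "\<bar>K\<bar> / sqrt (2 * pi) * (exp (c * \<bar>z\<bar>) * exp (- z\<^sup>2 / 2))
        \<le> \<bar>K\<bar> / sqrt (2 * pi) * (exp (- \<bar>z\<bar>) * exp ((c + 1)\<^sup>2 / 2))"
      by (rule mult_left_mono) simp
    moreover have "\<bar>F z\<bar> \<le> \<bar>K\<bar> * exp (c * \<bar>z\<bar>)"
      using assms[of z] by (rule order_trans) (simp add: mult_right_mono)
    then have "\<bar>F z\<bar> * (exp (- z\<^sup>2 / 2) / sqrt (2 * pi))
        \<le> \<bar>K\<bar> * exp (c * \<bar>z\<bar>) * (exp (- z\<^sup>2 / 2) / sqrt (2 * pi))"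
      by (rule mult_right_mono) simp
    ultimately show ?thesis
      by (simp add: normal_density_def abs_mult mult_ac)
  qed
  have "((\<lambda>z. exp (- \<bar>z::real\<bar>)) \<longlongrightarrow> 0) at_top"
    using filterlim_compose[OF exp_at_bot filterlim_uminus_at_bot_at_top]
    by (rule Lim_transform_eventually) (auto intro: eventually_mono[OF eventually_ge_at_top[of 0]])
  from tendsto_mult_left_zero[OF this, of "\<bar>K\<bar> * exp ((c + 1)\<^sup>2 / 2) / sqrt (2 * pi)"]
  show "((\<lambda>z. F z * std_normal_density z) \<longlongrightarrow> 0) at_top"
    by (rule Lim_null_comparison[OF always_eventually, rotated]) (use b in blast)
  have "((\<lambda>z. exp (- \<bar>z::real\<bar>)) \<longlongrightarrow> 0) at_bot"
    using exp_at_bot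
    by (rule Lim_transform_eventually) (auto intro: eventually_mono[OF eventually_le_at_bot[of 0]])
  from tendsto_mult_left_zero[OF this, of "\<bar>K\<bar> * exp ((c + 1)\<^sup>2 / 2) / sqrt (2 * pi)"]
  show "((\<lambda>z. F z * std_normal_density z) \<longlongrightarrow> 0) at_bot"
    by (rule Lim_null_comparison[OF always_eventually, rotated]) (use b in blast)
qed

lemma std_normal_density_deriv:
  "(std_normal_density has_real_derivative - z * std_normal_density z) (at z)"
  unfolding normal_density_def
  by (auto intro!: derivative_eq_intros simp: field_simps)

text \<open>The derivative of \<open>F\<close> times the Gaussian density is \<open>F' - z F\<close> times the density, and
  the growth bound makes the boundary terms vanish.\<close>

lemma gaussian_ibp_1d:
  fixes F F' :: "real \<Rightarrow> real"
  assumes deriv: "\<And>z. (F has_real_derivative F' z) (at z)"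
    and cont: "\<And>z. isCont F' z"
    and bF: "\<And>z. \<bar>F z\<bar> \<le> K * exp (c * \<bar>z\<bar>)"
    and bF': "\<And>z. \<bar>F' z\<bar> \<le> K * exp (c * \<bar>z\<bar>)"
  shows "(LINT z|std_gaussian. z * F z) = (LINT z|std_gaussian. F' z)"
proof -
  let ?\<phi> = std_normal_density
  have contF: "continuous_on UNIV F" 
    using deriv by (meson DERIV_isCont continuous_at_imp_continuous_on)
  have [measurable]: "F \<in> borel_measurable borel" "F' \<in> borel_measurable borel"
    using contF cont by (auto intro!: borel_measurable_continuous_onI continuous_at_imp_continuous_on)
  have b1: "\<bar>z * F z\<bar> \<le> K * exp ((c + 1) * \<bar>z\<bar>)" for z
  proof -
    have "\<bar>z * F z\<bar> \<le> exp \<bar>z\<bar> * (K * exp (c * \<bar>z\<bar>))"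
      unfolding abs_mult by (intro mult_mono abs_le_exp_abs bF) auto
    moreover have "exp \<bar>z\<bar> * exp (c * \<bar>z\<bar>) = exp ((c + 1) * \<bar>z\<bar>)"
      by (simp add: exp_add[symmetric] algebra_simps)
    ultimately show ?thesis by (simp add: mult_ac)
  qed
  have i1: "integrable std_gaussian (\<lambda>z. z * F z)"
    by (rule integrable_std_gaussian_exp_bound[OF _ b1]) simp
  have i2: "integrable std_gaussian F'"
    by (rule integrable_std_gaussian_exp_bound[OF _ bF']) simp
  let ?g = "\<lambda>z. ?\<phi> z * F' z - ?\<phi> z * (z * F z)"
  have int: "integrable lborel (\<lambda>z. ?\<phi> z * F' z)" "integrable lborel (\<lambda>z. ?\<phi> z * (z * F z))"
    using i1 i2 by (simp_all add: integrable_std_gaussian_iff)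
  have cphi: "isCont ?\<phi> z" for z
    using std_normal_density_deriv[of z] by (rule DERIV_isCont)
  have "(LBINT z=-\<infinity>..\<infinity>. ?g z) = 0 - 0"
  proof (rule interval_integral_FTC_integrable[where F = "\<lambda>z. F z * ?\<phi> z"])
    show "((\<lambda>z. F z * ?\<phi> z) has_vector_derivative ?g x) (at x)" for x
      using DERIV_mult[OF deriv[of x] std_normal_density_deriv[of x]]
      by (simp add: has_real_derivative_iff_has_vector_derivative algebra_simps)
    show "isCont ?g x" for x
      using cphi[of x] cont[of x] DERIV_isCont[OF deriv[of x]] by (intro continuous_intros)
    show "set_integrable lborel (einterval (- \<infinity>) \<infinity>) ?g"
      using int by (simp add: set_integrable_def)
    show "(((\<lambda>z. F z * ?\<phi> z) \<circ> real_of_ereal) \<longlongrightarrow> 0) (at_right (- \<infinity>))"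
      using std_normal_density_exp_tendsto_0(2)[OF bF]
      by (simp add: ereal_tendsto_simps1)
    show "(((\<lambda>z. F z * ?\<phi> z) \<circ> real_of_ereal) \<longlongrightarrow> 0) (at_left \<infinity>)"
      using std_normal_density_exp_tendsto_0(1)[OF bF]
      by (simp add: ereal_tendsto_simps1)
  qed simp
  then have "(LINT z|lborel. ?g z) = 0"
    by (simp add: interval_lebesgue_integral_def set_lebesgue_integral_def)
  then show ?thesis
    using int by (simp add: integral_std_gaussian)
qed

subsection \<open>Finite Gaussian families\<close>

abbreviation gaussians :: "'i set \<Rightarrow> ('i \<Rightarrow> real) measure" where
  "gaussians I \<equiv> \<Pi>\<^sub>M p\<in>I. std_gaussian"

lemma product_sigma_finite_std_gaussian: "product_sigma_finite (\<lambda>_::'i. std_gaussian)"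
proof -
  interpret prob_space std_gaussian by (rule prob_space_std_gaussian)
  show ?thesis by unfold_locales
qed

lemma prob_space_gaussians: "prob_space (gaussians I)"
  by (intro prob_space_PiM prob_space_std_gaussian)

lemma gaussians_component: "p \<in> I \<Longrightarrow> (\<lambda>\<omega>. \<omega> p) \<in> borel_measurable (gaussians I)"
  using measurable_component_singleton[of p I "\<lambda>_. std_gaussian"]
  by (simp add: measurable_cong_sets[OF refl sets_std_gaussian])

text \<open>At most exponential growth, measured on the coordinates in \<open>I\<close> and at every point of the function
  space. The class is closed under sums and products, contains the linear forms and their exponentials,
  and lies inside the integrable functions; so one notion settles all integrability questions below. A
  single constant serves as factor and as exponent.\<close>

definition exp_growth :: "'i set \<Rightarrow> (('i \<Rightarrow> real) \<Rightarrow> real) \<Rightarrow> bool" where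
  "exp_growth I F \<longleftrightarrow> (\<exists>K\<ge>0. \<forall>\<omega>. \<bar>F \<omega>\<bar> \<le> K * exp (K * (\<Sum>i\<in>I. \<bar>\<omega> i\<bar>)))"

lemma exp_growthI:
  fixes F :: "('i \<Rightarrow> real) \<Rightarrow> real"
  assumes "\<And>\<omega>. \<bar>F \<omega>\<bar> \<le> K * exp (c * (\<Sum>i\<in>I. \<bar>\<omega> i\<bar>))"
  shows "exp_growth I F"
  unfolding exp_growth_def
proof (intro exI[of _ "max \<bar>K\<bar> \<bar>c\<bar>"] conjI allI)
  fix \<omega> :: "'i \<Rightarrow> real"
  let ?s = "\<Sum>i\<in>I. \<bar>\<omega> i\<bar>"
  have s: "?s \<ge> 0" by (simp add: sum_nonneg)
  have "c * ?s \<le> max \<bar>K\<bar> \<bar>c\<bar> * ?s"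
    using s by (intro mult_right_mono) auto
  then have "K * exp (c * ?s) \<le> max \<bar>K\<bar> \<bar>c\<bar> * exp (max \<bar>K\<bar> \<bar>c\<bar> * ?s)"
    by (intro mult_mono) (auto simp: le_max_iff_disj)
  with assms[of \<omega>] show "\<bar>F \<omega>\<bar> \<le> max \<bar>K\<bar> \<bar>c\<bar> * exp (max \<bar>K\<bar> \<bar>c\<bar> * ?s)"
    by linarith
qed auto

lemma exp_growth_bounded:
  assumes "\<And>\<omega>. \<bar>F \<omega>\<bar> \<le> K"
  shows "exp_growth I F"
  by (rule exp_growthI[of _ K 0]) (use assms in simp)

lemma exp_growth_const [intro]: "exp_growth I (\<lambda>_. c)"
  by (rule exp_growth_bounded[of _ "\<bar>c\<bar>"]) simp

lemma exp_growth_add [intro]: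
  fixes F G :: "('i \<Rightarrow> real) \<Rightarrow> real"
  assumes "exp_growth I F" "exp_growth I G"
  shows "exp_growth I (\<lambda>\<omega>. F \<omega> + G \<omega>)"
proof -
  obtain K L where K: "K \<ge> 0" "\<And>\<omega>. \<bar>F \<omega>\<bar> \<le> K * exp (K * (\<Sum>i\<in>I. \<bar>\<omega> i\<bar>))"
    and L: "L \<ge> 0" "\<And>\<omega>. \<bar>G \<omega>\<bar> \<le> L * exp (L * (\<Sum>i\<in>I. \<bar>\<omega> i\<bar>))"
    using assms unfolding exp_growth_def by blast
  show ?thesis
  proof (rule exp_growthI[of _ "K + L" "max K L"])
    fix \<omega> :: "'i \<Rightarrow> real"
    let ?s = "\<Sum>i\<in>I. \<bar>\<omega> i\<bar>"
    have s: "?s \<ge> 0" by (simp add: sum_nonneg)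
    have "K * exp (K * ?s) \<le> K * exp (max K L * ?s)" "L * exp (L * ?s) \<le> L * exp (max K L * ?s)"
      using s K(1) L(1) by (auto intro!: mult_left_mono mult_right_mono)
    with K(2)[of \<omega>] L(2)[of \<omega>] show "\<bar>F \<omega> + G \<omega>\<bar> \<le> (K + L) * exp (max K L * ?s)"
      by (simp add: distrib_right)
  qed
qed

lemma exp_growth_mult [intro]:
  fixes F G :: "('i \<Rightarrow> real) \<Rightarrow> real"
  assumes "exp_growth I F" "exp_growth I G"
  shows "exp_growth I (\<lambda>\<omega>. F \<omega> * G \<omega>)"
proof -
  obtain K L where K: "K \<ge> 0" "\<And>\<omega>. \<bar>F \<omega>\<bar> \<le> K * exp (K * (\<Sum>i\<in>I. \<bar>\<omega> i\<bar>))"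
    and L: "L \<ge> 0" "\<And>\<omega>. \<bar>G \<omega>\<bar> \<le> L * exp (L * (\<Sum>i\<in>I. \<bar>\<omega> i\<bar>))"
    using assms unfolding exp_growth_def by blast
  show ?thesis
  proof (rule exp_growthI[of _ "K * L" "K + L"])
    fix \<omega> :: "'i \<Rightarrow> real"
    let ?s = "\<Sum>i\<in>I. \<bar>\<omega> i\<bar>"
    have "\<bar>F \<omega>\<bar> * \<bar>G \<omega>\<bar> \<le> (K * exp (K * ?s)) * (L * exp (L * ?s))"
      using K L by (intro mult_mono) auto
    then show "\<bar>F \<omega> * G \<omega>\<bar> \<le> K * L * exp ((K + L) * ?s)"
      by (simp add: abs_mult distrib_right exp_add mult_ac)
  qed
qed

lemma exp_growth_diff [intro]:
  assumes "exp_growth I F" "exp_growth I G"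
  shows "exp_growth I (\<lambda>\<omega>. F \<omega> - G \<omega>)"
  using exp_growth_add[OF assms(1) exp_growth_mult[OF exp_growth_const[of I "-1"] assms(2)]] by simp

lemma exp_growth_sum [intro]:
  "(\<And>x. x \<in> A \<Longrightarrow> exp_growth I (F x)) \<Longrightarrow> exp_growth I (\<lambda>\<omega>. \<Sum>x\<in>A. F x \<omega>)"
  by (induction A rule: infinite_finite_induct) auto

lemma exp_growth_prod [intro]:
  "(\<And>x. x \<in> A \<Longrightarrow> exp_growth I (F x)) \<Longrightarrow> exp_growth I (\<lambda>\<omega>. \<Prod>x\<in>A. F x \<omega>)"
  by (induction A rule: infinite_finite_induct) auto

lemma exp_growth_component:
  assumes "finite I" "p \<in> I"
  shows "exp_growth I (\<lambda>\<omega>. \<omega> p)"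
proof (rule exp_growthI[of _ 1 1])
  fix \<omega> :: "'a \<Rightarrow> real"
  have "\<bar>\<omega> p\<bar> \<le> (\<Sum>i\<in>I. \<bar>\<omega> i\<bar>)"
    using assms by (intro member_le_sum) auto
  then show "\<bar>\<omega> p\<bar> \<le> 1 * exp (1 * (\<Sum>i\<in>I. \<bar>\<omega> i\<bar>))"
    unfolding mult_1 using exp_ge_add_one_self[of "\<Sum>i\<in>I. \<bar>\<omega> i\<bar>"] by linarith
qed

lemma exp_growth_linear: "finite I \<Longrightarrow> exp_growth I (\<lambda>\<omega>. \<Sum>i\<in>I. d i * \<omega> i)"
  by (intro exp_growth_sum exp_growth_mult exp_growth_const exp_growth_component)

lemma exp_growth_exp_linear:
  assumes "finite I"
  shows "exp_growth I (\<lambda>\<omega>. exp (\<Sum>i\<in>I. d i * \<omega> i))"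
proof (rule exp_growthI[of _ 1 "\<Sum>i\<in>I. \<bar>d i\<bar>"])
  fix \<omega> :: "'a \<Rightarrow> real"
  have "(\<Sum>i\<in>I. d i * \<omega> i) \<le> (\<Sum>i\<in>I. (\<Sum>j\<in>I. \<bar>d j\<bar>) * \<bar>\<omega> i\<bar>)"
  proof (rule sum_mono)
    fix i assume "i \<in> I"
    then have "\<bar>d i\<bar> \<le> (\<Sum>j\<in>I. \<bar>d j\<bar>)" using assms by (intro member_le_sum) auto
    then have "\<bar>d i * \<omega> i\<bar> \<le> (\<Sum>j\<in>I. \<bar>d j\<bar>) * \<bar>\<omega> i\<bar>" by (simp add: abs_mult mult_right_mono)
    then show "d i * \<omega> i \<le> (\<Sum>j\<in>I. \<bar>d j\<bar>) * \<bar>\<omega> i\<bar>" by linarith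
  qed
  then show "\<bar>exp (\<Sum>i\<in>I. d i * \<omega> i)\<bar> \<le> 1 * exp ((\<Sum>i\<in>I. \<bar>d i\<bar>) * (\<Sum>i\<in>I. \<bar>\<omega> i\<bar>))"
    by (simp add: sum_distrib_left)
qed

lemma linear_form_deriv:
  assumes "finite I" "p \<in> I"
  shows "((\<lambda>z. (\<Sum>i\<in>I. a i * (x(p := z)) i)) has_real_derivative a p) (at t)"
proof -
  have "(\<Sum>i\<in>I. a i * (x(p := z)) i) = a p * z + (\<Sum>i\<in>I - {p}. a i * x i)" for z
    using assms by (subst sum.remove[of _ p]) (auto intro!: sum.cong)
  then show ?thesis by (auto intro!: derivative_eq_intros)
qed

lemma linear_form_measurable_subset:
  "I \<subseteq> J \<Longrightarrow> (\<lambda>x. \<Sum>i\<in>I. a i * x i) \<in> borel_measurable (gaussians J)"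
  by (intro borel_measurable_sum borel_measurable_times borel_measurable_const gaussians_component) auto

lemma linear_form_measurable:
  "(\<lambda>x. \<Sum>i\<in>I. a i * x i) \<in> borel_measurable (gaussians I)"
  by (rule linear_form_measurable_subset) simp

lemma linear_form_extend:
  fixes a x :: "'i \<Rightarrow> real"
  assumes "finite J" "I \<subseteq> J"
  shows "(\<Sum>i\<in>I. a i * x i) = (\<Sum>i\<in>J. (if i \<in> I then a i else 0) * x i)"
proof -
  have "(\<Sum>i\<in>J. (if i \<in> I then a i else 0) * x i) = (\<Sum>i\<in>I. (if i \<in> I then a i else 0) * x i)"
    using assms by (intro sum.mono_neutral_right) auto
  then show ?thesis by simp
qed

lemma exp_growth_linear_subset:
  assumes "finite J" "I \<subseteq> J"
  shows "exp_growth J (\<lambda>x. \<Sum>i\<in>I. a i * x i)"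
  unfolding linear_form_extend[OF assms] by (rule exp_growth_linear[OF assms(1)])

lemma exp_growth_exp_linear_subset:
  assumes "finite J" "I \<subseteq> J"
  shows "exp_growth J (\<lambda>x. exp (\<Sum>i\<in>I. a i * x i))"
  unfolding linear_form_extend[OF assms] by (rule exp_growth_exp_linear[OF assms(1)])

lemma integrable_gaussians_prod:
  fixes f :: "'i \<Rightarrow> real \<Rightarrow> real"
  assumes "finite I" "\<And>i. i \<in> I \<Longrightarrow> integrable std_gaussian (f i)"
  shows "integrable (gaussians I) (\<lambda>\<omega>. \<Prod>i\<in>I. f i (\<omega> i))"
  using product_sigma_finite.product_integrable_prod[OF product_sigma_finite_std_gaussian assms] .

lemma integral_gaussians_prod:
  fixes f :: "'i \<Rightarrow> real \<Rightarrow> real"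
  assumes "finite I" "\<And>i. i \<in> I \<Longrightarrow> integrable std_gaussian (f i)"
  shows "(LINT \<omega>|gaussians I. (\<Prod>i\<in>I. f i (\<omega> i))) = (\<Prod>i\<in>I. (LINT z|std_gaussian. f i z))"
  using product_sigma_finite.product_integral_prod[OF product_sigma_finite_std_gaussian assms] .

lemma exp_growth_integrable:
  assumes "finite I" "F \<in> borel_measurable (gaussians I)" "exp_growth I F"
  shows "integrable (gaussians I) F"
proof -
  obtain K where K: "K \<ge> 0" "\<And>\<omega>. \<bar>F \<omega>\<bar> \<le> K * exp (K * (\<Sum>i\<in>I. \<bar>\<omega> i\<bar>))"
    using assms unfolding exp_growth_def by blast
  show ?thesis
  proof (rule Bochner_Integration.integrable_bound)
    show "integrable (gaussians I) (\<lambda>\<omega>. K * (\<Prod>i\<in>I. exp (K * \<bar>\<omega> i\<bar>)))"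
      using assms(1) by (intro integrable_mult_right integrable_gaussians_prod
        integrable_std_gaussian_exp_abs)
    show "AE \<omega> in gaussians I. norm (F \<omega>) \<le> norm (K * (\<Prod>i\<in>I. exp (K * \<bar>\<omega> i\<bar>)))"
      using K assms(1) by (intro AE_I2) (simp add: exp_sum[symmetric] sum_distrib_left abs_mult)
  qed (rule assms)
qed

lemma gaussian_exp_linear:
  assumes "finite I"
  shows "(LINT \<omega>|gaussians I. exp (\<Sum>i\<in>I. d i * \<omega> i)) = exp ((\<Sum>i\<in>I. (d i)\<^sup>2) / 2)"
proof -
  have "(LINT \<omega>|gaussians I. exp (\<Sum>i\<in>I. d i * \<omega> i))
      = (LINT \<omega>|gaussians I. (\<Prod>i\<in>I. exp (d i * \<omega> i)))"
    using assms by (simp add: exp_sum)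
  also have "\<dots> = (\<Prod>i\<in>I. (LINT z|std_gaussian. exp (d i * z)))"
    using assms by (intro integral_gaussians_prod integrable_std_gaussian_exp)
  finally show ?thesis
    using assms by (simp add: integral_std_gaussian_exp exp_sum sum_divide_distrib)
qed

text \<open>One coordinate is integrated at a time, with the others frozen.\<close>

lemma gaussian_ibp:
  fixes F F' :: "('i \<Rightarrow> real) \<Rightarrow> real"
  assumes I: "finite I" "p \<in> I"
    and [measurable]: "F \<in> borel_measurable (gaussians I)" "F' \<in> borel_measurable (gaussians I)"
    and gr: "exp_growth I F" "exp_growth I F'"
    and deriv: "\<And>x. ((\<lambda>z. F (x(p := z))) has_real_derivative F' x) (at (x p))"
    and cont: "\<And>x z. isCont (\<lambda>z. F' (x(p := z))) z"
  shows "(LINT x|gaussians I. x p * F x) = (LINT x|gaussians I. F' x)"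
proof -
  define J where "J = I - {p}"
  have J: "finite J" "p \<notin> J" "I = insert p J" using I by (auto simp: J_def)
  have i1: "integrable (gaussians (insert p J)) (\<lambda>x. x p * F x)"
    unfolding J(3)[symmetric] 
    by (rule exp_growth_integrable[OF I(1) _ exp_growth_mult[OF exp_growth_component[OF I] gr(1)]])
       (intro borel_measurable_times gaussians_component I assms(3))
  have i2: "integrable (gaussians (insert p J)) F'"
    unfolding J(3)[symmetric] by (rule exp_growth_integrable[OF I(1) assms(4) gr(2)])
  obtain K1 where K1: "K1 \<ge> 0" "\<And>x. \<bar>F x\<bar> \<le> K1 * exp (K1 * (\<Sum>i\<in>I. \<bar>x i\<bar>))"
    using gr(1) unfolding exp_growth_def by blast
  obtain K2 where K2: "K2 \<ge> 0" "\<And>x. \<bar>F' x\<bar> \<le> K2 * exp (K2 * (\<Sum>i\<in>I. \<bar>x i\<bar>))"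
    using gr(2) unfolding exp_growth_def by blast
  define K where "K = max K1 K2"
  have K: "K \<ge> 0" using K1 by (simp add: K_def)
  have bK: "Ki * exp (Ki * (\<Sum>i\<in>I. \<bar>(x(p := z)) i\<bar>)) \<le> (K * exp (K * (\<Sum>i\<in>J. \<bar>x i\<bar>))) * exp (K * \<bar>z\<bar>)"
    if "0 \<le> Ki" "Ki \<le> K" for Ki z x
  proof -
    have s: "(\<Sum>i\<in>I. \<bar>(x(p := z)) i\<bar>) = \<bar>z\<bar> + (\<Sum>i\<in>J. \<bar>x i\<bar>)"
      using J by (auto intro!: sum.cong)
    have "Ki * exp (Ki * (\<Sum>i\<in>I. \<bar>(x(p := z)) i\<bar>)) \<le> K * exp (K * (\<Sum>i\<in>I. \<bar>(x(p := z)) i\<bar>))"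
      using that by (intro mult_mono) (auto intro!: mult_right_mono sum_nonneg)
    then show ?thesis unfolding s by (simp add: distrib_left exp_add mult_ac)
  qed
  have "(LINT x|gaussians I. x p * F x)
      = (LINT x|gaussians J. LINT z|std_gaussian. z * F (x(p := z)))"
    using product_sigma_finite.product_integral_insert[OF product_sigma_finite_std_gaussian J(1,2) i1] J(3) by simp
  also have "\<dots> = (LINT x|gaussians J. LINT z|std_gaussian. F' (x(p := z)))"
  proof (rule Bochner_Integration.integral_cong[OF refl], rule gaussian_ibp_1d)
    fix x z
    show "((\<lambda>z. F (x(p := z))) has_real_derivative F' (x(p := z))) (at z)"
      using deriv[of "x(p := z)"] by simp
    show "isCont (\<lambda>z. F' (x(p := z))) z" by (rule cont)
    show "\<bar>F (x(p := z))\<bar> \<le> K * exp (K * (\<Sum>i\<in>J. \<bar>x i\<bar>)) * exp (K * \<bar>z\<bar>)"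
      using K1(2)[of "x(p := z)"] bK[of K1 x z] K1(1) by (simp add: K_def)
    show "\<bar>F' (x(p := z))\<bar> \<le> K * exp (K * (\<Sum>i\<in>J. \<bar>x i\<bar>)) * exp (K * \<bar>z\<bar>)"
      using K2(2)[of "x(p := z)"] bK[of K2 x z] K2(1) by (simp add: K_def)
  qed
  also have "\<dots> = (LINT x|gaussians I. F' x)"
    using product_sigma_finite.product_integral_insert[OF product_sigma_finite_std_gaussian J(1,2) i2] J(3) by simp
  finally show ?thesis .
qed

lemma gaussians_independent:
  assumes IJ: "finite I" "finite J" "I \<inter> J = {}"
    and int: "integrable (gaussians (I \<union> J)) (\<lambda>\<omega>. F \<omega> * G \<omega>)"
    and F: "\<And>\<omega> \<omega>'. (\<And>i. i \<in> I \<Longrightarrow> \<omega> i = \<omega>' i) \<Longrightarrow> F \<omega> = F \<omega>'"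
    and G: "\<And>\<omega> \<omega>'. (\<And>i. i \<in> J \<Longrightarrow> \<omega> i = \<omega>' i) \<Longrightarrow> G \<omega> = G \<omega>'"
  shows "(LINT \<omega>|gaussians (I \<union> J). F \<omega> * G \<omega> :: real)
    = (LINT \<omega>|gaussians I. F \<omega>) * (LINT \<omega>|gaussians J. G \<omega>)"
proof -
  have "(LINT \<omega>|gaussians (I \<union> J). F \<omega> * G \<omega>)
      = (LINT x|gaussians I. LINT y|gaussians J. F (merge I J (x, y)) * G (merge I J (x, y)))"
    by (rule product_sigma_finite.product_integral_fold[OF product_sigma_finite_std_gaussian IJ(3,1,2) int])
  also have "\<dots> = (LINT x|gaussians I. LINT y|gaussians J. F x * G y)"
  proof (intro Bochner_Integration.integral_cong refl arg_cong2[where f = "(*)"])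
    fix x y
    show "F (merge I J (x, y)) = F x" by (rule F) (simp add: merge_def)
    show "G (merge I J (x, y)) = G y" by (rule G) (use IJ in \<open>auto simp: merge_def\<close>)
  qed
  finally show ?thesis by simp
qed

lemma gaussians_marginal:
  fixes F :: "('i \<Rightarrow> real) \<Rightarrow> real"
  assumes "finite I" "J \<subseteq> I" "integrable (gaussians I) F"
    and F: "\<And>\<omega> \<omega>'. (\<And>i. i \<in> J \<Longrightarrow> \<omega> i = \<omega>' i) \<Longrightarrow> F \<omega> = F \<omega>'"
  shows "(LINT \<omega>|gaussians I. F \<omega>) = (LINT \<omega>|gaussians J. F \<omega>)"
proof -
  have fin: "finite J" "finite (I - J)" using assms(1) finite_subset[OF assms(2,1)] by blast+
  have I: "J \<union> (I - J) = I" using assms(2) by blast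
  interpret prob_space "gaussians (I - J)" by (rule prob_space_gaussians)
  show ?thesis
    using gaussians_independent[of J "I - J" F "\<lambda>_. 1", OF fin _ _ F] assms(3)
    by (simp only: I mult_1_right lebesgue_integral_const prob_space) simp
qed

subsection \<open>Differentiation under the integral sign\<close>

text \<open>By the mean value theorem \<open>G\<close> dominates the difference quotients.\<close>

lemma has_real_derivative_integral:
  fixes F F' :: "real \<Rightarrow> 'a \<Rightarrow> real"
  assumes deriv: "\<And>\<theta> \<omega>. ((\<lambda>\<theta>. F \<theta> \<omega>) has_real_derivative F' \<theta> \<omega>) (at \<theta>)"
    and bound: "\<And>\<theta> \<omega>. \<bar>F' \<theta> \<omega>\<bar> \<le> G \<omega>"
    and G: "integrable M G"
    and F: "\<And>\<theta>. integrable M (F \<theta>)"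
    and F': "\<And>\<theta>. F' \<theta> \<in> borel_measurable M"
  shows "((\<lambda>\<theta>. LINT \<omega>|M. F \<theta> \<omega>) has_real_derivative (LINT \<omega>|M. F' \<theta>0 \<omega>)) (at \<theta>0)"
  unfolding has_field_derivative_iff tendsto_at_iff_sequentially comp_def
proof (intro allI impI)
  fix X :: "nat \<Rightarrow> real"
  assume X: "\<forall>i. X i \<in> UNIV - {\<theta>0}" "X \<longlonglongrightarrow> \<theta>0"
  have "(\<lambda>i. LINT \<omega>|M. (F (X i) \<omega> - F \<theta>0 \<omega>) / (X i - \<theta>0)) \<longlonglongrightarrow> (LINT \<omega>|M. F' \<theta>0 \<omega>)"
  proof (rule integral_dominated_convergence[OF _ _ G])
    show "AE \<omega> in M. (\<lambda>i. (F (X i) \<omega> - F \<theta>0 \<omega>) / (X i - \<theta>0)) \<longlonglongrightarrow> F' \<theta>0 \<omega>"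
      using deriv[of _ \<theta>0] X
      unfolding has_field_derivative_iff tendsto_at_iff_sequentially comp_def by auto
    show "AE \<omega> in M. norm ((F (X i) \<omega> - F \<theta>0 \<omega>) / (X i - \<theta>0)) \<le> G \<omega>" for i
    proof (rule AE_I2)
      fix \<omega>
      have "norm (F (X i) \<omega> - F \<theta>0 \<omega>) \<le> G \<omega> * norm (X i - \<theta>0)"
        by (rule field_differentiable_bound[where S = UNIV and f = "\<lambda>\<theta>. F \<theta> \<omega>" and f' = "\<lambda>\<theta>. F' \<theta> \<omega>"])
           (use deriv bound in auto)
      then show "norm ((F (X i) \<omega> - F \<theta>0 \<omega>) / (X i - \<theta>0)) \<le> G \<omega>"
        using X(1) by (simp add: field_simps)
    qed
    show "F' \<theta>0 \<in> borel_measurable M" by (rule F')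
    show "(\<lambda>\<omega>. (F (X i) \<omega> - F \<theta>0 \<omega>) / (X i - \<theta>0)) \<in> borel_measurable M" for i
      using F[of "X i"] F[of \<theta>0] by (auto dest!: borel_measurable_integrable)
  qed
  then show "(\<lambda>i. ((LINT \<omega>|M. F (X i) \<omega>) - (LINT \<omega>|M. F \<theta>0 \<omega>)) / (X i - \<theta>0))
      \<longlonglongrightarrow> (LINT \<omega>|M. F' \<theta>0 \<omega>)"
    using F by simp
qed

section \<open>The order parameter\<close>

lemma tanh_sq_le_1: "(tanh z)\<^sup>2 \<le> (1::real)"
  using tanh_real_bounds[of z] by (simp add: abs_square_le_1 abs_le_iff)

lemma tanh_sq_deriv:
  "((\<lambda>z. (tanh z)\<^sup>2) has_real_derivative 2 * tanh z * (1 - (tanh z)\<^sup>2)) (at z)"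
  by (auto intro!: derivative_eq_intros simp: power2_eq_square)

lemma tanh_sq_deriv2:
  "((\<lambda>z. 2 * tanh z * (1 - (tanh z)\<^sup>2)) has_real_derivative
     2 * (1 - (tanh z)\<^sup>2) * (1 - 3 * (tanh z)\<^sup>2)) (at z)"
  by (auto intro!: derivative_eq_intros simp: power2_eq_square algebra_simps)

lemma tanh_sq_deriv_bound: "\<bar>2 * tanh z * (1 - (tanh z)\<^sup>2)\<bar> \<le> (2::real)"
proof -
  have "\<bar>tanh z\<bar> * \<bar>1 - (tanh z)\<^sup>2\<bar> \<le> 1 * 1"
    using tanh_real_bounds[of z] tanh_sq_le_1[of z] by (intro mult_mono) auto
  then show ?thesis by (simp add: abs_mult)
qed

lemma tanh_sq_deriv2_bound: "\<bar>2 * (1 - (tanh z)\<^sup>2) * (1 - 3 * (tanh z)\<^sup>2)\<bar> \<le> (2::real)"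
proof -
  define x where "x = (tanh z)\<^sup>2"
  have x: "0 \<le> x" "x \<le> 1" using tanh_sq_le_1[of z] by (auto simp: x_def)
  have "(1 - x) * (1 - 3 * x) \<le> 1"
    using x mult_nonneg_nonneg[of x "4 - 3 * x"] by (simp add: algebra_simps)
  moreover have "- 1 \<le> (1 - x) * (1 - 3 * x)"
    using zero_le_power2[of "3 * x - 2"] by (simp add: algebra_simps power2_eq_square)
  ultimately show ?thesis unfolding x_def[symmetric] abs_le_iff mult.assoc by linarith
qed

lemma integrable_std_gaussian_abs: "integrable std_gaussian (\<lambda>z. K * \<bar>z\<bar>)"
  using abs_le_exp_abs
  by (intro integrable_mult_right integrable_std_gaussian_exp_bound[of _ 1 1]) auto

text \<open>Gaussian integration by parts turns the derivative in \<open>s\<close> into \<open>s\<close> times the mean of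
  \<open>(tanh\<^sup>2)''\<close>, which is bounded by \<open>2\<close>. So the Gaussian mean of \<open>tanh\<^sup>2\<close> is 1-Lipschitz as a function
  of the variance \<open>s\<^sup>2\<close>.\<close>

lemma gaussian_tanh_sq_lipschitz:
  fixes s r h :: real
  assumes "0 \<le> s" "0 \<le> r"
  shows "\<bar>(LINT z|std_gaussian. (tanh (s * z + h))\<^sup>2) - (LINT z|std_gaussian. (tanh (r * z + h))\<^sup>2)\<bar>
    \<le> \<bar>s\<^sup>2 - r\<^sup>2\<bar>"
proof -
  interpret prob_space std_gaussian by (rule prob_space_std_gaussian)
  define T where "T = (\<lambda>s. LINT z|std_gaussian. (tanh (s * z + h))\<^sup>2)"
  define \<phi>1 where "\<phi>1 = (\<lambda>z::real. 2 * tanh z * (1 - (tanh z)\<^sup>2))"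
  define \<phi>2 where "\<phi>2 = (\<lambda>z::real. 2 * (1 - (tanh z)\<^sup>2) * (1 - 3 * (tanh z)\<^sup>2))"
  have d1: "((\<lambda>z. (tanh z)\<^sup>2) has_real_derivative \<phi>1 z) (at z)" for z :: real
    unfolding \<phi>1_def by (rule tanh_sq_deriv)
  have d2: "(\<phi>1 has_real_derivative \<phi>2 z) (at z)" for z :: real
    unfolding \<phi>1_def \<phi>2_def by (rule tanh_sq_deriv2)
  have b1: "\<bar>\<phi>1 z\<bar> \<le> 2" and b2: "\<bar>\<phi>2 z\<bar> \<le> 2" for z
    unfolding \<phi>1_def \<phi>2_def by (rule tanh_sq_deriv_bound tanh_sq_deriv2_bound)+
  have c2: "isCont \<phi>2 z" for z
    unfolding \<phi>2_def by (intro continuous_intros) auto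
  have [measurable]: "\<phi>1 \<in> borel_measurable borel" "\<phi>2 \<in> borel_measurable borel"
    "(tanh :: real \<Rightarrow> real) \<in> borel_measurable borel"
    by (intro borel_measurable_continuous_onI continuous_at_imp_continuous_on ballI
        DERIV_isCont[OF d2] c2 isCont_tanh cosh_real_nonzero)+
  have dT: "(T has_real_derivative (LINT z|std_gaussian. s * \<phi>2 (s * z + h))) (at s)" for s
  proof -
    have "(T has_real_derivative (LINT z|std_gaussian. z * \<phi>1 (s * z + h))) (at s)"
      unfolding T_def
    proof (rule has_real_derivative_integral[where G = "\<lambda>z. 2 * \<bar>z\<bar>"])
      show "((\<lambda>s. (tanh (s * z + h))\<^sup>2) has_real_derivative z * \<phi>1 (s * z + h)) (at s)" for s z
        by (rule DERIV_cong[OF DERIV_chain2[OF d1]]) (auto intro!: derivative_eq_intros)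
      show "\<bar>z * \<phi>1 (s * z + h)\<bar> \<le> 2 * \<bar>z\<bar>" for s z
        using mult_left_mono[OF b1[of "s * z + h"], of "\<bar>z\<bar>"] by (simp add: abs_mult mult.commute)
      show "integrable std_gaussian (\<lambda>z. (tanh (s * z + h))\<^sup>2)" for s
        by (rule integrable_const_bound[of _ 1]) (auto simp: tanh_sq_le_1)
    qed (use integrable_std_gaussian_abs[of 2] in auto)
    also have "(LINT z|std_gaussian. z * \<phi>1 (s * z + h)) = (LINT z|std_gaussian. s * \<phi>2 (s * z + h))"
    proof (rule gaussian_ibp_1d[where K = "2 * (\<bar>s\<bar> + 1)" and c = 0])
      show "((\<lambda>z. \<phi>1 (s * z + h)) has_real_derivative s * \<phi>2 (s * z + h)) (at z)" for z
        by (rule DERIV_cong[OF DERIV_chain2[OF d2]]) (auto intro!: derivative_eq_intros)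
      show "isCont (\<lambda>z. s * \<phi>2 (s * z + h)) z" for z
        by (intro continuous_intros isCont_o2[OF _ c2])
      show "\<bar>\<phi>1 (s * z + h)\<bar> \<le> 2 * (\<bar>s\<bar> + 1) * exp (0 * \<bar>z\<bar>)" for z
        using b1[of "s * z + h"] by simp
      show "\<bar>s * \<phi>2 (s * z + h)\<bar> \<le> 2 * (\<bar>s\<bar> + 1) * exp (0 * \<bar>z\<bar>)" for z
        using mult_left_mono[OF b2[of "s * z + h"], of "\<bar>s\<bar>"] by (simp add: abs_mult)
    qed
    finally show ?thesis .
  qed
  have bT: "\<bar>LINT z|std_gaussian. s * \<phi>2 (s * z + h)\<bar> \<le> 2 * s" if "0 \<le> s" for s
  proof -
    have "\<bar>LINT z|std_gaussian. s * \<phi>2 (s * z + h)\<bar> \<le> (LINT z|std_gaussian. 2 * s)"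
    proof (rule integral_abs_bound[THEN order_trans], rule integral_mono)
      have "integrable std_gaussian (\<lambda>z. s * \<phi>2 (s * z + h))"
        using b2 that by (intro integrable_const_bound[of _ "2 * s"])
          (auto simp: abs_mult mult.commute[of _ s] intro!: AE_I2 mult_left_mono)
      then show "integrable std_gaussian (\<lambda>z. \<bar>s * \<phi>2 (s * z + h)\<bar>)" by (rule integrable_abs)
      show "\<bar>s * \<phi>2 (s * z + h)\<bar> \<le> 2 * s" for z
        using mult_left_mono[OF b2[of "s * z + h"], of s] that by (simp add: abs_mult)
    qed simp
    then show ?thesis using prob_space by simp
  qed
  have mono: "\<bar>T b - T a\<bar> \<le> b\<^sup>2 - a\<^sup>2" if "0 \<le> a" "a \<le> b" for a b
  proof -
    have "(\<lambda>x. x\<^sup>2 - T x) a \<le> (\<lambda>x. x\<^sup>2 - T x) b"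
    proof (rule DERIV_nonneg_imp_nondecreasing[OF that(2)])
      fix x assume "a \<le> x" "x \<le> b"
      then show "\<exists>y. ((\<lambda>x. x\<^sup>2 - T x) has_real_derivative y) (at x) \<and> 0 \<le> y"
        using bT[of x] that
        by (intro exI[of _ "2 * x - (LINT z|std_gaussian. x * \<phi>2 (x * z + h))"] conjI)
          (auto intro!: derivative_eq_intros dT simp del: integral_mult_right_zero)
    qed
    moreover have "(\<lambda>x. x\<^sup>2 + T x) a \<le> (\<lambda>x. x\<^sup>2 + T x) b"
    proof (rule DERIV_nonneg_imp_nondecreasing[OF that(2)])
      fix x assume "a \<le> x" "x \<le> b"
      then show "\<exists>y. ((\<lambda>x. x\<^sup>2 + T x) has_real_derivative y) (at x) \<and> 0 \<le> y"
        using bT[of x] that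
        by (intro exI[of _ "2 * x + (LINT z|std_gaussian. x * \<phi>2 (x * z + h))"] conjI)
          (auto intro!: derivative_eq_intros dT simp del: integral_mult_right_zero)
    qed
    ultimately show ?thesis by (simp add: abs_le_iff)
  qed
  show ?thesis
    using mono[of s r] mono[of r s] assms unfolding T_def by (cases "s \<le> r") auto
qed

text \<open>By the Lipschitz bound the right-hand side is a contraction in \<open>q\<close> with constant \<open>\<beta>\<^sup>2\<close>, so the
  definite description in the definition of \<open>overlap_q\<close> denotes its fixed point.\<close>

lemma overlap_q_fixed_point:
  assumes "0 < \<beta>" "\<beta> < 1"
  shows "0 \<le> overlap_q \<beta> h"
    and "overlap_q \<beta> h = (LINT z|std_gaussian. (tanh (\<beta> * z * sqrt (overlap_q \<beta> h) + h))\<^sup>2)"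
    and "overlap_q \<beta> h \<le> 1"
proof -
  interpret prob_space std_gaussian by (rule prob_space_std_gaussian)
  define \<Phi> where "\<Phi> = (\<lambda>q. LINT z|std_gaussian. (tanh (\<beta> * z * sqrt q + h))\<^sup>2)"
  have \<Phi>_alt: "\<Phi> q = (LINT z|std_gaussian. (tanh (\<beta> * sqrt q * z + h))\<^sup>2)" for q
    by (simp add: \<Phi>_def mult_ac)
  have [measurable]: "(tanh :: real \<Rightarrow> real) \<in> borel_measurable borel"
    by (intro borel_measurable_continuous_onI continuous_intros) auto
  have \<Phi>0: "0 \<le> \<Phi> q" for q
    unfolding \<Phi>_def by (intro Bochner_Integration.integral_nonneg) auto
  have "\<exists>!q. q \<in> {0..} \<and> \<Phi> q = q"
  proof (rule Banach_fix[OF complete_eq_closed[THEN iffD2, OF closed_atLeast], where c = "\<beta>\<^sup>2"])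
    show "\<beta>\<^sup>2 < 1" using assms by (simp add: abs_square_less_1)
    show "\<Phi> ` {0..} \<subseteq> {0..}" using \<Phi>0 by auto
    show "dist (\<Phi> q) (\<Phi> r) \<le> \<beta>\<^sup>2 * dist q r" if "q \<in> {0..}" "r \<in> {0..}" for q r
    proof -
      have "dist (\<Phi> q) (\<Phi> r) \<le> \<bar>(\<beta> * sqrt q)\<^sup>2 - (\<beta> * sqrt r)\<^sup>2\<bar>"
        unfolding \<Phi>_alt dist_real_def using that assms by (intro gaussian_tanh_sq_lipschitz) auto
      also have "\<dots> = \<beta>\<^sup>2 * dist q r"
        using that by (simp add: power_mult_distrib dist_real_def right_diff_distrib[symmetric] abs_mult)
      finally show ?thesis .
    qed
  qed auto
  then have "\<exists>!q. 0 \<le> q \<and> q = \<Phi> q" by (auto simp: eq_commute)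
  from theI'[OF this] have *: "0 \<le> overlap_q \<beta> h" "overlap_q \<beta> h = \<Phi> (overlap_q \<beta> h)"
    unfolding overlap_q_def \<Phi>_def by auto
  show "0 \<le> overlap_q \<beta> h"
    and "overlap_q \<beta> h = (LINT z|std_gaussian. (tanh (\<beta> * z * sqrt (overlap_q \<beta> h) + h))\<^sup>2)"
    using * unfolding \<Phi>_def by auto
  have "\<Phi> (overlap_q \<beta> h) \<le> (LINT z|std_gaussian. 1)"
    unfolding \<Phi>_def by (intro integral_mono integrable_const_bound[of _ 1]) (auto simp: tanh_sq_le_1)
  then show "overlap_q \<beta> h \<le> 1" using * prob_space by simp
qed

section \<open>Finite Gibbs measures with Gaussian disorder\<close>

definition gibbs :: "'s set \<Rightarrow> ('s \<Rightarrow> real) \<Rightarrow> ('s \<Rightarrow> real) \<Rightarrow> real" where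
  "gibbs S A f = (\<Sum>x\<in>S. f x * exp (A x)) / (\<Sum>x\<in>S. exp (A x))"

lemma partition_sum_pos: "finite S \<Longrightarrow> S \<noteq> {} \<Longrightarrow> 0 < (\<Sum>x\<in>S. exp (A x :: real))"
  by (intro sum_pos) auto

lemma gibbs_cong:
  assumes "\<And>x. x \<in> S \<Longrightarrow> A x = B x" "\<And>x. x \<in> S \<Longrightarrow> f x = g x"
  shows "gibbs S A f = gibbs S B g"
  unfolding gibbs_def using assms by (auto intro!: arg_cong2[where f = "(/)"] sum.cong)

lemma gibbs_mono:
  assumes "finite S" "S \<noteq> {}" "\<And>x. x \<in> S \<Longrightarrow> f x \<le> g x"
  shows "gibbs S A f \<le> gibbs S A g"
  unfolding gibbs_def using partition_sum_pos[OF assms(1,2), of A] assms(3)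
  by (intro divide_right_mono sum_mono mult_right_mono) auto

lemma gibbs_mult: "gibbs S A (\<lambda>x. c * f x) = c * gibbs S A f"
  unfolding gibbs_def by (simp add: sum_distrib_left mult.assoc)

text \<open>This separates the test function from the disorder, so that an expectation over the disorder acts only
  on the weights.\<close>

lemma gibbs_as_sum: 
  "finite S \<Longrightarrow> gibbs S A f = (\<Sum>x\<in>S. f x * gibbs S A (\<lambda>y. if y = x then 1 else 0))"
proof -
  assume S: "finite S"
  have "gibbs S A (\<lambda>y. if y = x then 1 else 0) = exp (A x) / (\<Sum>x\<in>S. exp (A x))" if "x \<in> S" for x
    using S that by (simp add: gibbs_def if_distrib[of "\<lambda>t. t * _"] sum.delta cong: if_cong)
  then show ?thesis by (simp add: gibbs_def sum_divide_distrib)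
qed

lemma gibbs_abs_le:
  assumes "finite S" "S \<noteq> {}" "\<And>x. x \<in> S \<Longrightarrow> \<bar>f x\<bar> \<le> B"
  shows "\<bar>gibbs S A f\<bar> \<le> B"
proof -
  have Z: "0 < (\<Sum>x\<in>S. exp (A x))" by (rule partition_sum_pos[OF assms(1,2)])
  have "\<bar>\<Sum>x\<in>S. f x * exp (A x)\<bar> \<le> (\<Sum>x\<in>S. B * exp (A x))"
    using assms(3) by (intro sum_abs[THEN order_trans] sum_mono) (simp add: abs_mult)
  then show ?thesis
    using Z by (simp add: gibbs_def abs_div_pos[OF Z, symmetric] divide_le_eq sum_distrib_left[symmetric])
qed

lemma gibbs_deriv:
  assumes S: "finite S" "S \<noteq> {}"
    and A: "\<And>x. x \<in> S \<Longrightarrow> ((\<lambda>t. A t x) has_real_derivative A' x) (at t)"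
    and f: "\<And>x. x \<in> S \<Longrightarrow> ((\<lambda>t. f t x) has_real_derivative f' x) (at t)"
  shows "((\<lambda>t. gibbs S (A t) (f t)) has_real_derivative
     gibbs S (A t) f' + gibbs S (A t) (\<lambda>x. f t x * A' x) - gibbs S (A t) (f t) * gibbs S (A t) A') (at t)"
proof -
  let ?Z = "\<Sum>x\<in>S. exp (A t x)"
  have Z: "?Z > 0" by (rule partition_sum_pos[OF S])
  have "((\<lambda>t. \<Sum>x\<in>S. f t x * exp (A t x)) has_real_derivative
      (\<Sum>x\<in>S. f' x * exp (A t x) + f t x * A' x * exp (A t x))) (at t)"
    by (rule DERIV_sum) (auto intro!: derivative_eq_intros A f simp: algebra_simps)
  moreover have "((\<lambda>t. \<Sum>x\<in>S. exp (A t x)) has_real_derivative (\<Sum>x\<in>S. A' x * exp (A t x))) (at t)"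
    by (rule DERIV_sum) (auto intro!: derivative_eq_intros A)
  ultimately have "((\<lambda>t. gibbs S (A t) (f t)) has_real_derivative
      ((\<Sum>x\<in>S. f' x * exp (A t x) + f t x * A' x * exp (A t x)) * ?Z
        - (\<Sum>x\<in>S. f t x * exp (A t x)) * (\<Sum>x\<in>S. A' x * exp (A t x))) / (?Z * ?Z)) (at t)"
    unfolding gibbs_def using Z by (intro DERIV_divide) auto
  then show ?thesis
    by (rule DERIV_cong) (use Z in \<open>simp add: gibbs_def sum.distrib field_simps\<close>)
qed

lemma gibbs_isCont:
  assumes S: "finite S" "S \<noteq> {}"
    and A: "\<And>x. x \<in> S \<Longrightarrow> isCont (\<lambda>t. A t x) t"
  shows "isCont (\<lambda>t. gibbs S (A t) f) t"
  unfolding gibbs_def using partition_sum_pos[OF S, of "A t"]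
  by (intro continuous_intros A) auto

lemma gibbs_measurable:
  assumes "\<And>x. x \<in> S \<Longrightarrow> (\<lambda>\<omega>. A \<omega> x) \<in> borel_measurable M"
  shows "(\<lambda>\<omega>. gibbs S (A \<omega>) f) \<in> borel_measurable M"
  unfolding gibbs_def
  by (intro borel_measurable_divide borel_measurable_sum borel_measurable_times
      borel_measurable_const measurable_compose[OF _ borel_measurable_exp] assms)

text \<open>Two replicas under the same energy are independent.\<close>

lemma gibbs_pair:
  assumes "finite C" "C \<noteq> {}" "\<And>a. a \<in> C \<times> C \<Longrightarrow> B a = A (fst a) + A (snd a)"
  defines "w \<equiv> \<lambda>x. exp (A x) / (\<Sum>y\<in>C. exp (A y))"
  shows "gibbs (C \<times> C) B f = (\<Sum>a\<in>C \<times> C. w (fst a) * w (snd a) * f a)"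
proof -
  let ?Z = "\<Sum>y\<in>C. exp (A y)"
  have Z: "?Z > 0" by (rule partition_sum_pos[OF assms(1,2)])
  have "(\<Sum>a\<in>C \<times> C. exp (B a)) = ?Z * ?Z"
    using assms(3) by (simp add: sum_product sum.cartesian_product exp_add case_prod_unfold)
  moreover have "(\<Sum>a\<in>C \<times> C. f a * exp (B a)) = (\<Sum>a\<in>C \<times> C. f a * (exp (A (fst a)) * exp (A (snd a))))"
    by (intro sum.cong refl) (simp add: assms(3) exp_add)
  ultimately show ?thesis
    unfolding gibbs_def w_def by (simp add: sum_divide_distrib mult_ac)
qed

lemma softmax_prob:
  assumes "finite C" "C \<noteq> {}"
  shows "0 \<le> exp (A x) / (\<Sum>y\<in>C. exp (A y :: real))" "(\<Sum>x\<in>C. exp (A x) / (\<Sum>y\<in>C. exp (A y))) = 1"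
  using partition_sum_pos[OF assms, of A] by (auto simp: sum_divide_distrib[symmetric])

lemma pair_weights_prob:
  fixes w :: "'s \<Rightarrow> real"
  assumes "\<And>x. x \<in> C \<Longrightarrow> 0 \<le> w x" "(\<Sum>x\<in>C. w x) = 1"
  shows "\<And>a. a \<in> C \<times> C \<Longrightarrow> 0 \<le> w (fst a) * w (snd a)" "(\<Sum>a\<in>C \<times> C. w (fst a) * w (snd a)) = 1"
proof -
  have "(\<Sum>a\<in>C \<times> C. w (fst a) * w (snd a)) = (\<Sum>x\<in>C. w x) * (\<Sum>x\<in>C. w x)"
    by (simp only: sum_product sum.cartesian_product case_prod_unfold)
  then show "(\<Sum>a\<in>C \<times> C. w (fst a) * w (snd a)) = 1" using assms by simp
qed (use assms in auto)

text \<open>The joint cumulant of \<open>f\<close>, \<open>e\<close> and \<open>e\<close> for the mean \<open>M\<close>. For a Gibbs average it is the derivative of the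
  covariance of \<open>f\<close> and \<open>e\<close> when the energy is tilted by \<open>e\<close>.\<close>

definition third_cumulant ::
    "(('s \<Rightarrow> real) \<Rightarrow> real) \<Rightarrow> ('s \<Rightarrow> real) \<Rightarrow> ('s \<Rightarrow> real) \<Rightarrow> real" where
  "third_cumulant M f e = M (\<lambda>x. f x * (e x)\<^sup>2) - 2 * M (\<lambda>x. f x * e x) * M e
     - M f * M (\<lambda>x. (e x)\<^sup>2) + 2 * M f * (M e)\<^sup>2"

text \<open>Interpolation along a path of Gaussian energies. Differentiating the energy produces factors that are
  linear in the disorder; integration by parts in each variable removes them and leaves third cumulants, weighted
  with \<open>c c'\<close>, half the derivative of the variance \<open>c\<^sup>2\<close> of the variable.\<close>

lemma gaussian_gibbs_interpolation:
  fixes c c' :: "real \<Rightarrow> 'i \<Rightarrow> real" and e :: "'s \<Rightarrow> 'i \<Rightarrow> real" and f f' :: "real \<Rightarrow> 's \<Rightarrow> real"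
    and b :: "'s \<Rightarrow> real"
  assumes I: "finite I" and S: "finite S" "S \<noteq> {}"
    and c: "\<And>t p. p \<in> I \<Longrightarrow> ((\<lambda>t. c t p) has_real_derivative c' t p) (at t)"
    and f: "\<And>t x. x \<in> S \<Longrightarrow> ((\<lambda>t. f t x) has_real_derivative f' t x) (at t)"
    and bc: "\<And>t p. p \<in> I \<Longrightarrow> \<bar>c' t p\<bar> \<le> B"
    and be: "\<And>x p. x \<in> S \<Longrightarrow> p \<in> I \<Longrightarrow> \<bar>e x p\<bar> \<le> B"
    and bf: "\<And>t x. x \<in> S \<Longrightarrow> \<bar>f t x\<bar> \<le> B" "\<And>t x. x \<in> S \<Longrightarrow> \<bar>f' t x\<bar> \<le> B"
  defines "G \<equiv> \<lambda>t \<omega>. gibbs S (\<lambda>x. (\<Sum>p\<in>I. c t p * e x p * \<omega> p) + b x)"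
  shows "((\<lambda>t. LINT \<omega>|gaussians I. G t \<omega> (f t)) has_real_derivative
     (LINT \<omega>|gaussians I. G t \<omega> (f' t) + (\<Sum>p\<in>I. c t p * c' t p *
        third_cumulant (G t \<omega>) (f t) (\<lambda>x. e x p)))) (at t)"
proof -
  interpret prob_space "gaussians I" by (rule prob_space_gaussians)
  obtain x0 where x0: "x0 \<in> S" using S by auto
  have B0: "0 \<le> B" using bf(1)[OF x0, of 0] by linarith
  have Gmeas: "(\<lambda>\<omega>. G t \<omega> g) \<in> borel_measurable (gaussians I)" for t g
    unfolding G_def
    by (intro gibbs_measurable borel_measurable_add borel_measurable_const linear_form_measurable)
  have Gbound: "\<bar>G t \<omega> g\<bar> \<le> K" if "\<And>x. x \<in> S \<Longrightarrow> \<bar>g x\<bar> \<le> K" for t \<omega> g K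
    unfolding G_def by (rule gibbs_abs_le[OF S that])
  have Gbounded: "\<exists>K. \<forall>\<omega>. \<bar>G t \<omega> g\<bar> \<le> K" for t g
    using Gbound[of g "\<Sum>x\<in>S. \<bar>g x\<bar>" t, OF member_le_sum[of _ S "\<lambda>x. \<bar>g x\<bar>"]] S(1) by fastforce
  have Ggrowth: "exp_growth I (\<lambda>\<omega>. G t \<omega> g)" for t g
    using Gbounded[of t g] exp_growth_bounded[of "\<lambda>\<omega>. G t \<omega> g"] by blast
  have Gderiv: "((\<lambda>z. G t (x(p := z)) g) has_real_derivative
      c t p * (G t x (\<lambda>y. g y * e y p) - G t x g * G t x (\<lambda>y. e y p))) (at (x p))"
    if p: "p \<in> I" for t x p g
  proof -
    have "((\<lambda>z. G t (x(p := z)) g) has_real_derivative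
      G t (x(p := x p)) (\<lambda>y. 0) + G t (x(p := x p)) (\<lambda>y. g y * (c t p * e y p))
       - G t (x(p := x p)) g * G t (x(p := x p)) (\<lambda>y. c t p * e y p)) (at (x p))"
      unfolding G_def
      by (rule gibbs_deriv[OF S DERIV_cong[OF DERIV_add[OF linear_form_deriv[OF I p] DERIV_const]] DERIV_const])
         simp
    then show ?thesis
      by (rule DERIV_cong) (simp add: G_def gibbs_def sum_distrib_left field_simps)
  qed
  have Gcont: "isCont (\<lambda>z. G t (x(p := z)) g) z" if p: "p \<in> I" for t x p g z
    using DERIV_isCont[OF Gderiv[OF p, of t "x(p := z)" g]] by simp
  have Gint: "integrable (gaussians I) (\<lambda>\<omega>. G t \<omega> g)" for t g
    by (rule exp_growth_integrable[OF I Gmeas Ggrowth])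
  define F where "F = (\<lambda>t \<omega> p. G t \<omega> (\<lambda>x. f t x * e x p) - G t \<omega> (f t) * G t \<omega> (\<lambda>x. e x p))"
  have Fmeas: "(\<lambda>\<omega>. F t \<omega> p) \<in> borel_measurable (gaussians I)" for t p
    unfolding F_def by (intro borel_measurable_diff borel_measurable_times Gmeas)
  have Fgrowth: "exp_growth I (\<lambda>\<omega>. F t \<omega> p)" for t p
    unfolding F_def by (intro exp_growth_diff exp_growth_mult Ggrowth)
  have Fbound: "\<bar>F t \<omega> p\<bar> \<le> 2 * B\<^sup>2" if p: "p \<in> I" for t \<omega> p
  proof -
    have "\<bar>G t \<omega> (\<lambda>x. f t x * e x p)\<bar> \<le> B * B"
      by (rule Gbound) (use bf be p B0 in \<open>auto simp: abs_mult intro!: mult_mono\<close>)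
    moreover have "\<bar>G t \<omega> (f t) * G t \<omega> (\<lambda>x. e x p)\<bar> \<le> B * B"
      unfolding abs_mult using bf be p B0 by (intro mult_mono Gbound) auto
    ultimately show ?thesis
      unfolding F_def power2_eq_square
      using abs_triangle_ineq4[of "G t \<omega> (\<lambda>x. f t x * e x p)" "G t \<omega> (f t) * G t \<omega> (\<lambda>x. e x p)"]
      by linarith
  qed
  have "((\<lambda>t. LINT \<omega>|gaussians I. G t \<omega> (f t)) has_real_derivative
      (LINT \<omega>|gaussians I. G t \<omega> (f' t) + (\<Sum>p\<in>I. c' t p * (\<omega> p * F t \<omega> p)))) (at t)"
  proof (rule has_real_derivative_integral[where G = "\<lambda>\<omega>. B + (\<Sum>p\<in>I. B * (2 * B\<^sup>2) * \<bar>\<omega> p\<bar>)"])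
    fix t \<omega>
    have "((\<lambda>t. G t \<omega> (f t)) has_real_derivative
        G t \<omega> (f' t) + G t \<omega> (\<lambda>x. f t x * (\<Sum>p\<in>I. c' t p * e x p * \<omega> p))
        - G t \<omega> (f t) * G t \<omega> (\<lambda>x. \<Sum>p\<in>I. c' t p * e x p * \<omega> p)) (at t)"
      unfolding G_def
      by (rule gibbs_deriv[OF S])
         (auto intro!: f derivative_eq_intros DERIV_sum c simp: mult_ac)
    also have "G t \<omega> (\<lambda>x. f t x * (\<Sum>p\<in>I. c' t p * e x p * \<omega> p))
        = (\<Sum>p\<in>I. c' t p * \<omega> p * G t \<omega> (\<lambda>x. f t x * e x p))"
      unfolding G_def gibbs_def
      by (simp add: sum_distrib_left sum_distrib_right sum_divide_distrib mult_ac)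
         (rule sum.swap)
    also have "G t \<omega> (\<lambda>x. \<Sum>p\<in>I. c' t p * e x p * \<omega> p)
        = (\<Sum>p\<in>I. c' t p * \<omega> p * G t \<omega> (\<lambda>x. e x p))"
      unfolding G_def gibbs_def
      by (simp add: sum_distrib_left sum_distrib_right sum_divide_distrib mult_ac)
         (rule sum.swap)
    finally show "((\<lambda>t. G t \<omega> (f t)) has_real_derivative
        G t \<omega> (f' t) + (\<Sum>p\<in>I. c' t p * (\<omega> p * F t \<omega> p))) (at t)"
      by (rule DERIV_cong)
         (simp add: F_def sum_distrib_left sum_subtractf right_diff_distrib mult_ac)
    have "\<bar>\<Sum>p\<in>I. c' t p * (\<omega> p * F t \<omega> p)\<bar> \<le> (\<Sum>p\<in>I. B * (2 * B\<^sup>2) * \<bar>\<omega> p\<bar>)"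
    proof (rule sum_abs[THEN order_trans], rule sum_mono)
      fix p assume p: "p \<in> I"
      have "\<bar>c' t p\<bar> * \<bar>F t \<omega> p\<bar> * \<bar>\<omega> p\<bar> \<le> B * (2 * B\<^sup>2) * \<bar>\<omega> p\<bar>"
        using bc[OF p] Fbound[OF p] B0 by (intro mult_mono) auto
      then show "\<bar>c' t p * (\<omega> p * F t \<omega> p)\<bar> \<le> B * (2 * B\<^sup>2) * \<bar>\<omega> p\<bar>"
        by (simp add: abs_mult mult_ac)
    qed
    then show "\<bar>G t \<omega> (f' t) + (\<Sum>p\<in>I. c' t p * (\<omega> p * F t \<omega> p))\<bar>
        \<le> B + (\<Sum>p\<in>I. B * (2 * B\<^sup>2) * \<bar>\<omega> p\<bar>)"
      using Gbound[of "f' t" B t \<omega>] bf(2) by (smt (verit))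
  next
    fix t
    show "integrable (gaussians I) (\<lambda>\<omega>. B + (\<Sum>p\<in>I. B * (2 * B\<^sup>2) * \<bar>\<omega> p\<bar>))"
      using I by (intro Bochner_Integration.integrable_add Bochner_Integration.integrable_sum
          integrable_mult_right integrable_abs exp_growth_integrable gaussians_component
          exp_growth_component) auto
    show "integrable (gaussians I) (\<lambda>\<omega>. G t \<omega> (f t))" by (rule Gint)
    show "(\<lambda>\<omega>. G t \<omega> (f' t) + (\<Sum>p\<in>I. c' t p * (\<omega> p * F t \<omega> p))) \<in> borel_measurable (gaussians I)"
      by (intro borel_measurable_add borel_measurable_sum borel_measurable_times
          borel_measurable_const gaussians_component Gmeas Fmeas)
  qed
  also have "(LINT \<omega>|gaussians I. G t \<omega> (f' t) + (\<Sum>p\<in>I. c' t p * (\<omega> p * F t \<omega> p)))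
    = (LINT \<omega>|gaussians I. G t \<omega> (f' t)) + (\<Sum>p\<in>I. c' t p * (LINT \<omega>|gaussians I. \<omega> p * F t \<omega> p))"
  proof -
    have i: "integrable (gaussians I) (\<lambda>\<omega>. \<omega> p * F t \<omega> p)" if p: "p \<in> I" for p
      by (rule exp_growth_integrable[OF I _ exp_growth_mult[OF exp_growth_component[OF I p] Fgrowth]])
         (intro borel_measurable_times gaussians_component p Fmeas)
    show ?thesis
      by (subst Bochner_Integration.integral_add)
         (auto simp: Bochner_Integration.integral_sum i Gint)
  qed
  also have "(\<Sum>p\<in>I. c' t p * (LINT \<omega>|gaussians I. \<omega> p * F t \<omega> p)) =
     (\<Sum>p\<in>I. c' t p * (LINT \<omega>|gaussians I. c t p *
        third_cumulant (G t \<omega>) (f t) (\<lambda>x. e x p)))"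
  proof (intro sum.cong refl arg_cong2[where f = "(*)"] gaussian_ibp[OF I])
    fix p assume p: "p \<in> I"
    show "p \<in> I" by (rule p)
    show "(\<lambda>\<omega>. F t \<omega> p) \<in> borel_measurable (gaussians I)" by (rule Fmeas)
    show "exp_growth I (\<lambda>\<omega>. F t \<omega> p)" by (rule Fgrowth)
    show "(\<lambda>\<omega>. c t p *
        third_cumulant (G t \<omega>) (f t) (\<lambda>x. e x p))
       \<in> borel_measurable (gaussians I)"
      unfolding third_cumulant_def
      by (intro borel_measurable_diff borel_measurable_add borel_measurable_times
          borel_measurable_power borel_measurable_const Gmeas)
    show "exp_growth I (\<lambda>\<omega>. c t p *
        third_cumulant (G t \<omega>) (f t) (\<lambda>x. e x p))"
      unfolding third_cumulant_def power2_eq_square[of "G t _ _"]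
      by (intro exp_growth_diff exp_growth_add exp_growth_mult exp_growth_const Ggrowth)
    fix x
    show "((\<lambda>z. F t (x(p := z)) p) has_real_derivative c t p *
        third_cumulant (G t x) (f t) (\<lambda>y. e y p)) (at (x p))"
      unfolding F_def third_cumulant_def
      by (rule DERIV_cong, (rule DERIV_diff DERIV_mult Gderiv[OF p])+)
         (simp add: power2_eq_square algebra_simps)
    fix z
    show "isCont (\<lambda>z. c t p *
        third_cumulant (G t (x(p := z))) (f t) (\<lambda>y. e y p)) z"
      unfolding third_cumulant_def by (intro continuous_intros Gcont[OF p])
  qed
  also have "(LINT \<omega>|gaussians I. G t \<omega> (f' t)) + (\<Sum>p\<in>I. c' t p * (LINT \<omega>|gaussians I. c t p *
        third_cumulant (G t \<omega>) (f t) (\<lambda>x. e x p)))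
    = (LINT \<omega>|gaussians I. G t \<omega> (f' t) + (\<Sum>p\<in>I. c t p * c' t p *
        third_cumulant (G t \<omega>) (f t) (\<lambda>x. e x p)))"
  proof -
    have i: "integrable (gaussians I) (\<lambda>\<omega>. third_cumulant (G t \<omega>) (f t) (\<lambda>x. e x p))" for p
      unfolding third_cumulant_def power2_eq_square[of "G t _ _"]
      by (intro exp_growth_integrable[OF I] borel_measurable_diff borel_measurable_add borel_measurable_times
          borel_measurable_power borel_measurable_const Gmeas 
          exp_growth_diff exp_growth_add exp_growth_mult exp_growth_const Ggrowth)
    have "integral\<^sup>L (gaussians I) A + (\<Sum>p\<in>I. c' t p * (LINT \<omega>|gaussians I. c t p * E p \<omega>))
        = (LINT \<omega>|gaussians I. A \<omega> + (\<Sum>p\<in>I. c t p * c' t p * E p \<omega>))"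
      if "integrable (gaussians I) A" "\<And>p. integrable (gaussians I) (E p)" for A E
      using that by (simp add: Bochner_Integration.integral_sum mult_ac)
    from this[OF Gint i] show ?thesis .
  qed
  finally show ?thesis .
qed

lemma exp_monotone_product:
  assumes "0 \<le> (k::real)"
  shows "0 \<le> (x - y) * (exp (k * x) - exp (k * y))"
proof (cases "x \<le> y")
  case True
  then show ?thesis using assms by (intro mult_nonpos_nonpos) (auto intro: mult_left_mono)
next
  case False
  then show ?thesis using assms by (intro mult_nonneg_nonneg) (auto intro: mult_left_mono)
qed

text \<open>Chebyshev's association inequality, by expanding the nonnegative double sum of
  \<open>(v a - v b) (f a - f b)\<close>.\<close>

lemma chebyshev_weighted:
  fixes W f v :: "'a \<Rightarrow> real"
  assumes W: "\<And>a. a \<in> S \<Longrightarrow> 0 \<le> W a" "(\<Sum>a\<in>S. W a) = 1"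
    and mono: "\<And>a b. a \<in> S \<Longrightarrow> b \<in> S \<Longrightarrow> 0 \<le> (v a - v b) * (f a - f b)"
  shows "(\<Sum>a\<in>S. W a * f a) * (\<Sum>a\<in>S. W a * v a) \<le> (\<Sum>a\<in>S. W a * (f a * v a))"
proof -
  have "0 \<le> (\<Sum>a\<in>S. \<Sum>b\<in>S. W a * W b * ((v a - v b) * (f a - f b)))"
    by (intro sum_nonneg mult_nonneg_nonneg W(1) mono)
  also have "\<dots> = (\<Sum>a\<in>S. \<Sum>b\<in>S. W a * (f a * v a) * W b) + (\<Sum>a\<in>S. \<Sum>b\<in>S. W a * (W b * (f b * v b)))
      - (\<Sum>a\<in>S. \<Sum>b\<in>S. (W a * f a) * (W b * v b)) - (\<Sum>a\<in>S. \<Sum>b\<in>S. (W a * v a) * (W b * f b))"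
    by (simp add: sum.distrib[symmetric] sum_subtractf[symmetric] algebra_simps)
  also have "\<dots> = 2 * (\<Sum>a\<in>S. W a * (f a * v a)) - 2 * ((\<Sum>a\<in>S. W a * f a) * (\<Sum>a\<in>S. W a * v a))"
    by (simp only: sum_product[symmetric] W(2)) (simp add: algebra_simps)
  finally show ?thesis by simp
qed

text \<open>The integrand of the interpolation formula for a system of pairs of replicas, when the covariance of the
  energy is a square \<open>A u\<^sup>2\<close> up to a constant. Replicas 1 and 2 carry the test function \<open>f\<close>. The terms
  that couple one of them to a third replica have a negative sign and are dropped, the constants cancel,
  and the term of a fresh pair 3, 4 is reduced to the pair 1, 2 by Chebyshev's inequality, as \<open>f\<close> increases
  with \<open>u\<^sup>2\<close>. This turns the coefficients \<open>2 + 6\<close> into the constant \<open>8\<close>.\<close>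

lemma replica_interpolation_bound:
  fixes w :: "'s \<Rightarrow> real" and e :: "'s \<Rightarrow> 'i \<Rightarrow> real" and \<kappa> :: "'i \<Rightarrow> real" and u f :: "'s \<times> 's \<Rightarrow> real"
  assumes w: "\<And>x. x \<in> C \<Longrightarrow> 0 \<le> w x" "(\<Sum>x\<in>C. w x) = 1"
    and K: "\<And>x y. x \<in> C \<Longrightarrow> y \<in> C \<Longrightarrow> (\<Sum>p\<in>I. \<kappa> p * e x p * e y p) = A * (u (x, y))\<^sup>2 - \<gamma>"
    and Kd: "\<And>x. x \<in> C \<Longrightarrow> (\<Sum>p\<in>I. \<kappa> p * e x p * e x p) = d"
    and A: "0 \<le> A"
    and f0: "\<And>a. a \<in> C \<times> C \<Longrightarrow> 0 \<le> f a"
    and mono: "\<And>a b. a \<in> C \<times> C \<Longrightarrow> b \<in> C \<times> C \<Longrightarrow> 0 \<le> ((u a)\<^sup>2 - (u b)\<^sup>2) * (f a - f b)"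
  defines "M \<equiv> \<lambda>g. \<Sum>a\<in>C \<times> C. w (fst a) * w (snd a) * g a"
  shows "(\<Sum>p\<in>I. \<kappa> p * third_cumulant M f (\<lambda>a. e (fst a) p + e (snd a) p)) \<le> 8 * A * M (\<lambda>a. f a * (u a)\<^sup>2)"
proof -
  have Madd: "M (\<lambda>a. g a + g' a) = M g + M g'" for g g'
    by (simp add: M_def distrib_left sum.distrib)
  have Mmult: "M (\<lambda>a. c * g a) = c * M g" for c g
    by (simp add: M_def sum_distrib_left mult_ac)
  have Msum: "M (\<lambda>a. \<Sum>p\<in>I. g p a) = (\<Sum>p\<in>I. M (g p))" for g
    unfolding M_def by (simp add: sum_distrib_left) (rule sum.swap)
  have Mcong: "M g = M g'" if "\<And>a. a \<in> C \<times> C \<Longrightarrow> g a = g' a" for g g'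
    unfolding M_def using that by (intro sum.cong) auto
  have Mmono: "M g \<le> M g'" if "\<And>a. a \<in> C \<times> C \<Longrightarrow> g a \<le> g' a" for g g'
    unfolding M_def using that pair_weights_prob(1)[of C w, OF w]
    by (intro sum_mono mult_left_mono) auto
  have M1: "M (\<lambda>a. c) = c" for c
    unfolding M_def using pair_weights_prob(2)[of C w, OF w] by (simp add: sum_distrib_right[symmetric])
  have Mfst: "M (\<lambda>a. g (fst a)) = (\<Sum>x\<in>C. w x * g x)" and Msnd: "M (\<lambda>a. g (snd a)) = (\<Sum>x\<in>C. w x * g x)" 
    and Mprod: "M (\<lambda>a. g (fst a) * g' (snd a)) = (\<Sum>x\<in>C. w x * g x) * (\<Sum>x\<in>C. w x * g' x)" for g g'
  proof -
    show *: "M (\<lambda>a. g (fst a) * g' (snd a)) = (\<Sum>x\<in>C. w x * g x) * (\<Sum>x\<in>C. w x * g' x)" for g g'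
      unfolding M_def sum_product sum.cartesian_product by (simp add: case_prod_unfold mult_ac)
    show "M (\<lambda>a. g (fst a)) = (\<Sum>x\<in>C. w x * g x)" 
      using *[of g "\<lambda>_. 1"] w(2) by simp
    show "M (\<lambda>a. g (snd a)) = (\<Sum>x\<in>C. w x * g x)" 
      using *[of "\<lambda>_. 1" g] w(2) by simp
  qed
  define m where "m = (\<lambda>p. \<Sum>x\<in>C. w x * e x p)"
  define s where "s = (\<lambda>p. \<Sum>x\<in>C. w x * (e x p)\<^sup>2)"
  define L where "L = (\<lambda>x. \<Sum>y\<in>C. w y * (\<Sum>p\<in>I. \<kappa> p * e x p * e y p))"
  have L: "- \<gamma> \<le> L x" if "x \<in> C" for x
  proof -
    have "(\<Sum>y\<in>C. w y * (- \<gamma>)) \<le> L x"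
      unfolding L_def using w(1) A that by (intro sum_mono mult_left_mono) (auto simp: K)
    then show ?thesis using w(2) by (simp add: sum_distrib_right[symmetric] sum_negf)
  qed
  have Lm: "(\<Sum>p\<in>I. \<kappa> p * m p * e x p) = L x" for x
    unfolding L_def m_def by (simp add: sum_distrib_left sum_distrib_right mult_ac) (rule sum.swap)
  have Mf0: "0 \<le> M f" using Mmono[of "\<lambda>_. 0" f] f0 M1[of 0] by simp
  have t1: "(\<Sum>p\<in>I. \<kappa> p * M (\<lambda>a. f a * (e (fst a) p + e (snd a) p)\<^sup>2))
      = 2 * d * M f + 2 * (A * M (\<lambda>a. f a * (u a)\<^sup>2) - \<gamma> * M f)"
  proof -
    have "(\<Sum>p\<in>I. \<kappa> p * M (\<lambda>a. f a * (e (fst a) p + e (snd a) p)\<^sup>2))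
        = M (\<lambda>a. \<Sum>p\<in>I. \<kappa> p * (f a * (e (fst a) p + e (snd a) p)\<^sup>2))"
      by (simp add: Msum Mmult)
    also have "\<dots> = M (\<lambda>a. (2 * d) * f a + 2 * (A * (f a * (u a)\<^sup>2) + (- \<gamma>) * f a))"
    proof (rule Mcong)
      fix a assume a: "a \<in> C \<times> C"
      obtain x y where xy: "a = (x, y)" "x \<in> C" "y \<in> C" using a by auto
      have "(\<Sum>p\<in>I. \<kappa> p * (f a * (e x p + e y p)\<^sup>2)) = f a * ((\<Sum>p\<in>I. \<kappa> p * e x p * e x p)
          + (\<Sum>p\<in>I. \<kappa> p * e y p * e y p) + 2 * (\<Sum>p\<in>I. \<kappa> p * e x p * e y p))"
        by (simp add: sum_distrib_left sum.distrib[symmetric] power2_eq_square algebra_simps)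
      also have "\<dots> = (2 * d) * f a + 2 * (A * (f a * (u a)\<^sup>2) + (- \<gamma>) * f a)"
        by (simp only: K[OF xy(2,3)] Kd[OF xy(2)] Kd[OF xy(3)] xy(1)) (simp add: algebra_simps)
      finally show "(\<Sum>p\<in>I. \<kappa> p * (f a * (e (fst a) p + e (snd a) p)\<^sup>2))
          = (2 * d) * f a + 2 * (A * (f a * (u a)\<^sup>2) + (- \<gamma>) * f a)" using xy by simp
    qed
    finally show ?thesis by (simp only: Madd Mmult) simp
  qed
  have t2: "- 2 * \<gamma> * M f \<le> (\<Sum>p\<in>I. \<kappa> p * (M (\<lambda>a. f a * (e (fst a) p + e (snd a) p)) * m p))"
  proof -
    have "(\<Sum>p\<in>I. \<kappa> p * (M (\<lambda>a. f a * (e (fst a) p + e (snd a) p)) * m p))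
        = M (\<lambda>a. \<Sum>p\<in>I. (\<kappa> p * m p) * (f a * (e (fst a) p + e (snd a) p)))"
      by (simp only: Msum Mmult) (simp add: mult_ac)
    also have "\<dots> = M (\<lambda>a. f a * (L (fst a) + L (snd a)))"
      by (simp add: Lm[symmetric] sum_distrib_left sum.distrib[symmetric] algebra_simps)
    also have "\<dots> \<ge> M (\<lambda>a. (- 2 * \<gamma>) * f a)"
    proof (rule Mmono)
      fix a assume a: "a \<in> C \<times> C"
      have "- 2 * \<gamma> \<le> L (fst a) + L (snd a)" using L[of "fst a"] L[of "snd a"] a by auto
      from mult_left_mono[OF this f0[OF a]]
      show "(- 2 * \<gamma>) * f a \<le> f a * (L (fst a) + L (snd a))" by (simp add: mult.commute)
    qed
    finally show ?thesis by (simp only: Mmult)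
  qed
  have t3: "(\<Sum>p\<in>I. \<kappa> p * s p) = d"
  proof -
    have "(\<Sum>p\<in>I. \<kappa> p * s p) = (\<Sum>x\<in>C. w x * (\<Sum>p\<in>I. \<kappa> p * e x p * e x p))"
      unfolding s_def by (simp add: sum_distrib_left power2_eq_square mult_ac) (rule sum.swap)
    also have "\<dots> = d" using w(2) by (simp add: Kd sum_distrib_right[symmetric])
    finally show ?thesis .
  qed
  have t4: "(\<Sum>p\<in>I. \<kappa> p * (m p)\<^sup>2) = A * M (\<lambda>a. (u a)\<^sup>2) - \<gamma>"
  proof -
    have "(\<Sum>p\<in>I. \<kappa> p * (m p)\<^sup>2) = M (\<lambda>a. \<Sum>p\<in>I. \<kappa> p * (e (fst a) p * e (snd a) p))"
      by (simp only: Msum Mmult Mprod[of "\<lambda>x. e x p" "\<lambda>x. e x p" for p] m_def power2_eq_square)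
    also have "\<dots> = M (\<lambda>a. A * (u a)\<^sup>2 + (- \<gamma>))"
      using K by (intro Mcong) (auto simp: mult.assoc)
    finally show ?thesis by (simp only: Madd Mmult M1)
  qed
  have cheb: "M f * M (\<lambda>a. (u a)\<^sup>2) \<le> M (\<lambda>a. f a * (u a)\<^sup>2)"
    unfolding M_def
    by (rule chebyshev_weighted) (use pair_weights_prob[of C w, OF w] mono in auto)
  have Me: "M (\<lambda>a. e (fst a) p + e (snd a) p) = 2 * m p" for p
    by (simp only: Madd Mfst[of "\<lambda>x. e x p"] Msnd[of "\<lambda>x. e x p"] m_def)
  have Me2: "M (\<lambda>a. (e (fst a) p + e (snd a) p)\<^sup>2) = 2 * s p + 2 * (m p)\<^sup>2" for p
  proof -
    have "M (\<lambda>a. (e (fst a) p + e (snd a) p)\<^sup>2)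
        = M (\<lambda>a. (e (fst a) p)\<^sup>2 + ((e (snd a) p)\<^sup>2 + 2 * (e (fst a) p * e (snd a) p)))"
      by (simp add: power2_eq_square algebra_simps)
    also have "\<dots> = s p + (s p + 2 * (m p * m p))"
      by (simp only: Madd Mmult Mprod[of "\<lambda>x. e x p" "\<lambda>x. e x p"] Mfst[of "\<lambda>x. (e x p)\<^sup>2"] Msnd[of "\<lambda>x. (e x p)\<^sup>2"] s_def m_def)
    finally show ?thesis by (simp add: power2_eq_square)
  qed
  have "(\<Sum>p\<in>I. \<kappa> p * third_cumulant M f (\<lambda>a. e (fst a) p + e (snd a) p))
    = (\<Sum>p\<in>I. \<kappa> p * M (\<lambda>a. f a * (e (fst a) p + e (snd a) p)\<^sup>2))
      - 4 * (\<Sum>p\<in>I. \<kappa> p * (M (\<lambda>a. f a * (e (fst a) p + e (snd a) p)) * m p))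
      - 2 * M f * (\<Sum>p\<in>I. \<kappa> p * s p) + 6 * M f * (\<Sum>p\<in>I. \<kappa> p * (m p)\<^sup>2)"
    unfolding third_cumulant_def Me Me2
    by (simp add: sum_distrib_left sum.distrib[symmetric] sum_subtractf[symmetric] power_mult_distrib algebra_simps)
  also have "\<dots> \<le> 2 * A * M (\<lambda>a. f a * (u a)\<^sup>2) + 6 * A * (M f * M (\<lambda>a. (u a)\<^sup>2))"
    unfolding t1 t3 t4 using t2 by (simp add: algebra_simps)
  also have "\<dots> \<le> 2 * A * M (\<lambda>a. f a * (u a)\<^sup>2) + 6 * A * M (\<lambda>a. f a * (u a)\<^sup>2)"
    using cheb A by (intro add_left_mono mult_left_mono) auto
  finally show ?thesis by simp
qed

section \<open>Concentration of the overlap\<close>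

definition configs :: "nat set \<Rightarrow> (nat \<Rightarrow> real) set" where
  "configs V = V \<rightarrow>\<^sub>E {-1, 1}"

definition pairs :: "nat set \<Rightarrow> (nat \<times> nat) set" where
  "pairs V = {(i, j). i \<in> V \<and> j \<in> V \<and> i < j}"

text \<open>The coupling strength \<open>b\<close> is separate from the number of sites: removing a site from a system of
  size \<open>N\<close> leaves \<open>N - 1\<close> sites but the strength \<open>\<beta> / sqrt N\<close>.\<close>

definition sk_energy ::
    "real \<Rightarrow> real \<Rightarrow> nat set \<Rightarrow> (nat \<times> nat \<Rightarrow> real) \<Rightarrow> (nat \<Rightarrow> real) \<Rightarrow> real" where
  "sk_energy b h V g \<sigma> = (\<Sum>p\<in>pairs V. b * (\<sigma> (fst p) * \<sigma> (snd p)) * g p) + h * (\<Sum>i\<in>V. \<sigma> i)"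

text \<open>The normalisation is by \<open>N\<close> also when \<open>V\<close> has only \<open>N - 1\<close> sites. The covariance kernel of
  the interpolation below, at coupling strength \<open>\<beta> / sqrt N\<close>, is then a square centred exactly at the order
  parameter of inverse temperature \<open>\<beta>\<close>, although the
  \<open>N - 1\<close> sites form a system of slightly smaller inverse temperature.\<close>

definition overlap :: "nat \<Rightarrow> nat set \<Rightarrow> (nat \<Rightarrow> real) \<Rightarrow> (nat \<Rightarrow> real) \<Rightarrow> real" where
  "overlap N V \<sigma> \<tau> = (\<Sum>j\<in>V. \<sigma> j * \<tau> j) / real N"

definition sk_gibbs2 where
  "sk_gibbs2 b h V g = gibbs (configs V \<times> configs V)
     (\<lambda>a. sk_energy b h V g (fst a) + sk_energy b h V g (snd a))"

lemma finite_configs [simp]: "finite V \<Longrightarrow> finite (configs V)"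
  unfolding configs_def by (intro finite_PiE) auto

lemma configs_nonempty [simp]: "configs V \<noteq> {}"
  unfolding configs_def by (auto simp: PiE_eq_empty_iff)

lemma configs_spin: "\<sigma> \<in> configs V \<Longrightarrow> i \<in> V \<Longrightarrow> \<sigma> i \<in> {-1, 1}"
  unfolding configs_def by (rule PiE_mem)

lemma configs_spin_sq: "\<sigma> \<in> configs V \<Longrightarrow> i \<in> V \<Longrightarrow> \<sigma> i * \<sigma> i = 1"
  using configs_spin[of \<sigma> V i] by auto

lemma configs_spin_abs: "\<sigma> \<in> configs V \<Longrightarrow> i \<in> V \<Longrightarrow> \<bar>\<sigma> i\<bar> = 1"
  using configs_spin[of \<sigma> V i] by auto

lemma finite_pairs [simp]: "finite V \<Longrightarrow> finite (pairs V)"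
  by (rule finite_subset[of _ "V \<times> V"]) (auto simp: pairs_def)

lemma sum_pairs:
  fixes a :: "nat \<Rightarrow> real"
  assumes "finite V"
  shows "2 * (\<Sum>p\<in>pairs V. a (fst p) * a (snd p)) = (\<Sum>i\<in>V. a i)\<^sup>2 - (\<Sum>i\<in>V. (a i)\<^sup>2)"
proof -
  let ?S = "prod.swap ` pairs V" and ?D = "(\<lambda>i. (i, i)) ` V"
  have VV: "V \<times> V = pairs V \<union> (?S \<union> ?D)"
    by (auto simp: pairs_def image_iff)
  have fin: "finite (pairs V)" "finite ?S" "finite ?D"
    using assms by simp_all
  have disj: "pairs V \<inter> (?S \<union> ?D) = {}" "?S \<inter> ?D = {}"
    by (auto simp: pairs_def)
  have "(\<Sum>i\<in>V. a i)\<^sup>2 = (\<Sum>p\<in>V \<times> V. a (fst p) * a (snd p))"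
    by (simp add: power2_eq_square sum_product sum.cartesian_product case_prod_unfold)
  also have "\<dots> = (\<Sum>p\<in>pairs V. a (fst p) * a (snd p)) + ((\<Sum>p\<in>?S. a (fst p) * a (snd p))
      + (\<Sum>p\<in>?D. a (fst p) * a (snd p)))"
    unfolding VV using fin disj by (simp add: sum.union_disjoint)
  also have "(\<Sum>p\<in>?S. a (fst p) * a (snd p)) = (\<Sum>p\<in>pairs V. a (fst p) * a (snd p))"
    by (subst sum.reindex) (auto simp: mult.commute)
  also have "(\<Sum>p\<in>?D. a (fst p) * a (snd p)) = (\<Sum>i\<in>V. (a i)\<^sup>2)"
    by (subst sum.reindex) (auto simp: inj_on_def power2_eq_square)
  finally show ?thesis by simp
qed

lemma sum_pairs_diag:
  fixes \<phi> :: "nat \<times> nat \<Rightarrow> real"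
  assumes "finite V"
  shows "(\<Sum>p\<in>pairs V \<union> (\<lambda>i. (i, i)) ` V. \<phi> p) = (\<Sum>p\<in>pairs V. \<phi> p) + (\<Sum>i\<in>V. \<phi> (i, i))"
proof -
  have "pairs V \<inter> (\<lambda>i. (i, i)) ` V = {}" by (auto simp: pairs_def)
  then have "(\<Sum>p\<in>pairs V \<union> (\<lambda>i. (i, i)) ` V. \<phi> p)
      = (\<Sum>p\<in>pairs V. \<phi> p) + (\<Sum>p\<in>(\<lambda>i. (i, i)) ` V. \<phi> p)"
    using assms by (intro sum.union_disjoint) auto
  also have "(\<Sum>p\<in>(\<lambda>i. (i, i)) ` V. \<phi> p) = (\<Sum>i\<in>V. \<phi> (i, i))"
    by (subst sum.reindex) (auto simp: inj_on_def)
  finally show ?thesis .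
qed

lemma overlap_abs_le:
  assumes "\<sigma> \<in> configs V" "\<tau> \<in> configs V" "card V \<le> N"
  shows "\<bar>overlap N V \<sigma> \<tau>\<bar> \<le> 1"
proof (cases "N = 0")
  case False
  have "\<bar>\<Sum>j\<in>V. \<sigma> j * \<tau> j\<bar> \<le> (\<Sum>j\<in>V. 1)"
    using assms by (intro sum_abs[THEN order_trans] sum_mono) (simp add: abs_mult configs_spin_abs)
  then show ?thesis
    using assms(3) False by (simp add: overlap_def divide_le_eq)
qed (simp add: overlap_def)

lemma overlap_commute: "overlap N V \<sigma> \<tau> = overlap N V \<tau> \<sigma>"
  by (simp add: overlap_def mult.commute)

lemma overlap_self: "\<sigma> \<in> configs V \<Longrightarrow> overlap N V \<sigma> \<sigma> = real (card V) / real N"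
  by (simp add: overlap_def configs_spin_sq)

lemma sk_energy_measurable:
  "pairs V \<subseteq> J \<Longrightarrow> (\<lambda>g. sk_energy b h V g \<sigma>) \<in> borel_measurable (gaussians J)"
  unfolding sk_energy_def by (intro borel_measurable_add borel_measurable_const linear_form_measurable_subset)

lemma sk_gibbs2_integrable:
  assumes "finite V"
  shows "integrable (gaussians (pairs V)) (\<lambda>g. sk_gibbs2 b h V g f)"
proof (rule exp_growth_integrable)
  show "(\<lambda>g. sk_gibbs2 b h V g f) \<in> borel_measurable (gaussians (pairs V))"
    unfolding sk_gibbs2_def by (intro gibbs_measurable borel_measurable_add sk_energy_measurable order_refl)
  have S: "finite (configs V \<times> configs V)" "configs V \<times> configs V \<noteq> {}" using assms by auto
  show "exp_growth (pairs V) (\<lambda>g. sk_gibbs2 b h V g f)"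
    unfolding sk_gibbs2_def
    by (rule exp_growth_bounded[of _ "\<Sum>x\<in>configs V \<times> configs V. \<bar>f x\<bar>"], rule gibbs_abs_le[OF S])
       (rule member_le_sum[of _ "configs V \<times> configs V" "\<lambda>x. \<bar>f x\<bar>"], use S in auto)
qed (use assms in simp)

subsection \<open>The decoupled system\<close>

text \<open>The left-hand side is the mean of \<open>exp (c X)\<close> for a variable \<open>X\<close> with values \<open>-1\<close> and \<open>1\<close> and mean \<open>q\<close>;
  this is Hoeffding's lemma for it.\<close>

lemma two_point_subgaussian:
  assumes "\<bar>q\<bar> \<le> (1::real)"
  shows "cosh c + q * sinh c \<le> exp (c * q + c\<^sup>2 / 2)"
proof -
  have *: "cosh c + q * sinh c \<le> exp (c * q + c\<^sup>2 / 2)" if "0 \<le> c" "\<bar>q\<bar> \<le> 1" for c q :: real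
  proof -
    \<comment> \<open>The probability of the value \<open>1\<close>. Hoeffding's bound is for the values \<open>0\<close> and \<open>1\<close>, hence the
      argument \<open>2 c\<close>.\<close>
    define p where "p = (1 + q) / 2"
    have p: "0 \<le> p" using that by (simp add: p_def)
    have pos: "0 < 1 + p * (exp (2 * c) - 1)"
      using p that by (intro add_pos_nonneg mult_nonneg_nonneg) auto
    have "- (2 * c) * p + ln (1 + p * (exp (2 * c) - 1)) \<le> (2 * c)\<^sup>2 / 8"
      using p that by (intro Hoeffdings_lemma_aux) auto
    then have "ln (1 + p * (exp (2 * c) - 1)) \<le> c\<^sup>2 / 2 + c * q + c"
      by (simp add: p_def field_simps power2_eq_square)
    then have "1 + p * (exp (2 * c) - 1) \<le> exp (c\<^sup>2 / 2 + c * q + c)"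
      using pos by (metis exp_le_cancel_iff exp_ln)
    then have "exp (- c) * (1 + p * (exp (2 * c) - 1)) \<le> exp (- c) * exp (c\<^sup>2 / 2 + c * q + c)"
      by (intro mult_left_mono) auto
    also have "exp (- c) * exp (c\<^sup>2 / 2 + c * q + c) = exp (c * q + c\<^sup>2 / 2)"
      by (simp add: exp_add[symmetric])
    also have "exp (- c) * (1 + p * (exp (2 * c) - 1)) = cosh c + q * sinh c"
    proof -
      have "exp (- c) * exp (2 * c) = exp c" by (simp add: exp_add[symmetric])
      then show ?thesis
        by (simp add: p_def cosh_def sinh_def field_simps)
    qed
    finally show ?thesis .
  qed
  show ?thesis
    using *[of c q] *[of "-c" "-q"] assms by (cases "0 \<le> c") auto
qed

text \<open>After division by the squared partition sum, this is the mean of \<open>exp (c s t)\<close> over two independent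
  spins in the field \<open>y\<close>, and \<open>s t\<close> has mean \<open>tanh\<^sup>2 y\<close>.\<close>

lemma one_site_replica_mgf:
  fixes y c :: real
  shows "(\<Sum>s\<in>{-1, 1}. \<Sum>t\<in>{-1, 1}. exp (y * (s + t) + c * (s * t)))
    = (\<Sum>s\<in>{-1, 1::real}. exp (y * s))\<^sup>2 * (cosh c + (tanh y)\<^sup>2 * sinh c)"
proof -
  let ?a = "exp y" and ?b = "exp (- y)"
  have e: "exp (y * 2) = ?a * ?a" "exp (- (y * 2)) = ?b * ?b" "?a * ?b = 1"
    by (simp_all add: exp_add[symmetric])
  have ab: "?a + ?b > 0" by (simp add: add_pos_pos)
  have t: "tanh y = (?a - ?b) / (?a + ?b)"
    unfolding tanh_def sinh_def cosh_def using ab by (simp add: frac_eq_eq field_simps)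
  have "(?a + ?b)\<^sup>2 * (cosh c + (tanh y)\<^sup>2 * sinh c) = (?a + ?b)\<^sup>2 * cosh c + (?a - ?b)\<^sup>2 * sinh c"
    using ab unfolding t by (simp add: power_divide field_simps)
  also have "\<dots> = (?a * ?a + ?b * ?b) * exp c + 2 * (?a * ?b) * exp (- c)"
    by (simp add: cosh_def sinh_def power2_eq_square field_simps)
  also have "\<dots> = (?a * ?a + ?b * ?b) * exp c + 2 * exp (- c)" unfolding e(3) by simp
  also have "\<dots> = exp (- (y * 2) + c) + exp (- c) + (exp (- c) + exp (y * 2 + c))"
    by (simp only: exp_add e) (simp add: algebra_simps)
  also have "\<dots> = (\<Sum>s\<in>{-1, 1}. \<Sum>t\<in>{-1, 1}. exp (y * (s + t) + c * (s * t)))"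
    by simp
  finally show ?thesis by (simp add: add.commute)
qed

lemma gaussian_square_exp_integrable:
  assumes "l < 1 / 2"
  shows "integrable std_gaussian (\<lambda>\<xi>. exp (\<bar>\<xi>\<bar> + l * \<xi>\<^sup>2))"
proof (subst integrable_std_gaussian_iff)
  \<comment> \<open>Together with \<open>exp (l \<xi>\<^sup>2)\<close> the density decays like \<open>exp (- \<xi>\<^sup>2 / v)\<close>; half of this decay absorbs
    \<open>exp \<bar>\<xi>\<bar>\<close>.\<close>
  define v where "v = 2 / (1 - 2 * l)"
  have v: "v > 0" using assms by (simp add: v_def)
  show "integrable lborel (\<lambda>\<xi>. std_normal_density \<xi> * exp (\<bar>\<xi>\<bar> + l * \<xi>\<^sup>2))"
  proof (rule Bochner_Integration.integrable_bound)
    show "integrable lborel (\<lambda>\<xi>. (sqrt (2 * pi * v) / sqrt (2 * pi) * exp (v / 2)) * normal_density 0 (sqrt v) \<xi>)"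
      using v by (intro integrable_mult_right integrable_normal_density) simp
    show "AE \<xi> in lborel. norm (std_normal_density \<xi> * exp (\<bar>\<xi>\<bar> + l * \<xi>\<^sup>2))
        \<le> norm ((sqrt (2 * pi * v) / sqrt (2 * pi) * exp (v / 2)) * normal_density 0 (sqrt v) \<xi>)"
    proof (rule AE_I2)
      fix \<xi> :: real
      have "2 * \<bar>\<xi>\<bar> * v \<le> \<xi>\<^sup>2 + v\<^sup>2"
        using zero_le_power2[of "\<bar>\<xi>\<bar> - v"] by (simp add: power2_eq_square algebra_simps)
      then have "\<bar>\<xi>\<bar> \<le> \<xi>\<^sup>2 / (2 * v) + v / 2"
        using v by (simp add: field_simps power2_eq_square)
      moreover have "l * \<xi>\<^sup>2 = \<xi>\<^sup>2 / 2 - 2 * (\<xi>\<^sup>2 / (2 * v))"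
        using assms by (simp add: v_def field_simps)
      ultimately have "- \<xi>\<^sup>2 / 2 + (\<bar>\<xi>\<bar> + l * \<xi>\<^sup>2) \<le> v / 2 + - \<xi>\<^sup>2 / (2 * v)"
        by simp
      then have "exp (- \<xi>\<^sup>2 / 2) * exp (\<bar>\<xi>\<bar> + l * \<xi>\<^sup>2) \<le> exp (v / 2) * exp (- \<xi>\<^sup>2 / (2 * v))"
        by (simp only: exp_add[symmetric] exp_le_cancel_iff)
      then show "norm (std_normal_density \<xi> * exp (\<bar>\<xi>\<bar> + l * \<xi>\<^sup>2))
        \<le> norm ((sqrt (2 * pi * v) / sqrt (2 * pi) * exp (v / 2)) * normal_density 0 (sqrt v) \<xi>)"
        using v by (simp add: normal_density_def divide_right_mono abs_mult mult.assoc real_sqrt_mult field_simps)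
    qed
  qed simp
qed simp

lemma sum_PiE_pair_prod:
  fixes G :: "nat \<Rightarrow> real \<Rightarrow> real \<Rightarrow> real"
  assumes "finite V"
  shows "(\<Sum>a\<in>configs V \<times> configs V. \<Prod>i\<in>V. G i (fst a i) (snd a i))
    = (\<Prod>i\<in>V. \<Sum>s\<in>{-1, 1}. \<Sum>t\<in>{-1, 1}. G i s t)"
proof -
  have "(\<Prod>i\<in>V. \<Sum>s\<in>{-1, 1}. \<Sum>t\<in>{-1, 1}. G i s t)
      = (\<Sum>\<sigma>\<in>configs V. \<Prod>i\<in>V. \<Sum>t\<in>{-1, 1}. G i (\<sigma> i) t)"
    unfolding configs_def using assms by (intro prod_sum_PiE) auto
  also have "\<dots> = (\<Sum>\<sigma>\<in>configs V. \<Sum>\<tau>\<in>configs V. \<Prod>i\<in>V. G i (\<sigma> i) (\<tau> i))"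
    unfolding configs_def using assms by (intro sum.cong refl prod_sum_PiE) auto
  finally show ?thesis by (simp add: sum.cartesian_product case_prod_unfold)
qed

lemma decoupled_gibbs_mgf:
  fixes y :: "nat \<Rightarrow> real"
  assumes "finite V"
  shows "gibbs (configs V \<times> configs V) (\<lambda>a. (\<Sum>i\<in>V. y i * fst a i) + (\<Sum>i\<in>V. y i * snd a i))
      (\<lambda>a. exp (c * (\<Sum>i\<in>V. fst a i * snd a i)))
    = (\<Prod>i\<in>V. cosh c + (tanh (y i))\<^sup>2 * sinh c)"
proof -
  let ?z = "\<lambda>i. \<Sum>s\<in>{-1, 1::real}. exp (y i * s)"
  have z: "?z i > 0" for i by (simp add: add_pos_pos)
  have "(\<Sum>a\<in>configs V \<times> configs V. exp ((\<Sum>i\<in>V. y i * fst a i) + (\<Sum>i\<in>V. y i * snd a i)))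
      = (\<Sum>a\<in>configs V \<times> configs V. \<Prod>i\<in>V. exp (y i * fst a i) * exp (y i * snd a i))"
    using assms by (simp add: exp_add exp_sum prod.distrib)
  also have "\<dots> = (\<Prod>i\<in>V. \<Sum>s\<in>{-1, 1}. \<Sum>t\<in>{-1, 1}. exp (y i * s) * exp (y i * t))"
    by (rule sum_PiE_pair_prod[OF assms, of "\<lambda>i s t. exp (y i * s) * exp (y i * t)"])
  also have "\<dots> = (\<Prod>i\<in>V. (?z i)\<^sup>2)"
    by (intro prod.cong refl) (simp add: power2_eq_square algebra_simps)
  finally have den: "(\<Sum>a\<in>configs V \<times> configs V. exp ((\<Sum>i\<in>V. y i * fst a i) + (\<Sum>i\<in>V. y i * snd a i)))
      = (\<Prod>i\<in>V. (?z i)\<^sup>2)" .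
  have "(\<Sum>a\<in>configs V \<times> configs V. exp (c * (\<Sum>i\<in>V. fst a i * snd a i)) *
        exp ((\<Sum>i\<in>V. y i * fst a i) + (\<Sum>i\<in>V. y i * snd a i)))
      = (\<Sum>a\<in>configs V \<times> configs V. \<Prod>i\<in>V. exp (y i * (fst a i + snd a i) + c * (fst a i * snd a i)))"
    using assms by (simp add: exp_sum[symmetric] exp_add[symmetric] sum.distrib sum_distrib_left algebra_simps)
  also have "\<dots> = (\<Prod>i\<in>V. \<Sum>s\<in>{-1, 1}. \<Sum>t\<in>{-1, 1}. exp (y i * (s + t) + c * (s * t)))"
    by (rule sum_PiE_pair_prod[OF assms, of "\<lambda>i s t. exp (y i * (s + t) + c * (s * t))"])
  also have "\<dots> = (\<Prod>i\<in>V. (?z i)\<^sup>2 * (cosh c + (tanh (y i))\<^sup>2 * sinh c))"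
    by (simp only: one_site_replica_mgf)
  also have "\<dots> = (\<Prod>i\<in>V. (?z i)\<^sup>2) * (\<Prod>i\<in>V. cosh c + (tanh (y i))\<^sup>2 * sinh c)"
    by (rule prod.distrib)
  finally have num: "(\<Sum>a\<in>configs V \<times> configs V. exp (c * (\<Sum>i\<in>V. fst a i * snd a i)) *
        exp ((\<Sum>i\<in>V. y i * fst a i) + (\<Sum>i\<in>V. y i * snd a i)))
      = (\<Prod>i\<in>V. (?z i)\<^sup>2) * (\<Prod>i\<in>V. cosh c + (tanh (y i))\<^sup>2 * sinh c)" .
  have "(\<Prod>i\<in>V. (?z i)\<^sup>2) > 0" using z by (intro prod_pos) (metis zero_less_power)
  then show ?thesis unfolding gibbs_def num den by simp
qed

text \<open>At the decoupled end of the path the products \<open>\<sigma>\<^sub>i \<tau>\<^sub>i\<close> at different sites are independent under the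
  averaged measure and have mean \<open>q\<close>, by the fixed point equation. Their sum is therefore subgaussian. The
  square in the exponent is linearised with an auxiliary Gaussian \<open>\<xi>\<close>; the summand \<open>\<bar>\<xi>\<bar>\<close> on the right comes
  from the one site by which \<open>N\<close> exceeds the size of \<open>V\<close>.\<close>

lemma decoupled_overlap_bound:
  fixes \<beta> h l :: real and I :: "(nat \<times> nat) set"
  assumes V: "finite V" "card V + 1 = N" and \<beta>: "0 < \<beta>" "\<beta> < 1" and l: "0 \<le> l" "l < 1 / 2"
    and I: "finite I" "\<And>i. i \<in> V \<Longrightarrow> (i, i) \<in> I"
  defines "q \<equiv> overlap_q \<beta> h"
  shows "(LINT \<omega>|gaussians I. gibbs (configs V \<times> configs V)
      (\<lambda>a. (\<Sum>i\<in>V. (\<beta> * \<omega> (i, i) * sqrt q + h) * fst a i) + (\<Sum>i\<in>V. (\<beta> * \<omega> (i, i) * sqrt q + h) * snd a i))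
      (\<lambda>a. exp (l * real N * (overlap N V (fst a) (snd a) - q)\<^sup>2)))
    \<le> (LINT \<xi>|std_gaussian. exp (\<bar>\<xi>\<bar> + l * \<xi>\<^sup>2))"
proof -
  let ?S = "configs V \<times> configs V"
  define y where "y = (\<lambda>\<omega>::nat \<times> nat \<Rightarrow> real. \<lambda>i. \<beta> * \<omega> (i, i) * sqrt q + h)"
  define G where "G = (\<lambda>\<omega>. gibbs ?S (\<lambda>a. (\<Sum>i\<in>V. y \<omega> i * fst a i) + (\<Sum>i\<in>V. y \<omega> i * snd a i)))"
  define R where "R = (\<lambda>a::(nat \<Rightarrow> real) \<times> (nat \<Rightarrow> real). \<Sum>i\<in>V. fst a i * snd a i)"
  have S: "finite ?S" "?S \<noteq> {}" using V by auto
  have N: "real N > 0" "real N = real (card V) + 1" using V(2) by auto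
  have q: "0 \<le> q" "q \<le> 1" "q = (LINT z|std_gaussian. (tanh (\<beta> * z * sqrt q + h))\<^sup>2)"
    unfolding q_def using overlap_q_fixed_point[OF \<beta>] by auto
  have ymeas: "(\<lambda>\<omega>. y \<omega> i) \<in> borel_measurable (gaussians I)" if "i \<in> V" for i
    unfolding y_def using I(2)[OF that]
    by (intro borel_measurable_add borel_measurable_times borel_measurable_const gaussians_component)
  have Gmeas: "(\<lambda>\<omega>. G \<omega> g) \<in> borel_measurable (gaussians I)" for g
    unfolding G_def
    by (intro gibbs_measurable borel_measurable_add borel_measurable_sum borel_measurable_times
        borel_measurable_const ymeas)
  have Gint: "integrable (gaussians I) (\<lambda>\<omega>. G \<omega> g)" for g
  proof (rule exp_growth_integrable[OF I(1) Gmeas])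
    show "exp_growth I (\<lambda>\<omega>. G \<omega> g)"
      unfolding G_def
      by (rule exp_growth_bounded[of _ "\<Sum>x\<in>?S. \<bar>g x\<bar>"], rule gibbs_abs_le[OF S])
         (rule member_le_sum[of _ ?S "\<lambda>x. \<bar>g x\<bar>"], use S in auto)
  qed
  define P where "P = (\<lambda>a. LINT \<omega>|gaussians I. G \<omega> (\<lambda>b. if b = a then 1 else 0))"
  have GP: "(LINT \<omega>|gaussians I. G \<omega> g) = (\<Sum>a\<in>?S. g a * P a)" for g
  proof -
    have "(LINT \<omega>|gaussians I. G \<omega> g) 
        = (LINT \<omega>|gaussians I. (\<Sum>a\<in>?S. g a * G \<omega> (\<lambda>b. if b = a then 1 else 0)))"
      unfolding G_def by (subst gibbs_as_sum[OF S(1)]) simp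
    also have "\<dots> = (\<Sum>a\<in>?S. g a * P a)"
      unfolding P_def using Gint by (subst Bochner_Integration.integral_sum) auto
    finally show ?thesis .
  qed
  \<comment> \<open>The \<open>N - 1\<close> sites of \<open>V\<close> are centred by \<open>q\<close> each; the remaining \<open>- q\<close> accounts for \<open>\<bar>c\<bar>\<close>.\<close>
  have mgf: "(\<Sum>a\<in>?S. exp (c * (R a - q * real N)) * P a) \<le> exp (\<bar>c\<bar> + real N * c\<^sup>2 / 2)" for c
  proof -
    define \<phi> where "\<phi> = (\<lambda>z. cosh c + (tanh (\<beta> * z * sqrt q + h))\<^sup>2 * sinh c)"
    have phi_int: "integrable std_gaussian \<phi>" and phi: "(LINT z|std_gaussian. \<phi> z) = cosh c + q * sinh c"
    proof -
      interpret prob_space std_gaussian by (rule prob_space_std_gaussian)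
      have [measurable]: "(tanh :: real \<Rightarrow> real) \<in> borel_measurable borel"
        by (intro borel_measurable_continuous_onI continuous_intros) auto
      have i: "integrable std_gaussian (\<lambda>z. (tanh (\<beta> * z * sqrt q + h))\<^sup>2)"
        by (rule integrable_const_bound[of _ 1]) (auto simp: tanh_sq_le_1)
      then show "integrable std_gaussian \<phi>" unfolding \<phi>_def by auto
      have "(LINT z|std_gaussian. \<phi> z)
          = cosh c + (LINT z|std_gaussian. (tanh (\<beta> * z * sqrt q + h))\<^sup>2) * sinh c"
        unfolding \<phi>_def using i prob_space by simp
      then show "(LINT z|std_gaussian. \<phi> z) = cosh c + q * sinh c" using q(3) by simp
    qed
    define D where "D = (\<lambda>i. (i, i)) ` V"
    have D: "finite D" "D \<subseteq> I" unfolding D_def using V(1) I(2) by blast+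
    have toD: "(\<Prod>i\<in>V. cosh c + (tanh (y \<omega> i))\<^sup>2 * sinh c) = (\<Prod>p\<in>D. \<phi> (\<omega> p))" for \<omega>
      unfolding D_def \<phi>_def y_def by (subst prod.reindex) (auto simp: inj_on_def)
    have cardD: "card D = card V" unfolding D_def by (rule card_image) (auto simp: inj_on_def)
    have e: "exp (c * (R a - q * real N)) = exp (- c * q * real N) * exp (c * R a)" for a
      by (simp add: exp_add[symmetric] algebra_simps)
    have "(\<Sum>a\<in>?S. exp (c * (R a - q * real N)) * P a)
        = exp (- c * q * real N) * (\<Sum>a\<in>?S. exp (c * R a) * P a)"
      unfolding e sum_distrib_left mult.assoc ..
    also have "(\<Sum>a\<in>?S. exp (c * R a) * P a) = (LINT \<omega>|gaussians I. (\<Prod>i\<in>V. cosh c + (tanh (y \<omega> i))\<^sup>2 * sinh c))"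
      unfolding GP[symmetric] G_def R_def decoupled_gibbs_mgf[OF V(1)] ..
    also have "\<dots> = (LINT \<omega>|gaussians I. (\<Prod>p\<in>D. \<phi> (\<omega> p)))"
      unfolding toD ..
    also have "\<dots> = (LINT \<omega>|gaussians D. (\<Prod>p\<in>D. \<phi> (\<omega> p)))"
    proof (rule gaussians_marginal[OF I(1) D(2)])
      have "integrable (gaussians I) (\<lambda>\<omega>. G \<omega> (\<lambda>a. exp (c * R a)))" by (rule Gint)
      then show "integrable (gaussians I) (\<lambda>\<omega>. \<Prod>p\<in>D. \<phi> (\<omega> p))"
        unfolding G_def R_def decoupled_gibbs_mgf[OF V(1)]
        unfolding toD .
    qed (auto intro: prod.cong)
    also have "\<dots> = (\<Prod>p\<in>D. cosh c + q * sinh c)"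
      by (subst integral_gaussians_prod[OF D(1), of "\<lambda>_. \<phi>"])
         (simp_all only: phi phi_int)
    also have "\<dots> = (cosh c + q * sinh c) ^ card V" by (simp add: cardD)
    also have "exp (- c * q * real N) * \<dots> \<le> exp (- c * q * real N) * (exp (c * q + c\<^sup>2 / 2)) ^ card V"
    proof (intro mult_left_mono power_mono)
      show "cosh c + q * sinh c \<le> exp (c * q + c\<^sup>2 / 2)"
        using q by (intro two_point_subgaussian) auto
      have "\<bar>q * sinh c\<bar> \<le> 1 * \<bar>sinh c\<bar>" unfolding abs_mult using q by (intro mult_right_mono) auto
      also have "\<dots> \<le> cosh c" by (simp add: sinh_def cosh_def abs_if field_simps)
      finally show "0 \<le> cosh c + q * sinh c" by (simp add: abs_le_iff)
    qed simp
    also have "\<dots> = exp (- c * q + real (card V) * (c\<^sup>2 / 2))"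
      unfolding exp_of_nat_mult[symmetric] exp_add[symmetric] N(2) by (simp add: algebra_simps)
    also have "\<dots> \<le> exp (\<bar>c\<bar> + real N * c\<^sup>2 / 2)"
    proof -
      have "\<bar>c * q\<bar> \<le> \<bar>c\<bar>"
        using mult_left_mono[OF q(2), of "\<bar>c\<bar>"] q(1) by (simp add: abs_mult)
      then have "- c * q \<le> \<bar>c\<bar>" by (simp add: abs_le_iff)
      moreover have "real (card V) * (c\<^sup>2 / 2) \<le> real N * c\<^sup>2 / 2"
        unfolding N(2) by (simp add: algebra_simps)
      ultimately show ?thesis by simp
    qed
    finally show ?thesis .
  qed
  \<comment> \<open>At this scale the auxiliary Gaussian mean reproduces the exponential of the square, and \<open>2 l < 1\<close> gives
    \<open>s \<le> 1\<close>.\<close>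
  define s where "s = sqrt (2 * l / real N)"
  have s: "0 \<le> s" "s \<le> 1" "real N * s\<^sup>2 = 2 * l"
  proof -
    have "2 * l / real N \<le> 1" using l N by (simp add: divide_le_eq)
    then show "s \<le> 1" by (simp add: s_def)
  qed (use l N in \<open>auto simp: s_def\<close>)
  have lin: "exp (l * real N * (overlap N V (fst a) (snd a) - q)\<^sup>2)
      = (LINT \<xi>|std_gaussian. exp (s * \<xi> * (R a - q * real N)))" for a
  proof -
    have "R a - q * real N = real N * (overlap N V (fst a) (snd a) - q)"
      using N by (simp add: R_def overlap_def field_simps)
    then have "(s * (R a - q * real N))\<^sup>2 / 2 = (real N * s\<^sup>2) * (real N * (overlap N V (fst a) (snd a) - q)\<^sup>2) / 2"
      by (simp add: power_mult_distrib power2_eq_square)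
    also have "\<dots> = l * real N * (overlap N V (fst a) (snd a) - q)\<^sup>2"
      unfolding s(3) by simp
    finally show ?thesis
      using integral_std_gaussian_exp[of "s * (R a - q * real N)"] by (simp add: mult_ac)
  qed
  have "(LINT \<omega>|gaussians I. G \<omega> (\<lambda>a. exp (l * real N * (overlap N V (fst a) (snd a) - q)\<^sup>2)))
      = (\<Sum>a\<in>?S. (LINT \<xi>|std_gaussian. exp (s * \<xi> * (R a - q * real N))) * P a)"
    unfolding GP lin ..
  also have "\<dots> = (LINT \<xi>|std_gaussian. (\<Sum>a\<in>?S. exp (s * \<xi> * (R a - q * real N)) * P a))"
    using integrable_std_gaussian_exp[of "s * (R a - q * real N)" for a]
    by (subst Bochner_Integration.integral_sum) (auto simp: mult_ac)
  also have "\<dots> \<le> (LINT \<xi>|std_gaussian. exp (\<bar>\<xi>\<bar> + l * \<xi>\<^sup>2))"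
  proof (rule integral_mono)
    show "integrable std_gaussian (\<lambda>\<xi>. \<Sum>a\<in>?S. exp (s * \<xi> * (R a - q * real N)) * P a)"
      using integrable_std_gaussian_exp[of "s * (R a - q * real N)" for a] by (auto simp: mult_ac)
    show "integrable std_gaussian (\<lambda>\<xi>. exp (\<bar>\<xi>\<bar> + l * \<xi>\<^sup>2))"
      by (rule gaussian_square_exp_integrable[OF l(2)])
    fix \<xi> :: real
    have "(\<Sum>a\<in>?S. exp (s * \<xi> * (R a - q * real N)) * P a) \<le> exp (\<bar>s * \<xi>\<bar> + real N * (s * \<xi>)\<^sup>2 / 2)"
      by (rule mgf)
    also have "real N * (s * \<xi>)\<^sup>2 / 2 = l * \<xi>\<^sup>2"
      using s(3) by (simp add: power_mult_distrib mult.assoc[symmetric])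
    also have "exp (\<bar>s * \<xi>\<bar> + l * \<xi>\<^sup>2) \<le> exp (\<bar>\<xi>\<bar> + l * \<xi>\<^sup>2)"
      using s by (simp add: abs_mult mult_left_le_one_le)
    finally show "(\<Sum>a\<in>?S. exp (s * \<xi> * (R a - q * real N)) * P a) \<le> exp (\<bar>\<xi>\<bar> + l * \<xi>\<^sup>2)" .
  qed
  finally show ?thesis unfolding G_def y_def .
qed

subsection \<open>The coupled system\<close>

text \<open>The path of disorders is \<open>sin t\<close> times the couplings plus \<open>cos t\<close> times independent Gaussian fields of
  variance \<open>\<beta>\<^sup>2 q\<close>; the trigonometric parametrisation is smooth up to both ends. The field at the site \<open>i\<close> is
  stored under the diagonal index \<open>(i, i)\<close>. For a fixed exponent the exponential moment of the overlap
  deviation grows along the path at most at a rate proportional to the moment with an additional squared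
  deviation. Lowering the coefficient in the exponent to \<open>l - 2 \<beta>\<^sup>2 sin\<^sup>2 t\<close> compensates this, so the moment
  at the coupled end is at most the one at the decoupled end.\<close>

lemma overlap_exponential_moment:
  fixes \<beta> h l :: real
  assumes V: "finite V" "card V + 1 = N" and \<beta>: "0 < \<beta>" "\<beta> < 1" and l: "0 \<le> l" "l < 1 / 2" "2 * \<beta>\<^sup>2 \<le> l"
  shows "(LINT g|gaussians (pairs V). sk_gibbs2 (\<beta> / sqrt (real N)) h V g
      (\<lambda>a. exp ((l - 2 * \<beta>\<^sup>2) * real N * (overlap N V (fst a) (snd a) - overlap_q \<beta> h)\<^sup>2)))
    \<le> (LINT \<xi>|std_gaussian. exp (\<bar>\<xi>\<bar> + l * \<xi>\<^sup>2))"
proof -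
  let ?C = "configs V"
  let ?S = "?C \<times> ?C"
  define q where "q = overlap_q \<beta> h"
  define b where "b = \<beta> / sqrt (real N)"
  define I where "I = pairs V \<union> (\<lambda>i. (i, i)) ` V"
  \<comment> \<open>Indices on the diagonal carry the independent fields, the others the couplings.\<close>
  define c where "c = (\<lambda>t (p::nat \<times> nat). if fst p = snd p then cos t else sin t :: real)"
  define c' where "c' = (\<lambda>t (p::nat \<times> nat). if fst p = snd p then - sin t else cos t :: real)"
  define e where "e = (\<lambda>x (p::nat \<times> nat). if fst p = snd p then \<beta> * sqrt q * x (fst p)
      else b * (x (fst p) * x (snd p)) :: real)"
  define E where "E = (\<lambda>a p. e (fst a) p + e (snd a) p)"
  define u where "u = (\<lambda>a. overlap N V (fst a) (snd a) - q)"
  define f where "f = (\<lambda>t a. exp ((l - 2 * \<beta>\<^sup>2 * (sin t)\<^sup>2) * real N * (u a)\<^sup>2))"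
  define f' where "f' = (\<lambda>t a. - (4 * \<beta>\<^sup>2 * sin t * cos t * real N) * (f t a * (u a)\<^sup>2))"
  define H where "H = (\<lambda>a::(nat \<Rightarrow> real) \<times> (nat \<Rightarrow> real). h * (\<Sum>i\<in>V. fst a i) + h * (\<Sum>i\<in>V. snd a i))"
  define G where "G = (\<lambda>t \<omega>. gibbs ?S (\<lambda>a. (\<Sum>p\<in>I. c t p * E a p * \<omega> p) + H a))"
  \<comment> \<open>A common bound for the quantities that the interpolation formula requires to be bounded.\<close>
  define B where "B = 1 + 2 * (\<beta> * sqrt q + \<bar>b\<bar>) + (1 + 16 * \<beta>\<^sup>2 * real N) * exp (4 * l * real N)"
  have N: "real N > 0" "card V \<le> N" using V(2) by auto
  have q: "0 \<le> q" "q \<le> 1"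
    unfolding q_def using overlap_q_fixed_point[OF \<beta>] by auto
  have b2: "b\<^sup>2 = \<beta>\<^sup>2 / real N" using N by (simp add: b_def power_divide)
  have I: "finite I" "pairs V \<subseteq> I" "\<And>i. i \<in> V \<Longrightarrow> (i, i) \<in> I" using V by (auto simp: I_def)
  have S: "finite ?S" "?S \<noteq> {}" using V by auto
  have Iprop: "fst p \<in> V" "snd p \<in> V" if "p \<in> I" for p using that by (auto simp: I_def pairs_def)
  have u2: "(u a)\<^sup>2 \<le> 4" if a: "a \<in> ?S" for a
  proof -
    have "\<bar>u a\<bar> \<le> 2"
      using overlap_abs_le[of "fst a" V "snd a" N] a N q unfolding u_def by auto
    then have "\<bar>u a\<bar>\<^sup>2 \<le> 2\<^sup>2" by (intro power_mono) auto
    then show ?thesis by simp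
  qed
  have eb: "\<bar>e x p\<bar> \<le> \<beta> * sqrt q + \<bar>b\<bar>" if "x \<in> ?C" "p \<in> I" for x p
    using configs_spin_abs[OF that(1) Iprop(1)[OF that(2)]] configs_spin_abs[OF that(1) Iprop(2)[OF that(2)]] \<beta> q
    unfolding e_def by (simp add: abs_mult)
  have fb: "\<bar>f t a\<bar> \<le> exp (4 * l * real N)" if "a \<in> ?S" for t a
  proof -
    have "(l - 2 * \<beta>\<^sup>2 * (sin t)\<^sup>2) * real N * (u a)\<^sup>2 \<le> (l * real N) * (u a)\<^sup>2"
      using N by (intro mult_right_mono) auto
    also have "\<dots> \<le> (l * real N) * 4" using l N u2[OF that] by (intro mult_left_mono) auto
    finally show ?thesis by (simp add: f_def)
  qed
  have f'b: "\<bar>f' t a\<bar> \<le> 16 * \<beta>\<^sup>2 * real N * exp (4 * l * real N)" if "a \<in> ?S" for t a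
  proof -
    have sc: "\<bar>sin t\<bar> * \<bar>cos t\<bar> \<le> 1 * 1" by (intro mult_mono) auto
    have "\<bar>f' t a\<bar> = (4 * \<beta>\<^sup>2 * real N) * ((\<bar>sin t\<bar> * \<bar>cos t\<bar>) * (\<bar>f t a\<bar> * (u a)\<^sup>2))"
      unfolding f'_def by (simp add: abs_mult)
    also have "\<dots> \<le> (4 * \<beta>\<^sup>2 * real N) * ((1 * 1) * (exp (4 * l * real N) * 4))"
      by (rule mult_left_mono[OF mult_mono[OF sc mult_mono[OF fb[OF that] u2[OF that]]]]) auto
    finally show ?thesis by (simp add: mult_ac)
  qed
  \<comment> \<open>The couplings contribute a multiple of \<open>R\<^sup>2\<close> and the fields a multiple of \<open>- 2 q R\<close>; the constant holds what
    completes the square and the diagonal that is missing in the sum over pairs of sites.\<close>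
  have kern: "(\<Sum>p\<in>I. (c t p * c' t p) * e x p * e y p)
      = (sin t * cos t * (real N * \<beta>\<^sup>2 / 2)) * (u (x, y))\<^sup>2
        - sin t * cos t * (real N * \<beta>\<^sup>2 * q\<^sup>2 / 2 + \<beta>\<^sup>2 * real (card V) / (2 * real N))"
    if "x \<in> ?C" "y \<in> ?C" for t x y
  proof -
    define R where "R = overlap N V x y"
    have R: "(\<Sum>i\<in>V. x i * y i) = real N * R" using N by (simp add: R_def overlap_def)
    have sq: "(\<Sum>i\<in>V. (x i * y i)\<^sup>2) = real (card V)"
    proof -
      have "(x i * y i)\<^sup>2 = (x i * x i) * (y i * y i)" for i by (simp add: power2_eq_square)
      then show ?thesis using that by (simp add: configs_spin_sq)
    qed
    have "(\<Sum>p\<in>pairs V. (c t p * c' t p) * e x p * e y p)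
        = (\<Sum>p\<in>pairs V. (sin t * cos t * b\<^sup>2) * ((x (fst p) * y (fst p)) * (x (snd p) * y (snd p))))"
      by (intro sum.cong refl) (auto simp: pairs_def c_def c'_def e_def power2_eq_square)
    also have "\<dots> = (sin t * cos t * b\<^sup>2) * (((real N * R)\<^sup>2 - real (card V)) / 2)"
      using sum_pairs[OF V(1), of "\<lambda>i. x i * y i"] unfolding R sq by (simp add: sum_distrib_left[symmetric])
    also have "\<dots> = sin t * cos t * (real N * \<beta>\<^sup>2 / 2 * R\<^sup>2 - \<beta>\<^sup>2 * real (card V) / (2 * real N))"
      unfolding b2 using N by (simp add: field_simps power2_eq_square)
    finally have off: "(\<Sum>p\<in>pairs V. (c t p * c' t p) * e x p * e y p)
      = sin t * cos t * (real N * \<beta>\<^sup>2 / 2 * R\<^sup>2 - \<beta>\<^sup>2 * real (card V) / (2 * real N))" .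
    have "(\<Sum>i\<in>V. (c t (i, i) * c' t (i, i)) * e x (i, i) * e y (i, i))
        = (\<Sum>i\<in>V. (- (sin t * cos t * \<beta>\<^sup>2 * q)) * (x i * y i))"
      using q by (intro sum.cong refl) (simp add: c_def c'_def e_def power2_eq_square)
    also have "\<dots> = - (sin t * cos t * \<beta>\<^sup>2 * q) * (real N * R)"
      by (simp only: sum_distrib_left[symmetric] R)
    finally have diag: "(\<Sum>i\<in>V. (c t (i, i) * c' t (i, i)) * e x (i, i) * e y (i, i))
        = - (sin t * cos t * \<beta>\<^sup>2 * q) * (real N * R)" .
    show ?thesis
      unfolding I_def sum_pairs_diag[OF V(1)] off diag u_def fst_conv snd_conv R_def[symmetric]
      by (simp add: power2_eq_square algebra_simps)
  qed
  have self: "u (x, x) = real (card V) / real N - q" if "x \<in> ?C" for x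
    using that by (simp add: u_def overlap_def configs_spin_sq)
  have deriv: "((\<lambda>t. LINT \<omega>|gaussians I. G t \<omega> (f t)) has_real_derivative
     (LINT \<omega>|gaussians I. G t \<omega> (f' t) + (\<Sum>p\<in>I. c t p * c' t p *
        third_cumulant (G t \<omega>) (f t) (\<lambda>x. E x p)))) (at t)" for t
    unfolding G_def
  proof (rule gaussian_gibbs_interpolation[OF I(1) S, where B = B])
    show "((\<lambda>t. c t p) has_real_derivative c' t p) (at t)" for t p
      unfolding c_def c'_def by (auto intro!: derivative_eq_intros)
    show "((\<lambda>t. f t a) has_real_derivative f' t a) (at t)" for t a
      unfolding f_def f'_def
      by (auto intro!: derivative_eq_intros simp: power2_eq_square)
    have B: "1 \<le> B" "2 * (\<beta> * sqrt q + \<bar>b\<bar>) \<le> B" "exp (4 * l * real N) \<le> B"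
      "16 * \<beta>\<^sup>2 * real N * exp (4 * l * real N) \<le> B"
      using \<beta> q N by (auto simp: B_def distrib_right add_nonneg_nonneg intro: add_increasing add_increasing2)
    show "\<bar>c' t p\<bar> \<le> B" for t p
      by (rule order_trans[OF _ B(1)]) (simp add: c'_def)
    show "\<bar>E a p\<bar> \<le> B" if "a \<in> ?S" "p \<in> I" for a p
      using eb[of "fst a" p] eb[of "snd a" p] that B(2) unfolding E_def by auto
    show "\<bar>f t a\<bar> \<le> B" "\<bar>f' t a\<bar> \<le> B" if "a \<in> ?S" for t a
      using fb[OF that, of t] f'b[OF that, of t] B(3,4) by auto
  qed
  have "(LINT \<omega>|gaussians I. G (pi / 2) \<omega> (f (pi / 2))) \<le> (LINT \<omega>|gaussians I. G 0 \<omega> (f 0))"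
  proof (rule DERIV_nonpos_imp_nonincreasing[of 0 "pi / 2" "\<lambda>t. LINT \<omega>|gaussians I. G t \<omega> (f t)"])
    fix t :: real assume t: "0 \<le> t" "t \<le> pi / 2"
    have sc: "0 \<le> sin t * cos t"
      using t by (intro mult_nonneg_nonneg sin_ge_zero cos_ge_zero) auto
    have le0: "G t \<omega> (f' t) + (\<Sum>p\<in>I. c t p * c' t p *
        third_cumulant (G t \<omega>) (f t) (\<lambda>x. E x p)) \<le> 0" for \<omega>
    proof -
      define A where "A = (\<lambda>x. (\<Sum>p\<in>I. c t p * e x p * \<omega> p) + h * (\<Sum>i\<in>V. x i))"
      define w where "w = (\<lambda>x. exp (A x) / (\<Sum>y\<in>?C. exp (A y)))"
      define M where "M = (\<lambda>g. \<Sum>a\<in>?S. w (fst a) * w (snd a) * g a)"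
      have GM: "G t \<omega> = M"
        unfolding G_def M_def w_def
        by (intro ext gibbs_pair) (use V in \<open>auto simp: A_def E_def H_def distrib_left distrib_right sum.distrib\<close>)
      have "(\<Sum>p\<in>I. (c t p * c' t p) * third_cumulant M (f t) (\<lambda>a. e (fst a) p + e (snd a) p))
        \<le> 8 * (sin t * cos t * (real N * \<beta>\<^sup>2 / 2)) * M (\<lambda>a. f t a * (u a)\<^sup>2)"
        unfolding M_def
      proof (rule replica_interpolation_bound[where \<kappa> = "\<lambda>p. c t p * c' t p" and C = "?C" and I = I
            and e = e and u = u and f = "f t" and w = w and A = "sin t * cos t * (real N * \<beta>\<^sup>2 / 2)"
            and \<gamma> = "sin t * cos t * (real N * \<beta>\<^sup>2 * q\<^sup>2 / 2 + \<beta>\<^sup>2 * real (card V) / (2 * real N))"])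
        show "(\<Sum>p\<in>I. (c t p * c' t p) * e x p * e y p)
          = (sin t * cos t * (real N * \<beta>\<^sup>2 / 2)) * (u (x, y))\<^sup>2
            - sin t * cos t * (real N * \<beta>\<^sup>2 * q\<^sup>2 / 2 + \<beta>\<^sup>2 * real (card V) / (2 * real N))"
          if "x \<in> ?C" "y \<in> ?C" for x y
          using that by (rule kern)
        show "0 \<le> w x" for x unfolding w_def by (rule softmax_prob) (use V in auto)
        show "(\<Sum>x\<in>?C. w x) = 1" unfolding w_def by (rule softmax_prob) (use V in auto)
        show "(\<Sum>p\<in>I. (c t p * c' t p) * e x p * e x p)
          = (sin t * cos t * (real N * \<beta>\<^sup>2 / 2)) * (real (card V) / real N - q)\<^sup>2
            - sin t * cos t * (real N * \<beta>\<^sup>2 * q\<^sup>2 / 2 + \<beta>\<^sup>2 * real (card V) / (2 * real N))"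
          if "x \<in> ?C" for x
          using kern[OF that that, of t] self[OF that] by simp
        show "0 \<le> sin t * cos t * (real N * \<beta>\<^sup>2 / 2)" by (rule mult_nonneg_nonneg[OF sc]) simp
        show "0 \<le> f t a" for a by (simp add: f_def)
        show "0 \<le> ((u a)\<^sup>2 - (u b)\<^sup>2) * (f t a - f t b)" if "a \<in> ?S" "b \<in> ?S" for a b
        proof -
          have "(sin t)\<^sup>2 \<le> 1" by (simp add: abs_square_le_1)
          then have "2 * \<beta>\<^sup>2 * (sin t)\<^sup>2 \<le> 2 * \<beta>\<^sup>2 * 1" by (intro mult_left_mono) auto
          then have "0 \<le> (l - 2 * \<beta>\<^sup>2 * (sin t)\<^sup>2) * real N" using l(3) N by (intro mult_nonneg_nonneg) auto
          then show ?thesis unfolding f_def by (rule exp_monotone_product)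
        qed
      qed
      moreover have "M (f' t) = - (4 * \<beta>\<^sup>2 * sin t * cos t * real N) * M (\<lambda>a. f t a * (u a)\<^sup>2)"
        unfolding f'_def M_def by (simp add: sum_distrib_left sum_negf mult_ac)
      ultimately show ?thesis unfolding GM E_def by (simp add: mult_ac)
    qed
    have "(LINT \<omega>|gaussians I. G t \<omega> (f' t) + (\<Sum>p\<in>I. c t p * c' t p *
        third_cumulant (G t \<omega>) (f t) (\<lambda>x. E x p))) \<le> 0"
      (is "integral\<^sup>L _ ?F \<le> 0")
    proof -
      have "0 \<le> (LINT \<omega>|gaussians I. - ?F \<omega>)"
        by (intro Bochner_Integration.integral_nonneg) (unfold neg_0_le_iff_le, rule le0)
      then show ?thesis by (simp only: Bochner_Integration.integral_minus neg_0_le_iff_le)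
    qed
    then show "\<exists>y. ((\<lambda>t. LINT \<omega>|gaussians I. G t \<omega> (f t)) has_real_derivative y) (at t) \<and> y \<le> 0"
      using deriv[of t] by blast
  qed simp
  also have "(LINT \<omega>|gaussians I. G 0 \<omega> (f 0)) \<le> (LINT \<xi>|std_gaussian. exp (\<bar>\<xi>\<bar> + l * \<xi>\<^sup>2))"
  proof -
    have en: "(\<Sum>p\<in>I. c 0 p * E a p * \<omega> p) + H a = (\<Sum>i\<in>V. (\<beta> * \<omega> (i, i) * sqrt q + h) * fst a i)
        + (\<Sum>i\<in>V. (\<beta> * \<omega> (i, i) * sqrt q + h) * snd a i)" for a \<omega>
    proof -
      have "(\<Sum>p\<in>pairs V. c 0 p * E a p * \<omega> p) = 0"
        by (intro sum.neutral) (auto simp: c_def pairs_def)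
      then show ?thesis
        unfolding I_def sum_pairs_diag[OF V(1)]
        by (simp add: c_def E_def e_def H_def sum.distrib[symmetric] sum_distrib_left algebra_simps)
    qed
    show ?thesis
      using decoupled_overlap_bound[OF V \<beta> l(1,2) I(1,3), of h]
      unfolding G_def en f_def u_def q_def by simp
  qed
  also have "(LINT \<omega>|gaussians I. G (pi / 2) \<omega> (f (pi / 2)))
      = (LINT \<omega>|gaussians (pairs V). sk_gibbs2 b h V \<omega> (f (pi / 2)))"
  proof -
    have en: "(\<Sum>p\<in>I. c (pi / 2) p * E a p * \<omega> p) + H a = sk_energy b h V \<omega> (fst a) + sk_energy b h V \<omega> (snd a)" for a \<omega>
    proof -
      have "(\<Sum>p\<in>pairs V. c (pi / 2) p * E a p * \<omega> p)
          = (\<Sum>p\<in>pairs V. b * (fst a (fst p) * fst a (snd p)) * \<omega> p + b * (snd a (fst p) * snd a (snd p)) * \<omega> p)"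
        by (intro sum.cong refl) (auto simp: c_def E_def e_def pairs_def algebra_simps)
      then show ?thesis
        unfolding I_def sum_pairs_diag[OF V(1)]
        by (simp add: c_def H_def sk_energy_def sum.distrib)
    qed
    have "(LINT \<omega>|gaussians I. G (pi / 2) \<omega> (f (pi / 2))) = (LINT \<omega>|gaussians I. sk_gibbs2 b h V \<omega> (f (pi / 2)))"
      unfolding G_def en sk_gibbs2_def ..
    also have "\<dots> = (LINT \<omega>|gaussians (pairs V). sk_gibbs2 b h V \<omega> (f (pi / 2)))"
    proof (rule gaussians_marginal[OF I(1,2)])
      show "integrable (gaussians I) (\<lambda>\<omega>. sk_gibbs2 b h V \<omega> (f (pi / 2)))"
      proof (rule exp_growth_integrable[OF I(1)])
        show "(\<lambda>\<omega>. sk_gibbs2 b h V \<omega> (f (pi / 2))) \<in> borel_measurable (gaussians I)"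
          unfolding sk_gibbs2_def en[symmetric]
          by (intro gibbs_measurable borel_measurable_add borel_measurable_const linear_form_measurable)
        show "exp_growth I (\<lambda>\<omega>. sk_gibbs2 b h V \<omega> (f (pi / 2)))"
          unfolding sk_gibbs2_def
          by (rule exp_growth_bounded, rule gibbs_abs_le[OF S fb])
      qed
    qed (auto simp: sk_gibbs2_def sk_energy_def intro!: gibbs_cong arg_cong2[where f = "(+)"] sum.cong)
    finally show ?thesis .
  qed
  finally show ?thesis unfolding f_def u_def b_def q_def by simp
qed

lemma power_le_fact_exp:
  assumes "0 \<le> (x::real)"
  shows "x ^ m \<le> fact m * exp x"
proof -
  have "(\<Sum>n\<in>{m}. x ^ n /\<^sub>R fact n) \<le> (\<Sum>n. x ^ n /\<^sub>R fact n)"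
    using assms by (intro sum_le_suminf summable_exp_generic) auto
  then have "x ^ m / fact m \<le> exp x" by (simp add: exp_def field_simps)
  then show ?thesis by (simp add: field_simps)
qed

text \<open>The choice \<open>l = 1/4 + \<beta>0\<^sup>2\<close> lies halfway between \<open>2 \<beta>0\<^sup>2\<close> and \<open>1/2\<close>, so both \<open>l < 1/2\<close> and
  \<open>l - 2 \<beta>\<^sup>2 \<ge> 1/4 - \<beta>0\<^sup>2 > 0\<close> hold; this is where \<open>\<beta>0 < 1/2\<close> enters. Moments are bounded by the exponential
  moment.\<close>

theorem overlap_moments:
  fixes \<beta>0 :: real and m :: nat
  assumes "0 < \<beta>0" "\<beta>0 < 1 / 2"
  shows "\<exists>K\<ge>0. \<forall>N V \<beta> h. finite V \<longrightarrow> card V + 1 = N \<longrightarrow> 0 < \<beta> \<longrightarrow> \<beta> \<le> \<beta>0 \<longrightarrow>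
    (LINT g|gaussians (pairs V). sk_gibbs2 (\<beta> / sqrt (real N)) h V g
      (\<lambda>a. (overlap N V (fst a) (snd a) - overlap_q \<beta> h) ^ (2 * m))) \<le> K / real N ^ m"
proof -
  define l where "l = 1 / 4 + \<beta>0\<^sup>2"
  define d where "d = 1 / 4 - \<beta>0\<^sup>2"
  define K where "K = (LINT \<xi>|std_gaussian. exp (\<bar>\<xi>\<bar> + l * \<xi>\<^sup>2))"
  have b0: "\<beta>0\<^sup>2 < 1 / 4" using power_strict_mono[of \<beta>0 "1/2" 2] assms by (simp add: power2_eq_square)
  have l: "0 \<le> l" "l < 1 / 2" and d: "0 < d" using b0 by (auto simp: l_def d_def)
  have K: "0 \<le> K" unfolding K_def by (intro Bochner_Integration.integral_nonneg) auto
  show ?thesis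
  proof (intro exI[of _ "fact m * K / d ^ m"] conjI allI impI)
    show "0 \<le> fact m * K / d ^ m" using K d by simp
    fix N :: nat and V :: "nat set" and \<beta> h :: real
    assume V: "finite V" "card V + 1 = N" and \<beta>: "0 < \<beta>" "\<beta> \<le> \<beta>0"
    have N: "real N > 0" using V by auto
    have bb: "\<beta>\<^sup>2 \<le> \<beta>0\<^sup>2" using \<beta> by (intro power_mono) auto
    let ?b = "\<beta> / sqrt (real N)"
    let ?u = "\<lambda>a. overlap N V (fst a) (snd a) - overlap_q \<beta> h"
    let ?S = "configs V \<times> configs V"
    have S: "finite ?S" "?S \<noteq> {}" using V by auto
    have le: "?u a ^ (2 * m) \<le> fact m / (d * real N) ^ m * exp ((l - 2 * \<beta>\<^sup>2) * real N * (?u a)\<^sup>2)" for a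
    proof -
      have "(d * real N * (?u a)\<^sup>2) ^ m \<le> fact m * exp (d * real N * (?u a)\<^sup>2)"
        using d N by (intro power_le_fact_exp) auto
      also have "\<dots> \<le> fact m * exp ((l - 2 * \<beta>\<^sup>2) * real N * (?u a)\<^sup>2)"
        using bb N by (intro mult_left_mono) (auto simp: l_def d_def intro!: mult_right_mono)
      finally show ?thesis
        unfolding power_mult power_mult_distrib using d N by (simp add: field_simps)
    qed
    have bl: "2 * \<beta>\<^sup>2 \<le> l" using bb b0 unfolding l_def by linarith
    have "(LINT g|gaussians (pairs V). sk_gibbs2 ?b h V g (\<lambda>a. ?u a ^ (2 * m)))
        \<le> (LINT g|gaussians (pairs V). sk_gibbs2 ?b h V g
              (\<lambda>a. fact m / (d * real N) ^ m * exp ((l - 2 * \<beta>\<^sup>2) * real N * (?u a)\<^sup>2)))"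
      by (intro integral_mono sk_gibbs2_integrable V(1))
         (unfold sk_gibbs2_def, rule gibbs_mono[OF S le])
    also have "\<dots> = fact m / (d * real N) ^ m * (LINT g|gaussians (pairs V). sk_gibbs2 ?b h V g
              (\<lambda>a. exp ((l - 2 * \<beta>\<^sup>2) * real N * (?u a)\<^sup>2)))"
      unfolding sk_gibbs2_def gibbs_mult by simp
    also have "\<dots> \<le> fact m / (d * real N) ^ m * K"
      unfolding K_def using V \<beta> l d N assms
      by (intro mult_left_mono overlap_exponential_moment bl) auto
    finally show "(LINT g|gaussians (pairs V). sk_gibbs2 ?b h V g (\<lambda>a. ?u a ^ (2 * m)))
        \<le> fact m * K / d ^ m / real N ^ m"
      by (simp add: power_mult_distrib)
  qed
qed

section \<open>Products of Hermite polynomials of nearly orthogonal Gaussians\<close>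

text \<open>The monic Hermite polynomials that are orthogonal for the centred Gaussian of variance \<open>v\<close>.\<close>

fun hermite :: "real \<Rightarrow> nat \<Rightarrow> real \<Rightarrow> real" where
  "hermite v 0 y = 1"
| "hermite v (Suc 0) y = y"
| "hermite v (Suc (Suc n)) y = y * hermite v (Suc n) y - real (Suc n) * v * hermite v n y"

lemma hermite_rec: "hermite v (Suc n) y = y * hermite v n y - real n * v * hermite v (n - 1) y"
  by (cases n) auto

lemma hermite_deriv:
  "((\<lambda>y. hermite v n y) has_real_derivative real n * hermite v (n - 1) y) (at y)"
proof (induction n rule: induct_nat_012)
  case (ge2 n)
  have "((\<lambda>y. y * hermite v (Suc n) y - real (Suc n) * v * hermite v n y) has_real_derivative
      1 * hermite v (Suc n) y + real (Suc n) * hermite v (Suc n - 1) y * y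
        - real (Suc n) * v * (real n * hermite v (n - 1) y)) (at y)"
    by (intro DERIV_diff DERIV_mult DERIV_cmult DERIV_ident ge2)
  then show ?case
    by (simp add: DERIV_cong hermite_rec[of v n] algebra_simps)
qed auto

lemma exp_growth_hermite:
  assumes "exp_growth I F"
  shows "exp_growth I (\<lambda>\<omega>. hermite v n (F \<omega>))"
proof (induction n rule: induct_nat_012)
  case (ge2 n)
  then show ?case using assms
    by (simp, intro exp_growth_diff exp_growth_mult exp_growth_const) auto
qed (use assms in auto)

lemma hermite_measurable [measurable]: "hermite v n \<in> borel_measurable borel"
  using hermite_deriv[of v n]
  by (intro borel_measurable_continuous_onI continuous_at_imp_continuous_on ballI DERIV_isCont) blast

text \<open>Integration by parts lowers one Hermite factor. The self covariance cancels against the recursion, and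
  what remains is a cross covariance with another factor, which also loses one degree, or the covariance
  with the exponent. So a pair of degrees costs \<open>r\<^sup>2\<close>, a single degree \<open>r\<close>, and the expectation has the size
  of \<open>r\<close> to the total degree.\<close>

lemma hermite_product_bound:
  fixes d :: "'x \<Rightarrow> 'i \<Rightarrow> real" and c :: "'i \<Rightarrow> real" and ord :: "'x \<Rightarrow> nat"
  assumes I: "finite I" and X: "finite X" and r: "0 \<le> r"
    and cov: "\<And>x y. x \<in> X \<Longrightarrow> y \<in> X \<Longrightarrow> x \<noteq> y \<Longrightarrow> \<bar>\<Sum>i\<in>I. d x i * d y i\<bar> \<le> r\<^sup>2"
    and cov_exp: "\<And>x. x \<in> X \<Longrightarrow> \<bar>\<Sum>i\<in>I. d x i * c i\<bar> \<le> r"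
  shows "\<bar>LINT \<omega>|gaussians I. (\<Prod>x\<in>X. hermite (\<Sum>i\<in>I. (d x i)\<^sup>2) (ord x) (\<Sum>i\<in>I. d x i * \<omega> i))
      * exp (\<Sum>i\<in>I. c i * \<omega> i)\<bar>
    \<le> fact (sum ord X) * r ^ (sum ord X) * exp ((\<Sum>i\<in>I. (c i)\<^sup>2) / 2)"
proof -
  define D where "D = (\<lambda>x (\<omega>::'i \<Rightarrow> real). \<Sum>i\<in>I. d x i * \<omega> i)"
  define L where "L = (\<lambda>\<omega>::'i \<Rightarrow> real. exp (\<Sum>i\<in>I. c i * \<omega> i))"
  define v where "v = (\<lambda>x. \<Sum>i\<in>I. (d x i)\<^sup>2)"
  define F where "F = (\<lambda>ord \<omega>. (\<Prod>x\<in>X. hermite (v x) (ord x) (D x \<omega>)) * L \<omega>)"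
  define EL where "EL = exp ((\<Sum>i\<in>I. (c i)\<^sup>2) / 2)"
  have Dm: "D x \<in> borel_measurable (gaussians I)" for x
    unfolding D_def by (rule linear_form_measurable)
  have Lm: "L \<in> borel_measurable (gaussians I)"
    unfolding L_def by (intro measurable_compose[OF _ borel_measurable_exp] linear_form_measurable)
  have Fm: "F ord \<in> borel_measurable (gaussians I)" for ord
    unfolding F_def
    by (intro borel_measurable_times borel_measurable_prod Lm measurable_compose[OF Dm hermite_measurable])
  have Dg: "exp_growth I (D x)" for x
    unfolding D_def by (rule exp_growth_linear[OF I])
  have Fg: "exp_growth I (F ord)" for ord
    unfolding F_def L_def
    by (intro exp_growth_mult exp_growth_prod exp_growth_hermite Dg exp_growth_exp_linear I)
  have Fi: "integrable (gaussians I) (F ord)" for ord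
    by (rule exp_growth_integrable[OF I Fm Fg])
  let ?E = "integral\<^sup>L (gaussians I)"
  have step: "(LINT \<omega>|gaussians I. D z \<omega> * F ord \<omega>)
      = (\<Sum>x\<in>X. (\<Sum>i\<in>I. d z i * d x i) * (real (ord x) * ?E (F (ord(x := ord x - 1)))))
        + (\<Sum>i\<in>I. d z i * c i) * ?E (F ord)" for z ord
  proof -
    have F_lower: "real (ord x) * hermite (v x) (ord x - 1) (D x \<omega>)
        * (\<Prod>y\<in>X - {x}. hermite (v y) (ord y) (D y \<omega>)) * L \<omega>
        = real (ord x) * F (ord(x := ord x - 1)) \<omega>" if x: "x \<in> X" for x \<omega>
    proof -
      have "(\<Prod>y\<in>X. hermite (v y) ((ord(x := ord x - 1)) y) (D y \<omega>))
          = hermite (v x) (ord x - 1) (D x \<omega>) * (\<Prod>y\<in>X - {x}. hermite (v y) (ord y) (D y \<omega>))"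
        using X x by (subst prod.remove[of _ x]) (auto intro!: prod.cong)
      then show ?thesis by (simp add: F_def)
    qed
    define F' where "F' = (\<lambda>i \<omega>. (\<Sum>x\<in>X. d x i * (real (ord x) * F (ord(x := ord x - 1)) \<omega>)) + c i * F ord \<omega>)"
    have ibp: "(LINT \<omega>|gaussians I. \<omega> i * F ord \<omega>) = (LINT \<omega>|gaussians I. F' i \<omega>)" if i: "i \<in> I" for i
    proof (rule gaussian_ibp[OF I i Fm _ Fg])
      show "F' i \<in> borel_measurable (gaussians I)"
        unfolding F'_def
        by (intro borel_measurable_add borel_measurable_sum borel_measurable_times borel_measurable_const Fm)
      show "exp_growth I (F' i)"
        unfolding F'_def by (intro exp_growth_add exp_growth_sum exp_growth_mult exp_growth_const Fg)
      have Fd: "((\<lambda>s. F ord (x(i := s))) has_real_derivative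
          (\<Sum>y\<in>X. d y i * (real (ord y) * hermite (v y) (ord y - 1) (D y x)
             * (\<Prod>z\<in>X - {y}. hermite (v z) (ord z) (D z x)) * L x))
          + c i * F ord x) (at (x i))" for ord x
      proof -
        have dh: "((\<lambda>s. hermite (v y) (ord y) (D y (x(i := s)))) has_real_derivative
            real (ord y) * hermite (v y) (ord y - 1) (D y (x(i := x i))) * d y i) (at (x i))" for y
          unfolding D_def by (rule DERIV_chain2[OF hermite_deriv linear_form_deriv[OF I i]])
        have dL: "((\<lambda>s. L (x(i := s))) has_real_derivative L (x(i := x i)) * c i) (at (x i))"
          unfolding L_def by (rule DERIV_chain2[OF DERIV_exp linear_form_deriv[OF I i]])
        show ?thesis
          unfolding F_def
          by (rule DERIV_cong[OF DERIV_mult[OF has_field_derivative_prod dL]], rule dh)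
             (simp add: sum_distrib_left sum_distrib_right mult_ac)
      qed
      show "((\<lambda>s. F ord (x(i := s))) has_real_derivative F' i x) (at (x i))" for x
        by (rule DERIV_cong[OF Fd]) (simp add: F'_def F_lower del: One_nat_def)
      have Fc: "isCont (\<lambda>s. F ord (x(i := s))) s" for ord x s
        using DERIV_isCont[OF Fd[of ord "x(i := s)"]] by simp
      show "isCont (\<lambda>s. F' i (x(i := s))) s" for x s
        unfolding F'_def by (intro continuous_intros Fc)
    qed
    have iF: "integrable (gaussians I) (\<lambda>\<omega>. \<omega> i * F ord \<omega>)" if i: "i \<in> I" for i
      by (rule exp_growth_integrable[OF I _ exp_growth_mult[OF exp_growth_component[OF I i] Fg]])
         (intro borel_measurable_times gaussians_component i Fm)
    have "(LINT \<omega>|gaussians I. D z \<omega> * F ord \<omega>) = (\<Sum>i\<in>I. d z i * (LINT \<omega>|gaussians I. \<omega> i * F ord \<omega>))"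
      unfolding D_def sum_distrib_right mult.assoc
      by (subst Bochner_Integration.integral_sum) (auto intro!: integrable_mult_right iF)
    also have "\<dots> = (\<Sum>i\<in>I. d z i * ((\<Sum>x\<in>X. d x i * (real (ord x) * ?E (F (ord(x := ord x - 1)))))
        + c i * ?E (F ord)))"
    proof (intro sum.cong refl arg_cong2[where f = "(*)"])
      fix i assume "i \<in> I"
      show "(LINT \<omega>|gaussians I. \<omega> i * F ord \<omega>) 
          = (\<Sum>x\<in>X. d x i * (real (ord x) * ?E (F (ord(x := ord x - 1)))))
            + c i * ?E (F ord)"
        unfolding ibp[OF \<open>i \<in> I\<close>] F'_def
        by (subst Bochner_Integration.integral_add)
           (auto intro!: Bochner_Integration.integrable_sum integrable_mult_right Fi 
              simp: Bochner_Integration.integral_sum Fi)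
    qed
    also have "\<dots> = (\<Sum>i\<in>I. \<Sum>x\<in>X. d z i * d x i * (real (ord x) * ?E (F (ord(x := ord x - 1)))))
        + (\<Sum>i\<in>I. d z i * c i * ?E (F ord))"
      by (simp add: distrib_left sum.distrib sum_distrib_left mult.assoc)
    also have "\<dots> = (\<Sum>x\<in>X. (\<Sum>i\<in>I. d z i * d x i) * (real (ord x) * ?E (F (ord(x := ord x - 1)))))
        + (\<Sum>i\<in>I. d z i * c i) * ?E (F ord)"
      by (subst sum.swap) (simp add: sum_distrib_right)
    finally show ?thesis .
  qed
  have main: "\<bar>?E (F ord)\<bar> \<le> fact p * r ^ p * EL" if "sum ord X = p" for ord p
    using that
  proof (induction p arbitrary: ord rule: less_induct)
    case (less p)
    show ?case
    proof (cases "p = 0")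
      case True
      then have "\<And>x. x \<in> X \<Longrightarrow> ord x = 0" using less.prems X by simp
      then have "F ord = L" by (auto simp: F_def)
      then show ?thesis using True gaussian_exp_linear[OF I, of c] by (simp add: L_def EL_def)
    next
      case False
      then obtain z where z: "z \<in> X" "ord z \<noteq> 0" using less.prems by (metis sum.neutral)
      define o1 where "o1 = ord(z := ord z - 1)"
      define n where "n = ord z - 1"
      have o1z: "o1 z = n" "ord z = Suc n" using z by (auto simp: o1_def n_def)
      have s1: "sum o1 X = p - 1"
      proof -
        have "sum ord X = ord z + sum ord (X - {z})" "sum o1 X = o1 z + sum o1 (X - {z})"
          using X z by (auto intro: sum.remove)
        moreover have "sum o1 (X - {z}) = sum ord (X - {z})" by (auto simp: o1_def intro: sum.cong)
        ultimately show ?thesis using less.prems o1z by simp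
      qed
      define o2 where "o2 = (\<lambda>x. o1(x := o1 x - 1))"
      have o2_fold: "o1(x := o1 x - 1) = o2 x" for x by (simp add: o2_def)
      have s2: "sum (o2 x) X = p - 2" if "x \<in> X" "o1 x \<noteq> 0" for x
      proof -
        have "sum o1 X = o1 x + sum o1 (X - {x})" "sum (o2 x) X = o2 x x + sum (o2 x) (X - {x})"
          using X that by (auto intro: sum.remove)
        moreover have "sum (o2 x) (X - {x}) = sum o1 (X - {x})" by (auto simp: o2_def intro: sum.cong)
        ultimately show ?thesis using s1 that by (simp add: o2_def)
      qed
      \<comment> \<open>The recursion isolates a linear factor, on which integration by parts acts.\<close>
      have expand: "F ord \<omega> = D z \<omega> * F o1 \<omega> - real n * v z * F (o2 z) \<omega>" for \<omega>
      proof -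
        let ?P = "\<Prod>y\<in>X - {z}. hermite (v y) (ord y) (D y \<omega>)"
        have P: "(\<Prod>y\<in>X. hermite (v y) (ord y) (D y \<omega>)) = hermite (v z) (Suc n) (D z \<omega>) * ?P"
          "(\<Prod>y\<in>X. hermite (v y) (o1 y) (D y \<omega>)) = hermite (v z) n (D z \<omega>) * ?P"
          "(\<Prod>y\<in>X. hermite (v y) (o2 z y) (D y \<omega>)) = hermite (v z) (n - 1) (D z \<omega>) * ?P"
          using X z o1z by (auto simp: prod.remove[of X z] o1_def o2_def intro!: prod.cong)
        show ?thesis unfolding F_def P hermite_rec[of "v z" n] by (simp add: algebra_simps)
      qed
      have iD: "integrable (gaussians I) (\<lambda>\<omega>. D z \<omega> * F o1 \<omega>)"
        by (intro exp_growth_integrable[OF I] borel_measurable_times exp_growth_mult Dm Fm Dg Fg)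
      have vz: "(\<Sum>i\<in>I. d z i * d z i) = v z" by (simp add: v_def power2_eq_square)
      have "?E (F ord)
          = (LINT \<omega>|gaussians I. D z \<omega> * F o1 \<omega>) - real n * v z * ?E (F (o2 z))"
        unfolding expand using iD Fi by simp
      \<comment> \<open>The term \<open>x = z\<close> is the self covariance and cancels against the second term of the recursion.\<close>
      also have "\<dots> = (\<Sum>x\<in>X - {z}. (\<Sum>i\<in>I. d z i * d x i) * (real (o1 x) * ?E (F (o2 x))))
        + (\<Sum>i\<in>I. d z i * c i) * ?E (F o1)"
        unfolding step o2_fold using X z(1)
        by (simp add: sum.remove[of X z] vz o1z)
      finally have eq: "?E (F ord)
        = (\<Sum>x\<in>X - {z}. (\<Sum>i\<in>I. d z i * d x i) * (real (o1 x) * ?E (F (o2 x))))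
        + (\<Sum>i\<in>I. d z i * c i) * ?E (F o1)" .
      have EL0: "0 \<le> EL" by (simp add: EL_def)
      have b1: "\<bar>(\<Sum>i\<in>I. d z i * c i) * ?E (F o1)\<bar> \<le> fact (p - 1) * r ^ p * EL"
      proof -
        have "\<bar>(\<Sum>i\<in>I. d z i * c i) * ?E (F o1)\<bar> \<le> r * (fact (p - 1) * r ^ (p - 1) * EL)"
          unfolding abs_mult using False r
          by (intro mult_mono cov_exp z(1) less.IH s1) auto
        also have "\<dots> = fact (p - 1) * r ^ p * EL" using False by (simp add: power_eq_if)
        finally show ?thesis .
      qed
      have b2: "\<bar>(\<Sum>i\<in>I. d z i * d x i) * (real (o1 x) * ?E (F (o2 x)))\<bar>
          \<le> real (o1 x) * (fact (p - 1) * r ^ p * EL)" if x: "x \<in> X - {z}" for x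
      proof (cases "o1 x = 0")
        case o1x: False
        then have p2: "2 \<le> p"
          using s1 x X member_le_sum[of x X o1] by auto
        have "\<bar>?E (F (o2 x))\<bar> \<le> fact (p - 2) * r ^ (p - 2) * EL"
          using x o1x p2 by (intro less.IH s2) auto
        also have "\<dots> \<le> fact (p - 1) * r ^ (p - 2) * EL"
          using r EL0 by (intro mult_right_mono) (auto intro!: fact_mono)
        finally have "\<bar>\<Sum>i\<in>I. d z i * d x i\<bar> * (real (o1 x) * \<bar>?E (F (o2 x))\<bar>)
            \<le> r\<^sup>2 * (real (o1 x) * (fact (p - 1) * r ^ (p - 2) * EL))"
          using x z(1) r EL0 by (intro mult_mono mult_left_mono cov) auto
        also have "\<dots> = real (o1 x) * (fact (p - 1) * (r\<^sup>2 * r ^ (p - 2)) * EL)" by simp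
        also have "r\<^sup>2 * r ^ (p - 2) = r ^ p" using p2 by (metis le_add_diff_inverse power_add)
        finally show ?thesis by (simp add: abs_mult)
      qed simp
      have "\<bar>?E (F ord)\<bar>
          \<le> (\<Sum>x\<in>X - {z}. real (o1 x) * (fact (p - 1) * r ^ p * EL)) + fact (p - 1) * r ^ p * EL"
        unfolding eq
        by (intro order_trans[OF abs_triangle_ineq] add_mono b1 order_trans[OF sum_abs] sum_mono b2)
      also have "\<dots> = real (sum o1 (X - {z}) + 1) * (fact (p - 1) * r ^ p * EL)"
        by (simp add: sum_distrib_right distrib_right)
      also have "\<dots> \<le> real p * (fact (p - 1) * r ^ p * EL)"
      proof (rule mult_right_mono)
        have "sum o1 (X - {z}) \<le> p - 1" using s1 X by (metis Diff_subset sum_mono2 zero_le)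
        then have "sum o1 (X - {z}) + 1 \<le> p" using False by simp
        then show "real (sum o1 (X - {z}) + 1) \<le> real p" by (simp only: of_nat_le_iff)
      qed (use r EL0 in auto)
      also have "\<dots> = fact p * r ^ p * EL"
        using False by (simp add: fact_reduce)
      finally show ?thesis .
    qed
  qed
  show ?thesis
    using main[OF refl, of ord] unfolding F_def D_def L_def v_def EL_def .
qed

lemma hermite_2: "hermite v 2 y = y\<^sup>2 - v"
  by (simp add: numeral_2_eq_2 power2_eq_square)

text \<open>Each factor is half a second Hermite polynomial plus a deviation of the variance. Both count as \<open>r\<^sup>2\<close>:
  the first by its degree, the second by assumption.\<close>

lemma centred_squares_bound:
  fixes d :: "'x \<Rightarrow> 'i \<Rightarrow> real" and c :: "'i \<Rightarrow> real"
  assumes I: "finite I" and X: "finite X" and r: "0 \<le> r"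
    and cov: "\<And>x y. x \<in> X \<Longrightarrow> y \<in> X \<Longrightarrow> x \<noteq> y \<Longrightarrow> \<bar>\<Sum>i\<in>I. d x i * d y i\<bar> \<le> r\<^sup>2"
    and cov_exp: "\<And>x. x \<in> X \<Longrightarrow> \<bar>\<Sum>i\<in>I. d x i * c i\<bar> \<le> r"
    and var: "\<And>x. x \<in> X \<Longrightarrow> \<bar>(\<Sum>i\<in>I. (d x i)\<^sup>2) / 2 - \<kappa>\<bar> \<le> r\<^sup>2"
  shows "\<bar>LINT \<omega>|gaussians I. (\<Prod>x\<in>X. (\<Sum>i\<in>I. d x i * \<omega> i)\<^sup>2 / 2 - \<kappa>) * exp (\<Sum>i\<in>I. c i * \<omega> i)\<bar>
    \<le> 2 ^ card X * fact (2 * card X) * r ^ (2 * card X) * exp ((\<Sum>i\<in>I. (c i)\<^sup>2) / 2)"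
proof -
  let ?D = "\<lambda>x \<omega>. \<Sum>i\<in>I. d x i * \<omega> i" and ?v = "\<lambda>x. \<Sum>i\<in>I. (d x i)\<^sup>2"
  let ?L = "\<lambda>\<omega>. exp (\<Sum>i\<in>I. c i * \<omega> i)"
  let ?H = "\<lambda>Y \<omega>. \<Prod>x\<in>Y. hermite (?v x) 2 (?D x \<omega>)"
  let ?EL = "exp ((\<Sum>i\<in>I. (c i)\<^sup>2) / 2)"
  have exp: "(\<Prod>x\<in>X. (?D x \<omega>)\<^sup>2 / 2 - \<kappa>) * ?L \<omega>
      = (\<Sum>Y\<in>Pow X. (1 / 2) ^ card Y * (\<Prod>x\<in>X - Y. ?v x / 2 - \<kappa>) * (?H Y \<omega> * ?L \<omega>))" for \<omega>
  proof -
    have "(\<Prod>x\<in>X. (?D x \<omega>)\<^sup>2 / 2 - \<kappa>) = (\<Prod>x\<in>X. 1 / 2 * hermite (?v x) 2 (?D x \<omega>) + (?v x / 2 - \<kappa>))"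
      by (intro prod.cong refl) (simp add: hermite_2 field_simps)
    also have "\<dots> = (\<Sum>Y\<in>Pow X. (\<Prod>x\<in>Y. 1 / 2 * hermite (?v x) 2 (?D x \<omega>)) * (\<Prod>x\<in>X - Y. ?v x / 2 - \<kappa>))"
      by (rule prod_add[OF X])
    finally have *: "(\<Prod>x\<in>X. (?D x \<omega>)\<^sup>2 / 2 - \<kappa>) = \<dots>" .
    show ?thesis
      unfolding * prod.distrib prod_constant sum_distrib_right
      by (intro sum.cong refl) (simp only: mult_ac)
  qed
  have int: "integrable (gaussians I) (\<lambda>\<omega>. ?H Y \<omega> * ?L \<omega>)" for Y
    by (intro exp_growth_integrable[OF I] borel_measurable_times borel_measurable_prod
        measurable_compose[OF linear_form_measurable hermite_measurable]
        measurable_compose[OF linear_form_measurable borel_measurable_exp]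
        exp_growth_mult exp_growth_prod exp_growth_hermite exp_growth_linear[OF I] exp_growth_exp_linear[OF I])
  have each: "\<bar>(1 / 2) ^ card Y * (\<Prod>x\<in>X - Y. ?v x / 2 - \<kappa>) * (LINT \<omega>|gaussians I. ?H Y \<omega> * ?L \<omega>)\<bar>
      \<le> fact (2 * card X) * r ^ (2 * card X) * ?EL" if Y: "Y \<in> Pow X" for Y
  proof -
    have fY: "finite Y" and cY: "card Y \<le> card X" using Y X by (auto intro: finite_subset card_mono)
    have "\<bar>LINT \<omega>|gaussians I. ?H Y \<omega> * ?L \<omega>\<bar> \<le> fact (sum (\<lambda>_. 2) Y) * r ^ (sum (\<lambda>_. 2) Y) * ?EL"
      using Y by (intro hermite_product_bound[OF I fY r] cov cov_exp) auto
    also have "sum (\<lambda>_. 2) Y = 2 * card Y" by simp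
    also have "fact (2 * card Y) * r ^ (2 * card Y) * ?EL \<le> fact (2 * card X) * r ^ (2 * card Y) * ?EL"
      using r cY by (intro mult_right_mono) (auto intro!: fact_mono)
    finally have h: "\<bar>LINT \<omega>|gaussians I. ?H Y \<omega> * ?L \<omega>\<bar> \<le> fact (2 * card X) * r ^ (2 * card Y) * ?EL" .
    have k: "\<bar>\<Prod>x\<in>X - Y. ?v x / 2 - \<kappa>\<bar> \<le> (r\<^sup>2) ^ card (X - Y)"
    proof -
      have "(\<Prod>x\<in>X - Y. \<bar>?v x / 2 - \<kappa>\<bar>) \<le> (\<Prod>x\<in>X - Y. r\<^sup>2)"
        using var by (intro prod_mono) auto
      then show ?thesis by (simp add: abs_prod)
    qed
    have "\<bar>(1 / 2) ^ card Y * (\<Prod>x\<in>X - Y. ?v x / 2 - \<kappa>) * (LINT \<omega>|gaussians I. ?H Y \<omega> * ?L \<omega>)\<bar>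
        \<le> 1 * (r\<^sup>2) ^ card (X - Y) * (fact (2 * card X) * r ^ (2 * card Y) * ?EL)"
      unfolding abs_mult using h k by (intro mult_mono) (auto simp: power_abs power_le_one)
    also have "\<dots> = fact (2 * card X) * ((r\<^sup>2) ^ card (X - Y) * (r\<^sup>2) ^ card Y) * ?EL"
      by (simp add: power_mult)
    also have "(r\<^sup>2) ^ card (X - Y) * (r\<^sup>2) ^ card Y = r ^ (2 * card X)"
      using card_Diff_subset[OF fY, of X] Y cY by (simp add: power_add[symmetric] power_mult)
    finally show ?thesis .
  qed
  have "\<bar>LINT \<omega>|gaussians I. (\<Prod>x\<in>X. (?D x \<omega>)\<^sup>2 / 2 - \<kappa>) * ?L \<omega>\<bar>
      = \<bar>\<Sum>Y\<in>Pow X. (1 / 2) ^ card Y * (\<Prod>x\<in>X - Y. ?v x / 2 - \<kappa>) * (LINT \<omega>|gaussians I. ?H Y \<omega> * ?L \<omega>)\<bar>"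
    unfolding exp using int by (subst Bochner_Integration.integral_sum) auto
  also have "\<dots> \<le> (\<Sum>Y\<in>Pow X. fact (2 * card X) * r ^ (2 * card X) * ?EL)"
    by (rule order_trans[OF sum_abs sum_mono[OF each]])
  also have "\<dots> = 2 ^ card X * fact (2 * card X) * r ^ (2 * card X) * ?EL"
    using X by (simp add: card_Pow)
  finally show ?thesis .
qed

section \<open>Replicas as product weights\<close>

lemma sum_PiE_marginal:
  fixes w :: "'s \<Rightarrow> real"
  assumes J: "finite J" "a \<in> J" and A: "finite A" and w: "(\<Sum>x\<in>A. w x) = 1"
  shows "(\<Sum>s\<in>PiE J (\<lambda>_. A). (\<Prod>j\<in>J. w (s j)) * f (s a)) = (\<Sum>x\<in>A. w x * f x)"
proof -
  have "(\<Sum>s\<in>PiE J (\<lambda>_. A). (\<Prod>j\<in>J. w (s j)) * f (s a))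
      = (\<Sum>s\<in>PiE J (\<lambda>_. A). \<Prod>j\<in>J. w (s j) * (if j = a then f (s j) else 1))"
    using J by (simp add: prod.distrib prod.delta)
  also have "\<dots> = (\<Prod>j\<in>J. \<Sum>x\<in>A. w x * (if j = a then f x else 1))"
    using J A by (intro prod_sum_PiE[symmetric]) auto
  also have "\<dots> = (\<Sum>x\<in>A. w x * f x)"
    using J w by (subst prod.remove[of _ a]) auto
  finally show ?thesis .
qed

lemma sum_PiE_marginal2:
  fixes w :: "'s \<Rightarrow> real"
  assumes J: "finite J" "a \<in> J" "b \<in> J" "a \<noteq> b" and A: "finite A" and w: "(\<Sum>x\<in>A. w x) = 1"
  shows "(\<Sum>s\<in>PiE J (\<lambda>_. A). (\<Prod>j\<in>J. w (s j)) * f (s a) (s b)) = (\<Sum>x\<in>A. \<Sum>y\<in>A. w x * w y * f x y)"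
proof -
  \<comment> \<open>For a fixed value of \<open>s a\<close> the summand is a product over the coordinates.\<close>
  have *: "(\<Sum>s\<in>PiE J (\<lambda>_. A). (\<Prod>j\<in>J. w (s j)) * (if s a = x then f x (s b) else 0))
      = (\<Sum>y\<in>A. w x * w y * f x y)" if x: "x \<in> A" for x
  proof -
    let ?g = "\<lambda>j y. if j = a then (if y = x then 1 else 0) else if j = b then f x y else 1"
    have g: "(\<Prod>j\<in>J. ?g j (s j)) = (if s a = x then f x (s b) else 0)" for s
    proof -
      have "(\<Prod>j\<in>J. ?g j (s j)) = ?g a (s a) * (?g b (s b) * (\<Prod>j\<in>J - {a} - {b}. ?g j (s j)))"
        using J by (subst prod.remove[of J a], simp, simp, subst prod.remove[of "J - {a}" b]) auto
      also have "(\<Prod>j\<in>J - {a} - {b}. ?g j (s j)) = 1" by (intro prod.neutral) auto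
      finally show ?thesis using J by simp
    qed
    have "(\<Sum>s\<in>PiE J (\<lambda>_. A). (\<Prod>j\<in>J. w (s j)) * (if s a = x then f x (s b) else 0))
        = (\<Sum>s\<in>PiE J (\<lambda>_. A). \<Prod>j\<in>J. w (s j) * ?g j (s j))"
      unfolding prod.distrib g ..
    also have "\<dots> = (\<Prod>j\<in>J. \<Sum>y\<in>A. w y * ?g j y)"
      using J A by (intro prod_sum_PiE[symmetric]) auto
    also have "\<dots> = (\<Sum>y\<in>A. w y * ?g a y) * ((\<Sum>y\<in>A. w y * ?g b y) * (\<Prod>j\<in>J - {a} - {b}. \<Sum>y\<in>A. w y * ?g j y))"
      using J by (subst prod.remove[of J a], simp, simp, subst prod.remove[of "J - {a}" b]) auto
    also have "(\<Prod>j\<in>J - {a} - {b}. \<Sum>y\<in>A. w y * ?g j y) = 1"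
      using w by (intro prod.neutral) auto
    also have "(\<Sum>y\<in>A. w y * ?g a y) = w x"
      using A x by (simp add: if_distrib[of "\<lambda>t. _ * t"] sum.delta cong: if_cong)
    also have "(\<Sum>y\<in>A. w y * ?g b y) = (\<Sum>y\<in>A. w y * f x y)" using J(4) by simp
    finally show ?thesis by (simp add: sum_distrib_left mult.assoc)
  qed
  have "(\<Sum>s\<in>PiE J (\<lambda>_. A). (\<Prod>j\<in>J. w (s j)) * f (s a) (s b))
      = (\<Sum>s\<in>PiE J (\<lambda>_. A). \<Sum>x\<in>A. (\<Prod>j\<in>J. w (s j)) * (if s a = x then f x (s b) else 0))"
  proof (rule sum.cong[OF refl])
    fix s assume "s \<in> PiE J (\<lambda>_. A)"
    then have "s a \<in> A" using J(2) by (rule PiE_mem)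
    then show "(\<Prod>j\<in>J. w (s j)) * f (s a) (s b)
        = (\<Sum>x\<in>A. (\<Prod>j\<in>J. w (s j)) * (if s a = x then f x (s b) else 0))"
      using A by (simp add: sum_distrib_left[symmetric] sum.delta)
  qed
  also have "\<dots> = (\<Sum>x\<in>A. \<Sum>y\<in>A. w x * w y * f x y)"
    by (subst sum.swap) (simp add: *)
  finally show ?thesis .
qed

text \<open>All replicas but the two named ones sum out; these may sit in one quadruple or in two.\<close>

lemma replica_pair_marginal:
  fixes w :: "'s \<Rightarrow> real"
  assumes C: "finite C" and w: "(\<Sum>x\<in>C. w x) = 1"
    and a: "a < n" "a' < n" "u < 4" "u' < 4" "(a, u) \<noteq> (a', u')"
  shows "(\<Sum>s\<in>PiE {..<n::nat} (\<lambda>_. PiE {..<4::nat} (\<lambda>_. C)). (\<Prod>j<n. \<Prod>v<4. w (s j v)) * f (s a u) (s a' u'))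
    = (\<Sum>x\<in>C. \<Sum>y\<in>C. w x * w y * f x y)"
proof -
  let ?Q = "PiE {..<4::nat} (\<lambda>_. C)"
  define W where "W = (\<lambda>x::nat \<Rightarrow> 's. \<Prod>v<4. w (x v))"
  have Q: "finite ?Q" using C by (intro finite_PiE) auto
  have W: "(\<Sum>x\<in>?Q. W x) = 1"
    unfolding W_def using prod_sum_PiE[of "{..<4::nat}" "\<lambda>_. C" "\<lambda>_. w"] C w by simp
  show ?thesis
  proof (cases "a = a'")
    case True
    then have u: "u \<noteq> u'" using a by auto
    have "(\<Sum>s\<in>PiE {..<n} (\<lambda>_. ?Q). (\<Prod>j<n. W (s j)) * f (s a u) (s a' u'))
        = (\<Sum>x\<in>?Q. W x * f (x u) (x u'))"
      unfolding True[symmetric]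
      using a by (intro sum_PiE_marginal[of _ a ?Q W "\<lambda>x. f (x u) (x u')"] Q W) auto
    also have "\<dots> = (\<Sum>x\<in>C. \<Sum>y\<in>C. w x * w y * f x y)"
      unfolding W_def using a u by (intro sum_PiE_marginal2 C w) auto
    finally show ?thesis by (simp add: W_def)
  next
    case False
    have "(\<Sum>s\<in>PiE {..<n} (\<lambda>_. ?Q). (\<Prod>j<n. W (s j)) * f (s a u) (s a' u'))
        = (\<Sum>x\<in>?Q. \<Sum>y\<in>?Q. W x * W y * f (x u) (y u'))"
      using a False by (intro sum_PiE_marginal2[of _ a a' ?Q W "\<lambda>x y. f (x u) (y u')"] Q W) auto
    also have "\<dots> = (\<Sum>x\<in>?Q. W x * (\<Sum>y\<in>?Q. W y * f (x u) (y u')))"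
      by (simp add: sum_distrib_left mult.assoc)
    also have "\<dots> = (\<Sum>x\<in>?Q. W x * (\<Sum>y\<in>C. w y * f (x u) y))"
    proof (intro sum.cong refl arg_cong2[where f = "(*)"])
      fix x
      show "(\<Sum>y\<in>?Q. W y * f (x u) (y u')) = (\<Sum>y\<in>C. w y * f (x u) y)"
        unfolding W_def using a by (intro sum_PiE_marginal[of _ u' C w "f (x u)"] C w) auto
    qed
    also have "\<dots> = (\<Sum>x\<in>C. w x * (\<Sum>y\<in>C. w y * f x y))"
      unfolding W_def using a by (intro sum_PiE_marginal[of _ u C w "\<lambda>x. \<Sum>y\<in>C. w y * f x y"] C w) auto
    finally show ?thesis by (simp add: W_def sum_distrib_left mult.assoc)
  qed
qed

lemma sum_PiE_lessThan_Suc: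
  fixes F :: "(nat \<Rightarrow> 's) \<Rightarrow> real"
  assumes "finite C"
  shows "(\<Sum>x\<in>PiE {..<Suc n} (\<lambda>_. C). F x) = (\<Sum>y\<in>C. \<Sum>x\<in>PiE {..<n} (\<lambda>_. C). F (x(n := y)))"
proof -
  have "inj_on (\<lambda>(y, g). g(n := y)) (C \<times> PiE {..<n} (\<lambda>_. C))"
  proof (rule inj_onI, clarify)
    fix y g y' g' assume g: "g \<in> PiE {..<n} (\<lambda>_. C)" "g' \<in> PiE {..<n} (\<lambda>_. C)"
      and eq: "g(n := y) = g'(n := y')"
    have "g x = g' x" for x
      using fun_cong[OF eq, of x] PiE_arb[OF g(1), of n] PiE_arb[OF g(2), of n] by (cases "x = n") auto
    then show "y = y' \<and> g = g'" using fun_cong[OF eq, of n] by auto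
  qed
  then show ?thesis
    unfolding lessThan_Suc PiE_insert_eq
    by (simp add: sum.reindex sum.cartesian_product case_prod_unfold)
qed

text \<open>One quadruple of replicas: two for the squared difference and two with the opposite tilt.\<close>

lemma quadruple_sum:
  fixes w l :: "'s \<Rightarrow> real"
  assumes "finite C"
  shows "(\<Sum>x\<in>PiE {..<4::nat} (\<lambda>_. C). (\<Prod>u<4. w (x u)) *
      (((l (x 0) - l (x 1))\<^sup>2 / 2 - \<kappa>) * exp (t * (l (x 0) + l (x 1) - l (x 2) - l (x 3)))))
    = (\<Sum>x\<in>C. \<Sum>y\<in>C. w x * w y * (((l x - l y)\<^sup>2 / 2 - \<kappa>) * exp (t * (l x + l y))))
      * (\<Sum>x\<in>C. w x * exp (- t * l x))\<^sup>2"
proof -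
  have four: "{..<4::nat} = {..<Suc (Suc (Suc (Suc 0)))}"
    by (simp add: numeral_eq_Suc)
  have "(\<Sum>x\<in>PiE {..<4::nat} (\<lambda>_. C). (\<Prod>u<4. w (x u)) *
      (((l (x 0) - l (x 1))\<^sup>2 / 2 - \<kappa>) * exp (t * (l (x 0) + l (x 1) - l (x 2) - l (x 3)))))
    = (\<Sum>d\<in>C. \<Sum>c\<in>C. \<Sum>b\<in>C. \<Sum>a\<in>C. w a * w b * w c * w d *
        (((l a - l b)\<^sup>2 / 2 - \<kappa>) * exp (t * (l a + l b - l c - l d))))"
    unfolding four sum_PiE_lessThan_Suc[OF assms]
    by (simp add: lessThan_Suc numeral_eq_Suc mult_ac)
  also have "\<dots> = (\<Sum>d\<in>C. \<Sum>c\<in>C. (w c * exp (- t * l c)) * ((w d * exp (- t * l d)) *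
      (\<Sum>b\<in>C. \<Sum>a\<in>C. w a * w b * (((l a - l b)\<^sup>2 / 2 - \<kappa>) * exp (t * (l a + l b))))))"
  proof (intro sum.cong refl)
    fix c d
    have "exp (t * (l a + l b - l c - l d)) = exp (t * (l a + l b)) * (exp (- t * l c) * exp (- t * l d))" for a b
      by (simp add: exp_add[symmetric] algebra_simps)
    then show "(\<Sum>b\<in>C. \<Sum>a\<in>C. w a * w b * w c * w d *
        (((l a - l b)\<^sup>2 / 2 - \<kappa>) * exp (t * (l a + l b - l c - l d)))) =
      (w c * exp (- t * l c)) * ((w d * exp (- t * l d)) *
      (\<Sum>b\<in>C. \<Sum>a\<in>C. w a * w b * (((l a - l b)\<^sup>2 / 2 - \<kappa>) * exp (t * (l a + l b)))))"
      unfolding sum_distrib_left by (intro sum.cong refl) (simp only: mult_ac)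
  qed
  also have "\<dots> = (\<Sum>b\<in>C. \<Sum>a\<in>C. w a * w b * (((l a - l b)\<^sup>2 / 2 - \<kappa>) * exp (t * (l a + l b))))
      * (\<Sum>x\<in>C. w x * exp (- t * l x))\<^sup>2"
    by (simp only: sum_distrib_left[symmetric] sum_distrib_right[symmetric] power2_eq_square) (simp only: mult_ac)
  also have "(\<Sum>b\<in>C. \<Sum>a\<in>C. w a * w b * (((l a - l b)\<^sup>2 / 2 - \<kappa>) * exp (t * (l a + l b))))
      = (\<Sum>x\<in>C. \<Sum>y\<in>C. w x * w y * (((l x - l y)\<^sup>2 / 2 - \<kappa>) * exp (t * (l x + l y))))"
    by (rule sum.swap)
  finally show ?thesis .
qed

text \<open>The variance under the tilted measure is half the mean squared difference of two replicas, divided by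
  the square of the tilted partition sum. This quotient cannot be averaged exactly, but
  \<open>\<langle>exp (t l)\<rangle> \<langle>exp (- t l)\<rangle> \<ge> 1\<close>, so dividing is bounded by multiplying with two further replicas of opposite
  tilt. The even power makes this legitimate although the deviation has no sign.\<close>

lemma tilted_variance_power_le:
  fixes A l :: "'s \<Rightarrow> real" and t \<kappa> :: real
  assumes C: "finite C" "C \<noteq> {}"
  defines "w \<equiv> \<lambda>x. exp (A x) / (\<Sum>y\<in>C. exp (A y))"
  defines "G \<equiv> gibbs C (\<lambda>x. A x + t * l x)"
  shows "(G (\<lambda>x. (l x)\<^sup>2) - (G l)\<^sup>2 - \<kappa>) ^ (2 * k)
    \<le> (\<Sum>x\<in>PiE {..<4::nat} (\<lambda>_. C). (\<Prod>u<4. w (x u)) *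
      (((l (x 0) - l (x 1))\<^sup>2 / 2 - \<kappa>) * exp (t * (l (x 0) + l (x 1) - l (x 2) - l (x 3))))) ^ (2 * k)"
proof -
  have w0: "\<And>x. 0 \<le> w x" "(\<Sum>x\<in>C. w x) = 1" unfolding w_def by (rule softmax_prob[OF C])+
  define Z where "Z = (\<Sum>x\<in>C. w x * exp (t * l x))"
  define S where "S = (\<Sum>x\<in>C. w x * exp (- t * l x))"
  define X where "X = (\<Sum>x\<in>C. \<Sum>y\<in>C. w x * w y * (((l x - l y)\<^sup>2 / 2 - \<kappa>) * exp (t * (l x + l y))))"
  have P: "(\<Sum>y\<in>C. exp (A y)) > 0" by (rule partition_sum_pos[OF C])
  have Z: "Z > 0" unfolding Z_def w_def using C P by (intro sum_pos) auto
  have S: "S > 0" unfolding S_def w_def using C P by (intro sum_pos) auto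
  have G: "G f = (\<Sum>x\<in>C. w x * (f x * exp (t * l x))) / Z" for f
  proof -
    have num: "(\<Sum>x\<in>C. w x * (f x * exp (t * l x))) = (\<Sum>x\<in>C. f x * exp (A x + t * l x)) / (\<Sum>y\<in>C. exp (A y))"
      unfolding w_def sum_divide_distrib by (intro sum.cong refl) (simp add: exp_add)
    have den: "Z = (\<Sum>x\<in>C. exp (A x + t * l x)) / (\<Sum>y\<in>C. exp (A y))"
      unfolding Z_def w_def sum_divide_distrib by (intro sum.cong refl) (simp add: exp_add)
    show ?thesis unfolding num den G_def gibbs_def using P by simp
  qed
  define b where "b = (\<lambda>x. w x * exp (t * l x))"
  have X: "X = (G (\<lambda>x. (l x)\<^sup>2) - (G l)\<^sup>2 - \<kappa>) * Z\<^sup>2"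
  proof -
    have "X = (\<Sum>x\<in>C. \<Sum>y\<in>C. (b x * (l x)\<^sup>2 / 2) * b y + b x * (b y * (l y)\<^sup>2 / 2)
        - (b x * l x) * (b y * l y) - \<kappa> * b x * b y)"
      unfolding X_def b_def
      by (intro sum.cong refl) (simp add: distrib_left exp_add power2_eq_square field_simps)
    also have "\<dots> = (\<Sum>x\<in>C. b x * (l x)\<^sup>2 / 2) * Z + Z * (\<Sum>x\<in>C. b x * (l x)\<^sup>2 / 2)
        - (\<Sum>x\<in>C. b x * l x) * (\<Sum>x\<in>C. b x * l x) - \<kappa> * Z * Z"
      unfolding Z_def b_def[symmetric] sum_product sum.distrib sum_subtractf
      by (simp add: sum_product sum_distrib_left mult_ac)
    also have "\<dots> = (\<Sum>x\<in>C. b x * (l x)\<^sup>2) * Z - (\<Sum>x\<in>C. b x * l x)\<^sup>2 - \<kappa> * Z\<^sup>2"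
      by (simp add: sum_divide_distrib[symmetric] power2_eq_square)
    also have "(\<Sum>x\<in>C. b x * (l x)\<^sup>2) = G (\<lambda>x. (l x)\<^sup>2) * Z"
      unfolding G b_def using Z by (simp add: mult_ac)
    also have "(\<Sum>x\<in>C. b x * l x) = G l * Z"
      unfolding G b_def using Z by (simp add: mult_ac)
    finally show ?thesis by (simp add: power2_eq_square algebra_simps)
  qed
  have ZS: "1 \<le> Z * S"
  proof -
    have "(\<Sum>x\<in>C. w x * exp (t * l x)) * (\<Sum>x\<in>C. w x * (- exp (- t * l x)))
        \<le> (\<Sum>x\<in>C. w x * (exp (t * l x) * (- exp (- t * l x))))"
    proof (rule chebyshev_weighted[OF w0(1) w0(2)])
      fix x y
      show "0 \<le> (- exp (- t * l x) - - exp (- t * l y)) * (exp (t * l x) - exp (t * l y))"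
        using exp_monotone_product[of 1 "t * l x" "t * l y"]
        by (cases "t * l x \<le> t * l y") (auto intro!: mult_nonneg_nonneg mult_nonpos_nonpos)
    qed
    also have "\<dots> = - 1" using w0(2) by (simp add: exp_minus sum_negf)
    finally show ?thesis by (simp add: Z_def S_def sum_negf)
  qed
  have "\<bar>G (\<lambda>x. (l x)\<^sup>2) - (G l)\<^sup>2 - \<kappa>\<bar> * 1 \<le> \<bar>G (\<lambda>x. (l x)\<^sup>2) - (G l)\<^sup>2 - \<kappa>\<bar> * (Z * S)\<^sup>2"
    using ZS by (intro mult_left_mono) (auto simp: one_le_power)
  also have "\<dots> = \<bar>X * S\<^sup>2\<bar>" unfolding X by (simp add: abs_mult power_mult_distrib)
  finally have "\<bar>G (\<lambda>x. (l x)\<^sup>2) - (G l)\<^sup>2 - \<kappa>\<bar> ^ (2 * k) \<le> \<bar>X * S\<^sup>2\<bar> ^ (2 * k)"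
    by (intro power_mono) auto
  then show ?thesis
    unfolding quadruple_sum[OF C(1)] X_def S_def by (simp add: power_even_abs)
qed

section \<open>The mean field equation for one spin\<close>

definition uniform_sym :: "real measure" where
  "uniform_sym = density lborel (\<lambda>t. ennreal (indicator {-1..1} t / 2))"

lemma sets_uniform_sym [simp, measurable_cong]: "sets uniform_sym = sets borel"
  by (simp add: uniform_sym_def)

lemma prob_space_uniform_sym: "prob_space uniform_sym"
proof (rule prob_spaceI)
  have "emeasure uniform_sym (space uniform_sym) = (\<integral>\<^sup>+ t. ennreal (1 / 2) * indicator {-1..1::real} t \<partial>lborel)"
    unfolding uniform_sym_def
    by (subst emeasure_density) (auto intro!: nn_integral_cong split: split_indicator)
  also have "\<dots> = ennreal (1 / 2) * ennreal 2" by (subst nn_integral_cmult_indicator) auto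
  also have "\<dots> = ennreal (1 / 2 * 2)" by (rule ennreal_mult[symmetric]) auto
  also have "\<dots> = 1" by simp
  finally show "emeasure uniform_sym (space uniform_sym) = 1" .
qed

lemma AE_uniform_sym: "AE t in uniform_sym. \<bar>t\<bar> \<le> 1"
  unfolding uniform_sym_def by (subst AE_density) (auto split: split_indicator simp: abs_le_iff)

lemma integral_uniform_sym:
  fixes f :: "real \<Rightarrow> real"
  assumes "f \<in> borel_measurable borel"
  shows "(LINT t|uniform_sym. f t) = (LINT t|lborel. indicator {-1..1} t *\<^sub>R f t) / 2"
  unfolding uniform_sym_def using assms by (subst integral_real_density) auto

lemma tanh_lipschitz: "\<bar>tanh x - tanh y\<bar> \<le> \<bar>x - y\<bar>" for x y :: real
proof -
  have "norm (tanh x - tanh y) \<le> 1 * norm (x - y)"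
  proof (rule field_differentiable_bound[where S = UNIV])
    show "(tanh has_field_derivative 1 - (tanh z)\<^sup>2) (at z within UNIV)" for z :: real
      by (auto intro!: derivative_eq_intros)
    show "norm (1 - (tanh z)\<^sup>2) \<le> 1" for z :: real
      using tanh_sq_le_1[of z] by (simp add: abs_le_iff)
  qed auto
  then show ?thesis by simp
qed

text \<open>With \<open>\<Lambda> t\<close> the logarithm of the tilted partition sum, the magnetisation is
  \<open>tanh (h + (\<Lambda> 1 - \<Lambda> (-1)) / 2)\<close>, and the mean local field is a mixture of \<open>\<Lambda>' 1\<close> and \<open>\<Lambda>' (-1)\<close>. If \<open>\<Lambda>''\<close> were
  the constant \<open>\<kappa>\<close>, the mean field equation would be exact; in general the two arguments of \<open>tanh\<close> differ by
  an integral of \<open>\<Lambda>'' - \<kappa>\<close> against a weight bounded by \<open>1\<close>, and \<open>\<Lambda>''\<close> is the variance of \<open>l\<close> under the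
  tilted measure.\<close>

lemma mean_field_error:
  fixes A l :: "'s \<Rightarrow> real" and h \<kappa> :: real
  assumes C: "finite C" "C \<noteq> {}"
  defines "G \<equiv> \<lambda>t. gibbs C (\<lambda>x. A x + t * l x)"
  defines "Z \<equiv> \<lambda>t. \<Sum>x\<in>C. exp (A x + t * l x)"
  defines "p \<equiv> exp h * Z 1 + exp (- h) * Z (-1)"
  defines "m \<equiv> (exp h * Z 1 - exp (- h) * Z (-1)) / p"
  defines "B \<equiv> (exp h * Z 1 * G 1 l + exp (- h) * Z (-1) * G (-1) l) / p"
  shows "(m - tanh (B + h - \<kappa> * m)) ^ (2 * k)
    \<le> 4 ^ k * (LINT t|uniform_sym. (G t (\<lambda>x. (l x)\<^sup>2) - (G t l)\<^sup>2 - \<kappa>) ^ (2 * k))"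
proof -
  interpret U: prob_space uniform_sym by (rule prob_space_uniform_sym)
  define Y where "Y = (\<lambda>t. G t (\<lambda>x. (l x)\<^sup>2) - (G t l)\<^sup>2 - \<kappa>)"
  have Z: "Z t > 0" for t unfolding Z_def by (rule partition_sum_pos[OF C])
  have p: "p > 0" unfolding p_def using Z by (intro add_pos_pos mult_pos_pos) auto
  have G_deriv: "((\<lambda>t. G t l) has_real_derivative Y t + \<kappa>) (at t)" for t
  proof -
    have "((\<lambda>t. G t l) has_real_derivative
        G t (\<lambda>_. 0) + G t (\<lambda>x. l x * l x) - G t l * G t l) (at t)"
      unfolding G_def by (rule gibbs_deriv[OF C]) (auto intro!: derivative_eq_intros)
    then show ?thesis
      by (rule DERIV_cong) (simp add: Y_def power2_eq_square G_def gibbs_def)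
  qed
  have Z_deriv: "((\<lambda>t. ln (Z t)) has_real_derivative G t l) (at t)" for t
  proof -
    have "(Z has_real_derivative (\<Sum>x\<in>C. l x * exp (A x + t * l x))) (at t)"
      unfolding Z_def by (rule DERIV_sum) (auto intro!: derivative_eq_intros)
    from DERIV_ln_divide[THEN DERIV_chain2, OF Z this]
    show ?thesis by (rule DERIV_cong) (simp add: G_def gibbs_def Z_def)
  qed
  define LZ where "LZ = (\<lambda>t. ln (Z t))"
  have LZ_deriv: "(LZ has_real_derivative G t l) (at t)" for t
    unfolding LZ_def by (rule Z_deriv)
  have Y_cont: "isCont Y t" for t
    unfolding Y_def G_def by (intro continuous_intros gibbs_isCont[OF C])
  then have [measurable]: "Y \<in> borel_measurable borel"
    by (intro borel_measurable_continuous_onI continuous_at_imp_continuous_on ballI)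
  obtain KY where KY: "\<And>t. \<bar>Y t\<bar> \<le> KY"
  proof -
    define Kl where "Kl = (\<Sum>x\<in>C. \<bar>l x\<bar>)"
    have l: "\<bar>l x\<bar> \<le> Kl" if "x \<in> C" for x
      unfolding Kl_def using that C by (intro member_le_sum) auto
    have "\<bar>G t l\<bar> \<le> Kl" for t unfolding G_def by (rule gibbs_abs_le[OF C l])
    then have g1: "(G t l)\<^sup>2 \<le> Kl\<^sup>2" for t by (metis abs_ge_zero power2_abs power_mono)
    have g2: "\<bar>G t (\<lambda>x. (l x)\<^sup>2)\<bar> \<le> Kl\<^sup>2" for t
      unfolding G_def using l
      by (intro gibbs_abs_le[OF C]) (metis abs_ge_zero abs_power2 power2_abs power_mono)
    have "\<bar>Y t\<bar> \<le> Kl\<^sup>2 + Kl\<^sup>2 + \<bar>\<kappa>\<bar>" for t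
      using g1[of t] g2[of t] zero_le_power2[of "G t l"] unfolding Y_def by linarith
    then show ?thesis by (rule that)
  qed
  have m1: "\<bar>m\<bar> \<le> 1"
  proof -
    have "\<bar>exp h * Z 1 - exp (- h) * Z (-1)\<bar> \<le> p"
      unfolding p_def using Z[of 1] Z[of "-1"] by (simp add: abs_le_iff)
    then show ?thesis unfolding m_def using p by simp
  qed
  define a where "a = h + (ln (Z 1) - ln (Z (-1))) / 2"
  have m_tanh: "m = tanh a"
  proof -
    have "exp (- 2 * a) = exp (- h) * exp (- h) * (Z (-1) / Z 1)"
    proof -
      have "- 2 * a = - h + - h + (ln (Z (-1)) - ln (Z 1))" by (simp add: a_def field_simps)
      then show ?thesis by (simp only: exp_add exp_diff exp_ln[OF Z])
    qed
    then have e: "exp h * Z 1 * exp (- 2 * a) = exp (- h) * Z (-1)"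
      using Z[of 1] by (simp add: exp_minus field_simps)
    have "tanh a = (exp h * Z 1 * (1 - exp (- 2 * a))) / (exp h * Z 1 * (1 + exp (- 2 * a)))"
      unfolding tanh_real_altdef using Z[of 1] by (subst mult_divide_mult_cancel_left) auto
    then have "tanh a = (exp h * Z 1 - exp (- h) * Z (-1)) / (exp h * Z 1 + exp (- h) * Z (-1))"
      by (simp only: right_diff_distrib distrib_left mult_1_right e)
    then show ?thesis by (simp add: m_def p_def)
  qed
  have B: "B = (1 + m) / 2 * G 1 l + (1 - m) / 2 * G (-1) l"
  proof -
    have "(1 + m) / 2 = exp h * Z 1 / p" "(1 - m) / 2 = exp (- h) * Z (-1) / p"
      using p by (simp_all add: m_def field_simps p_def)
    then show ?thesis by (simp add: B_def add_divide_distrib)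
  qed
  \<comment> \<open>A primitive of \<open>- (t + m) / 2\<close> times \<open>\<Lambda>'' - \<kappa>\<close>. Its increment over \<open>[-1, 1]\<close> is the difference of the
    two arguments of \<open>tanh\<close>.\<close>
  define F where "F = (\<lambda>t. - (t * G t l - LZ t) / 2 + \<kappa> * t\<^sup>2 / 4 - m * (G t l - \<kappa> * t) / 2)"
  have F_deriv: "(F has_real_derivative - (t + m) / 2 * Y t) (at t)" for t
    unfolding F_def
    by (auto intro!: derivative_eq_intros G_deriv LZ_deriv simp: field_simps)
  have arg: "a - (B + h - \<kappa> * m) = F 1 - F (-1)"
    unfolding a_def B F_def LZ_def by (simp add: field_simps)
  have "(LINT t|lborel. indicator {-1..1} t *\<^sub>R (- (t + m) / 2 * Y t)) = F 1 - F (-1)"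
  proof (rule integral_FTC_atLeastAtMost)
    show "(F has_vector_derivative - (x + m) / 2 * Y x) (at x within {-1..1})" for x
      using F_deriv[of x] has_field_derivative_at_within
      by (simp add: has_real_derivative_iff_has_vector_derivative[symmetric])
    show "continuous_on {- 1..1} (\<lambda>x. - (x + m) / 2 * Y x)"
      by (intro continuous_at_imp_continuous_on ballI continuous_intros Y_cont) auto
  qed simp
  moreover have "(LINT t|uniform_sym. - (t + m) * Y t)
      = (LINT t|lborel. indicator {-1..1} t *\<^sub>R (- (t + m) / 2 * Y t))"
  proof -
    have "(LINT t|uniform_sym. - (t + m) * Y t)
        = (LINT t|lborel. indicator {-1..1} t *\<^sub>R (- (t + m) * Y t)) / 2"
      by (rule integral_uniform_sym) simp
    also have "\<dots> = (LINT t|lborel. indicator {-1..1} t *\<^sub>R (- (t + m) * Y t) / 2)"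
      by (rule Bochner_Integration.integral_divide_zero[symmetric])
    also have "\<dots> = (LINT t|lborel. indicator {-1..1} t *\<^sub>R (- (t + m) / 2 * Y t))"
      by (intro Bochner_Integration.integral_cong refl) simp
    finally show ?thesis .
  qed
  ultimately have diff: "F 1 - F (-1) = (LINT t|uniform_sym. - (t + m) * Y t)" by simp
  have wb: "AE t in uniform_sym. \<bar>- (t + m) * Y t\<bar> \<le> 2 * \<bar>Y t\<bar>"
    using AE_uniform_sym
  proof eventually_elim
    case (elim t)
    then have "\<bar>t + m\<bar> \<le> 2" using m1 by linarith
    then show ?case unfolding abs_mult abs_minus_cancel by (intro mult_right_mono) auto
  qed
  have "AE t in uniform_sym. norm (- (t + m) * Y t) \<le> 2 * KY"
    using wb
  proof eventually_elim
    case (elim t)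
    then show ?case using KY[of t] unfolding real_norm_def by linarith
  qed
  then have i1: "integrable uniform_sym (\<lambda>t. - (t + m) * Y t)"
    by (rule U.integrable_const_bound) simp
  have i2: "integrable uniform_sym (\<lambda>t. Y t ^ (2 * k))"
    by (rule U.integrable_const_bound[of _ "KY ^ (2 * k)"])
       (use power_mono[OF KY abs_ge_zero] in \<open>simp_all add: power_abs del: power_even_abs\<close>)
  have wb2: "AE t in uniform_sym. (- (t + m) * Y t) ^ (2 * k) \<le> 4 ^ k * Y t ^ (2 * k)"
    using wb
  proof eventually_elim
    case (elim t)
    then have "\<bar>- (t + m) * Y t\<bar> ^ (2 * k) \<le> (2 * \<bar>Y t\<bar>) ^ (2 * k)" by (intro power_mono) auto
    then show ?case by (simp add: power_even_abs power_mult_distrib power_mult)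
  qed
  have i3: "integrable uniform_sym (\<lambda>t. (- (t + m) * Y t) ^ (2 * k))"
  proof (rule Bochner_Integration.integrable_bound)
    show "integrable uniform_sym (\<lambda>t. 4 ^ k * Y t ^ (2 * k))" using i2 by simp
    show "AE t in uniform_sym. norm ((- (t + m) * Y t) ^ (2 * k)) \<le> norm (4 ^ k * Y t ^ (2 * k))"
      using wb2
    proof eventually_elim
      case (elim t)
      have "0 \<le> (- (t + m) * Y t) ^ (2 * k)" by (rule zero_le_even_power) simp
      then show ?case using elim unfolding real_norm_def by linarith
    qed
  qed simp
  have "(m - tanh (B + h - \<kappa> * m)) ^ (2 * k) \<le> (F 1 - F (-1)) ^ (2 * k)"
  proof -
    have "\<bar>m - tanh (B + h - \<kappa> * m)\<bar> \<le> \<bar>F 1 - F (-1)\<bar>"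
      using tanh_lipschitz[of a "B + h - \<kappa> * m"] unfolding arg m_tanh[symmetric] .
    then have "\<bar>m - tanh (B + h - \<kappa> * m)\<bar> ^ (2 * k) \<le> \<bar>F 1 - F (-1)\<bar> ^ (2 * k)"
      by (intro power_mono) auto
    then show ?thesis by (simp add: power_even_abs)
  qed
  also have "\<dots> \<le> (LINT t|uniform_sym. (- (t + m) * Y t) ^ (2 * k))"
    unfolding diff
    by (rule U.jensens_inequality[OF i1, where I = UNIV]) (use i3 in \<open>auto intro: convex_power_even\<close>)
  also have "\<dots> \<le> (LINT t|uniform_sym. 4 ^ k * Y t ^ (2 * k))"
    using i2 i3 wb2 by (intro integral_mono_AE) auto
  finally show ?thesis by (simp add: Y_def)
qed

section \<open>The cavity at one site\<close>

definition cavity_edges :: "nat \<Rightarrow> nat \<Rightarrow> (nat \<times> nat) set" where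
  "cavity_edges i N = (\<lambda>j. (min i j, max i j)) ` ({1..N} - {i})"

text \<open>An edge at \<open>i\<close> is an ordered pair, so \<open>i\<close> can be either component; this is the other one.\<close>

definition far_end :: "nat \<Rightarrow> nat \<times> nat \<Rightarrow> nat" where
  "far_end i p = fst p + snd p - i"

text \<open>The field that the other sites exert on the site \<open>i\<close>, written as a linear form in the couplings of \<open>i\<close>.\<close>

definition cavity_field :: "real \<Rightarrow> nat \<Rightarrow> nat \<Rightarrow> (nat \<times> nat \<Rightarrow> real) \<Rightarrow> (nat \<Rightarrow> real) \<Rightarrow> real" where
  "cavity_field b i N g \<sigma> = (\<Sum>p\<in>cavity_edges i N. b * \<sigma> (far_end i p) * g p)"

text \<open>The system without the site \<open>i\<close>, tilted by its field on \<open>i\<close>. The tilts \<open>t = 1\<close> and \<open>t = -1\<close> give the Gibbs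
  measure of the whole system conditioned on the spin at \<open>i\<close>.\<close>

definition cavity_gibbs where
  "cavity_gibbs b h i N g t = gibbs (configs ({1..N} - {i}))
     (\<lambda>\<sigma>. sk_energy b h ({1..N} - {i}) g \<sigma> + t * cavity_field b i N g \<sigma>)"

text \<open>This is \<open>\<Lambda>'' t - \<kappa>\<close> for the logarithm \<open>\<Lambda>\<close> of the tilted partition sum of
  the cavity system.\<close>

definition cavity_deviation where
  "cavity_deviation \<kappa> b h i N g t = cavity_gibbs b h i N g t (\<lambda>\<sigma>. (cavity_field b i N g \<sigma>)\<^sup>2)
     - (cavity_gibbs b h i N g t (cavity_field b i N g))\<^sup>2 - \<kappa>"

lemma finite_cavity_edges [simp]: "finite (cavity_edges i N)"
  by (simp add: cavity_edges_def)

lemma sum_cavity_edges: "(\<Sum>p\<in>cavity_edges i N. f p) = (\<Sum>j\<in>{1..N} - {i}. f (min i j, max i j))"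
proof -
  have "inj_on (\<lambda>j. (min i j, max i j)) ({1..N} - {i})"
    by (auto simp: inj_on_def min_def max_def split: if_splits)
  then show ?thesis unfolding cavity_edges_def by (simp add: sum.reindex)
qed

lemma far_end_edge [simp]: "far_end i (min i j, max i j) = j"
  by (simp add: far_end_def min_def max_def)

lemma far_end_mem: "p \<in> cavity_edges i N \<Longrightarrow> far_end i p \<in> {1..N} - {i}"
  unfolding cavity_edges_def by auto

lemma card_cavity_edges: "card (cavity_edges i N) \<le> N"
proof -
  have "card (cavity_edges i N) \<le> card ({1..N} - {i})" unfolding cavity_edges_def by (rule card_image_le) simp
  also have "\<dots> \<le> card {1..N}" by (rule card_mono) auto
  finally show ?thesis by simp
qed

lemma spin_pairs_cavity:
  assumes "i \<in> {1..N}"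
  shows "spin_pairs N = pairs ({1..N} - {i}) \<union> cavity_edges i N"
    and "pairs ({1..N} - {i}) \<inter> cavity_edges i N = {}"
proof -
  show "pairs ({1..N} - {i}) \<inter> cavity_edges i N = {}"
    by (auto simp: pairs_def cavity_edges_def min_def max_def split: if_splits)
  show "spin_pairs N = pairs ({1..N} - {i}) \<union> cavity_edges i N"
  proof (rule set_eqI)
    fix p :: "nat \<times> nat"
    obtain x y where p: "p = (x, y)" by (cases p)
    have "p \<in> cavity_edges i N \<longleftrightarrow> (x = i \<and> y \<in> {1..N} \<and> i < y) \<or> (y = i \<and> x \<in> {1..N} \<and> x < i)"
    proof
      assume "p \<in> cavity_edges i N"
      then show "(x = i \<and> y \<in> {1..N} \<and> i < y) \<or> (y = i \<and> x \<in> {1..N} \<and> x < i)"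
        unfolding p cavity_edges_def by (auto simp: min_def max_def split: if_splits)
    next
      assume "(x = i \<and> y \<in> {1..N} \<and> i < y) \<or> (y = i \<and> x \<in> {1..N} \<and> x < i)"
      then show "p \<in> cavity_edges i N"
      proof
        assume "x = i \<and> y \<in> {1..N} \<and> i < y"
        then show ?thesis unfolding p cavity_edges_def by (intro image_eqI[of _ _ y]) auto
      next
        assume "y = i \<and> x \<in> {1..N} \<and> x < i"
        then show ?thesis unfolding p cavity_edges_def by (intro image_eqI[of _ _ x]) auto
      qed
    qed
    then show "p \<in> spin_pairs N \<longleftrightarrow> p \<in> pairs ({1..N} - {i}) \<union> cavity_edges i N"
      using assms unfolding p by (auto simp: spin_pairs_def pairs_def)
  qed
qed

lemma spin_pairs_eq_pairs: "spin_pairs N = pairs {1..N}"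
  by (auto simp: spin_pairs_def pairs_def)

lemma cavity_field_measurable:
  "cavity_edges i N \<subseteq> J \<Longrightarrow> (\<lambda>g. cavity_field b i N g \<sigma>) \<in> borel_measurable (gaussians J)"
  unfolding cavity_field_def by (rule linear_form_measurable_subset)

text \<open>The Gaussian expectation over the couplings of the site \<open>i\<close>, for a fixed family of replicas whose mutual
  overlaps are within \<open>\<epsilon>\<close> of \<open>q\<close>. The covariance of two cavity fields is \<open>\<beta>\<^sup>2\<close> times the overlap. Differences of
  fields then have variance close to \<open>2 \<beta>\<^sup>2 (1 - q)\<close> and small covariances with one another; their
  covariance with the exponent is small as well, since the signs in the exponent sum to zero in each
  quadruple.\<close>

lemma replica_cavity_expectation:
  fixes s :: "nat \<Rightarrow> nat \<Rightarrow> nat \<Rightarrow> real" and \<beta> q t \<epsilon> :: real and n :: nat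
  assumes i: "i \<in> {1..N}" and \<beta>: "0 < \<beta>" "\<beta> \<le> 1 / 2" and t: "\<bar>t\<bar> \<le> 1"
    and s: "\<And>a u. a < n \<Longrightarrow> u < 4 \<Longrightarrow> s a u \<in> configs ({1..N} - {i})"
    and eps: "\<And>a u a' u'. a < n \<Longrightarrow> u < 4 \<Longrightarrow> a' < n \<Longrightarrow> u' < 4 \<Longrightarrow> (a, u) \<noteq> (a', u') \<Longrightarrow>
      \<bar>overlap N ({1..N} - {i}) (s a u) (s a' u') - q\<bar> \<le> \<epsilon>"
    and eps2: "0 \<le> \<epsilon>" "\<epsilon> \<le> 2"
  defines "l \<equiv> \<lambda>\<omega>. cavity_field (\<beta> / sqrt (real N)) i N \<omega>"
  shows "\<bar>LINT \<omega>|gaussians (cavity_edges i N). (\<Prod>a<n.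
      ((l \<omega> (s a 0) - l \<omega> (s a 1))\<^sup>2 / 2 - \<beta>\<^sup>2 * (1 - q)) *
      exp (t * (l \<omega> (s a 0) + l \<omega> (s a 1) - l \<omega> (s a 2) - l \<omega> (s a 3))))\<bar>
    \<le> 2 ^ n * fact (2 * n) * (3 * real n + 1) ^ (2 * n) * exp (8 * (real n)\<^sup>2) * (\<epsilon> + 1 / real N) ^ n"
proof -
  let ?V = "{1..N} - {i}"
  let ?E = "cavity_edges i N"
  define b where "b = \<beta> / sqrt (real N)"
  define e where "e = (\<lambda>\<sigma> p. b * \<sigma> (far_end i p) :: real)"
  define R where "R = overlap N ?V"
  define d where "d = (\<lambda>a p. e (s a 0) p - e (s a 1) p)"
  define c where "c = (\<lambda>p. \<Sum>a<n. t * (e (s a 0) p + e (s a 1) p - e (s a 2) p - e (s a 3) p))"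
  \<comment> \<open>As \<open>\<epsilon> \<le> 2\<close>, \<open>\<epsilon>\<close> is at most \<open>3/2\<close> times its square root; so the factor \<open>3 n + 1\<close> lets \<open>r\<close> dominate
    the covariance with the exponent, which is at most \<open>2 n \<epsilon>\<close>.\<close>
  define r where "r = (3 * real n + 1) * sqrt (\<epsilon> + 1 / real N)"
  have N: "real N > 0" "N \<ge> 1" using i by auto
  have cardV: "real (card ?V) = real N - 1" using i N by (simp add: of_nat_diff)
  have b2: "b\<^sup>2 = \<beta>\<^sup>2 / real N" using N by (simp add: b_def power_divide)
  have \<beta>2: "\<beta>\<^sup>2 \<le> 1 / 4" using power_mono[of \<beta> "1/2" 2] \<beta> by (simp add: power2_eq_square)
  have cov: "(\<Sum>p\<in>?E. e \<sigma> p * e \<tau> p) = \<beta>\<^sup>2 * R \<sigma> \<tau>" for \<sigma> \<tau>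
  proof -
    have "(\<Sum>p\<in>?E. e \<sigma> p * e \<tau> p) = (\<Sum>j\<in>?V. b\<^sup>2 * (\<sigma> j * \<tau> j))"
      unfolding sum_cavity_edges e_def by (simp add: power2_eq_square mult_ac)
    then show ?thesis
      unfolding sum_distrib_left[symmetric] b2 R_def overlap_def by simp
  qed
  have l: "l \<omega> \<sigma> = (\<Sum>p\<in>?E. e \<sigma> p * \<omega> p)" for \<omega> \<sigma>
    by (simp add: l_def cavity_field_def e_def b_def)
  have ld: "l \<omega> (s a 0) - l \<omega> (s a 1) = (\<Sum>p\<in>?E. d a p * \<omega> p)" for \<omega> a
    by (simp add: l d_def left_diff_distrib sum_subtractf)
  have lc: "(\<Sum>a<n. t * (l \<omega> (s a 0) + l \<omega> (s a 1) - l \<omega> (s a 2) - l \<omega> (s a 3))) = (\<Sum>p\<in>?E. c p * \<omega> p)" for \<omega>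
  proof -
    have "(\<Sum>p\<in>?E. c p * \<omega> p) = (\<Sum>a<n. \<Sum>p\<in>?E. t * (e (s a 0) p + e (s a 1) p - e (s a 2) p - e (s a 3) p) * \<omega> p)"
      unfolding c_def sum_distrib_right by (rule sum.swap)
    also have "\<dots> = (\<Sum>a<n. t * (l \<omega> (s a 0) + l \<omega> (s a 1) - l \<omega> (s a 2) - l \<omega> (s a 3)))"
      unfolding l by (intro sum.cong refl)
        (simp add: sum.distrib[symmetric] sum_subtractf[symmetric] sum_distrib_left algebra_simps)
    finally show ?thesis ..
  qed
  have Rq: "\<bar>R (s a u) (s a' u') - q\<bar> \<le> \<epsilon>" if "a < n" "u < 4" "a' < n" "u' < 4" "(a, u) \<noteq> (a', u')" for a u a' u'
    unfolding R_def using that by (rule eps)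
  have Rint: "q - \<epsilon> \<le> R (s a u) (s a' u') \<and> R (s a u) (s a' u') \<le> q + \<epsilon>"
    if "a < n" "u < 4" "a' < n" "u' < 4" "(a, u) \<noteq> (a', u')" for a u a' u'
    using Rq[OF that] by (simp add: abs_le_iff)
  have bil: "(\<Sum>p\<in>?E. d a p * e \<tau> p) = \<beta>\<^sup>2 * (R (s a 0) \<tau> - R (s a 1) \<tau>)" for a \<tau>
    unfolding d_def by (simp add: left_diff_distrib sum_subtractf cov right_diff_distrib)
  have dd: "(\<Sum>p\<in>?E. d a p * d a' p)
      = \<beta>\<^sup>2 * (R (s a 0) (s a' 0) - R (s a 1) (s a' 0) - (R (s a 0) (s a' 1) - R (s a 1) (s a' 1)))" for a a'
  proof -
    have "(\<Sum>p\<in>?E. d a p * d a' p) = (\<Sum>p\<in>?E. d a p * e (s a' 0) p) - (\<Sum>p\<in>?E. d a p * e (s a' 1) p)"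
      by (subst (2) d_def) (simp add: right_diff_distrib sum_subtractf)
    then show ?thesis unfolding bil by (simp add: right_diff_distrib)
  qed
  have dc: "(\<Sum>p\<in>?E. d a p * c p) = (\<Sum>a'<n. t * (\<beta>\<^sup>2 *
      ((R (s a 0) (s a' 0) - R (s a 1) (s a' 0)) + (R (s a 0) (s a' 1) - R (s a 1) (s a' 1))
       - (R (s a 0) (s a' 2) - R (s a 1) (s a' 2)) - (R (s a 0) (s a' 3) - R (s a 1) (s a' 3)))))" for a
  proof -
    have "(\<Sum>p\<in>?E. d a p * c p) = (\<Sum>a'<n. \<Sum>p\<in>?E. d a p * (t * (e (s a' 0) p + e (s a' 1) p - e (s a' 2) p - e (s a' 3) p)))"
      unfolding c_def sum_distrib_left by (rule sum.swap)
    also have "\<dots> = (\<Sum>a'<n. t * ((\<Sum>p\<in>?E. d a p * e (s a' 0) p) + (\<Sum>p\<in>?E. d a p * e (s a' 1) p)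
        - (\<Sum>p\<in>?E. d a p * e (s a' 2) p) - (\<Sum>p\<in>?E. d a p * e (s a' 3) p)))"
      by (intro sum.cong refl)
        (simp add: sum.distrib[symmetric] sum_subtractf[symmetric] sum_distrib_left algebra_simps)
    finally show ?thesis unfolding bil by (simp add: distrib_left right_diff_distrib)
  qed
  have x0: "0 \<le> \<epsilon> + 1 / real N" using eps2 N by simp
  have r0: "0 \<le> r" unfolding r_def using x0 by simp
  have r2: "\<epsilon> + 1 / real N \<le> r\<^sup>2"
  proof -
    have "1 * (\<epsilon> + 1 / real N) \<le> (3 * real n + 1)\<^sup>2 * (\<epsilon> + 1 / real N)"
      by (rule mult_right_mono[OF _ x0]) (simp add: one_le_power)
    then show ?thesis unfolding r_def power_mult_distrib using x0 by simp
  qed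
  have r2eps: "\<epsilon> \<le> r\<^sup>2" using r2 N by (smt (verit) divide_nonneg_nonneg)
  have reps: "2 * real n * \<epsilon> \<le> r"
  proof -
    have "\<epsilon> = sqrt \<epsilon> * sqrt \<epsilon>" using eps2 by simp
    also have "\<dots> \<le> (3 / 2) * sqrt (\<epsilon> + 1 / real N)"
    proof (intro mult_mono)
      have "sqrt \<epsilon> \<le> sqrt ((3 / 2)\<^sup>2)" using eps2 by (intro real_sqrt_le_mono) (simp add: power2_eq_square)
      then show "sqrt \<epsilon> \<le> 3 / 2" by simp
    qed (use eps2 N in auto)
    finally have "2 * real n * \<epsilon> \<le> 2 * real n * ((3 / 2) * sqrt (\<epsilon> + 1 / real N))"
      by (intro mult_left_mono) auto
    also have "\<dots> \<le> r" unfolding r_def using x0 by (simp add: algebra_simps)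
    finally show ?thesis .
  qed
  have main: "\<bar>LINT \<omega>|gaussians ?E. (\<Prod>a\<in>{..<n}. (\<Sum>p\<in>?E. d a p * \<omega> p)\<^sup>2 / 2 - \<beta>\<^sup>2 * (1 - q)) * exp (\<Sum>p\<in>?E. c p * \<omega> p)\<bar>
    \<le> 2 ^ card {..<n} * fact (2 * card {..<n}) * r ^ (2 * card {..<n}) * exp ((\<Sum>p\<in>?E. (c p)\<^sup>2) / 2)"
  proof (rule centred_squares_bound[OF finite_cavity_edges finite_lessThan r0])
    fix a a' assume a: "a \<in> {..<n}" "a' \<in> {..<n}" "a \<noteq> a'"
    have "\<bar>R (s a 0) (s a' 0) - R (s a 1) (s a' 0) - (R (s a 0) (s a' 1) - R (s a 1) (s a' 1))\<bar> \<le> 4 * \<epsilon>"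
      using Rint[of a 0 a' 0] Rint[of a 1 a' 0] Rint[of a 0 a' 1] Rint[of a 1 a' 1] a
      by (simp add: abs_le_iff)
    then have "\<bar>\<Sum>p\<in>?E. d a p * d a' p\<bar> \<le> (1 / 4) * (4 * \<epsilon>)"
      unfolding dd abs_mult using \<beta>2 by (intro mult_mono) auto
    then show "\<bar>\<Sum>p\<in>?E. d a p * d a' p\<bar> \<le> r\<^sup>2" using r2eps by simp
  next
    fix a assume a: "a \<in> {..<n}"
    have "\<bar>\<Sum>p\<in>?E. d a p * c p\<bar> \<le> (\<Sum>a'<n. 1 * ((1 / 4) * (8 * \<epsilon>)))"
      unfolding dc
    proof (rule order_trans[OF sum_abs sum_mono])
      fix a' assume a': "a' \<in> {..<n}"
      have "\<bar>(R (s a 0) (s a' 0) - R (s a 1) (s a' 0)) + (R (s a 0) (s a' 1) - R (s a 1) (s a' 1))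
       - (R (s a 0) (s a' 2) - R (s a 1) (s a' 2)) - (R (s a 0) (s a' 3) - R (s a 1) (s a' 3))\<bar> \<le> 8 * \<epsilon>"
      proof (cases "a' = a")
        case True
        \<comment> \<open>Within one quadruple the self overlaps cancel, and so does the overlap of the first two replicas.\<close>
        have "R (s a 0) (s a 0) = R (s a 1) (s a 1)"
          unfolding R_def using s[of a 0] s[of a 1] a by (simp add: overlap_self)
        moreover have "R (s a 0) (s a 1) = R (s a 1) (s a 0)" unfolding R_def by (rule overlap_commute)
        ultimately show ?thesis
          using True a eps2 Rint[of a 0 a 2] Rint[of a 0 a 3] Rint[of a 1 a 2] Rint[of a 1 a 3]
          by (simp add: abs_le_iff)
      next
        case False
        then show ?thesis
          using a a' Rint[of a 0 a' 0] Rint[of a 0 a' 1] Rint[of a 0 a' 2] Rint[of a 0 a' 3]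
            Rint[of a 1 a' 0] Rint[of a 1 a' 1] Rint[of a 1 a' 2] Rint[of a 1 a' 3]
          by (simp add: abs_le_iff)
      qed
      then show "\<bar>t * (\<beta>\<^sup>2 * ((R (s a 0) (s a' 0) - R (s a 1) (s a' 0)) + (R (s a 0) (s a' 1) - R (s a 1) (s a' 1))
       - (R (s a 0) (s a' 2) - R (s a 1) (s a' 2)) - (R (s a 0) (s a' 3) - R (s a 1) (s a' 3))))\<bar>
        \<le> 1 * ((1 / 4) * (8 * \<epsilon>))"
        unfolding abs_mult using t \<beta>2 by (intro mult_mono) auto
    qed
    also have "\<dots> = 2 * real n * \<epsilon>" by simp
    finally show "\<bar>\<Sum>p\<in>?E. d a p * c p\<bar> \<le> r" using reps by linarith
  next
    fix a assume a: "a \<in> {..<n}"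
    have "(\<Sum>p\<in>?E. (d a p)\<^sup>2) = \<beta>\<^sup>2 * (2 * (real (card ?V) / real N) - 2 * R (s a 0) (s a 1))"
      unfolding power2_eq_square[of "d a _"] dd
      using s[of a 0] s[of a 1] a overlap_commute[of N ?V "s a 1" "s a 0"] by (simp add: R_def overlap_self)
    then have "(\<Sum>p\<in>?E. (d a p)\<^sup>2) / 2 - \<beta>\<^sup>2 * (1 - q) = \<beta>\<^sup>2 * (- (R (s a 0) (s a 1) - q) - 1 / real N)"
      unfolding cardV using N by (simp add: field_simps)
    also have "\<bar>\<dots>\<bar> \<le> 1 * (\<epsilon> + 1 / real N)"
      unfolding abs_mult
    proof (intro mult_mono)
      have "\<bar>R (s a 0) (s a 1) - q\<bar> \<le> \<epsilon>" using a by (intro Rq) auto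
      moreover have "0 \<le> 1 / real N" by simp
      ultimately show "\<bar>- (R (s a 0) (s a 1) - q) - 1 / real N\<bar> \<le> \<epsilon> + 1 / real N" by linarith
    qed (use \<beta>2 in auto)
    finally show "\<bar>(\<Sum>p\<in>?E. (d a p)\<^sup>2) / 2 - \<beta>\<^sup>2 * (1 - q)\<bar> \<le> r\<^sup>2" using r2 by simp
  qed
  have csum: "(\<Sum>p\<in>?E. (c p)\<^sup>2) / 2 \<le> 8 * (real n)\<^sup>2"
  proof -
    have cb: "(c p)\<^sup>2 \<le> 16 * (real n)\<^sup>2 * b\<^sup>2" if p: "p \<in> ?E" for p
    proof -
      have eb: "\<bar>e (s a u) p\<bar> \<le> \<bar>b\<bar>" if "a < n" "u < 4" for a u
        using configs_spin_abs[OF s[OF that] far_end_mem[OF p]] by (simp add: e_def abs_mult)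
      have "\<bar>c p\<bar> \<le> (\<Sum>a<n. 1 * (4 * \<bar>b\<bar>))"
        unfolding c_def
      proof (rule order_trans[OF sum_abs sum_mono])
        fix a assume "a \<in> {..<n}"
        then have "\<bar>e (s a 0) p + e (s a 1) p - e (s a 2) p - e (s a 3) p\<bar> \<le> 4 * \<bar>b\<bar>"
          using eb[of a 0] eb[of a 1] eb[of a 2] eb[of a 3] by (simp add: abs_le_iff)
        then show "\<bar>t * (e (s a 0) p + e (s a 1) p - e (s a 2) p - e (s a 3) p)\<bar> \<le> 1 * (4 * \<bar>b\<bar>)"
          unfolding abs_mult using t by (intro mult_mono) auto
      qed
      then have "\<bar>c p\<bar>\<^sup>2 \<le> (real n * (4 * \<bar>b\<bar>))\<^sup>2" by (intro power_mono) auto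
      then show ?thesis by (simp add: power_mult_distrib)
    qed
    have "(\<Sum>p\<in>?E. (c p)\<^sup>2) \<le> real (card ?E) * (16 * (real n)\<^sup>2 * b\<^sup>2)"
      using sum_mono[OF cb] by simp
    also have "\<dots> \<le> real N * (16 * (real n)\<^sup>2 * b\<^sup>2)"
      using card_cavity_edges[of i N] by (intro mult_right_mono) auto
    also have "\<dots> = 16 * (real n)\<^sup>2 * \<beta>\<^sup>2" unfolding b2 using N by simp
    also have "\<dots> \<le> 16 * (real n)\<^sup>2 * 1" using \<beta>2 by (intro mult_left_mono) auto
    finally show ?thesis by simp
  qed
  have r_pow: "r ^ (2 * n) = (3 * real n + 1) ^ (2 * n) * (\<epsilon> + 1 / real N) ^ n"
    unfolding r_def power_mult_distrib using x0 by (simp add: power_mult)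
  have "\<bar>LINT \<omega>|gaussians ?E. (\<Prod>a<n.
      ((l \<omega> (s a 0) - l \<omega> (s a 1))\<^sup>2 / 2 - \<beta>\<^sup>2 * (1 - q)) *
      exp (t * (l \<omega> (s a 0) + l \<omega> (s a 1) - l \<omega> (s a 2) - l \<omega> (s a 3))))\<bar>
    \<le> 2 ^ n * fact (2 * n) * r ^ (2 * n) * exp ((\<Sum>p\<in>?E. (c p)\<^sup>2) / 2)"
  proof -
    have pe: "(\<Prod>a<n. exp (t * (l \<omega> (s a 0) + l \<omega> (s a 1) - l \<omega> (s a 2) - l \<omega> (s a 3))))
        = exp (\<Sum>p\<in>?E. c p * \<omega> p)" for \<omega>
      unfolding lc[symmetric] by (rule exp_sum[symmetric]) simp
    show ?thesis using main unfolding prod.distrib ld pe card_lessThan .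
  qed
  also have "\<dots> \<le> 2 ^ n * fact (2 * n) * r ^ (2 * n) * exp (8 * (real n)\<^sup>2)"
    using csum r0 by (intro mult_left_mono) auto
  finally show ?thesis unfolding r_pow by (simp add: mult_ac)
qed

lemma add_power_le:
  fixes x y :: real
  assumes "0 \<le> x" "0 \<le> y"
  shows "(x + y) ^ n \<le> 2 ^ n * (x ^ n + y ^ n)"
proof -
  have "(x + y) ^ n \<le> (2 * max x y) ^ n" using assms by (intro power_mono) auto
  also have "\<dots> = 2 ^ n * (max x y) ^ n" by (simp add: power_mult_distrib)
  also have "(max x y) ^ n \<le> x ^ n + y ^ n" using assms by (simp add: max_def)
  finally show ?thesis by simp
qed

text \<open>The even power is expanded into products over replicas of the cavity system. The weights of the replicas
  do not involve the couplings of the site \<open>i\<close>, so the two expectations factorise; the expectation over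
  these couplings is bounded configuration by configuration through the overlaps, whose moments are then
  averaged over the cavity system.\<close>

lemma cavity_variance_moment:
  fixes \<beta>0 :: real and k :: nat
  assumes \<beta>0: "0 < \<beta>0" "\<beta>0 < 1 / 2" and k: "1 \<le> k"
  shows "\<exists>K\<ge>0. \<forall>N i \<beta> h t. i \<in> {1..N} \<longrightarrow> 0 < \<beta> \<longrightarrow> \<beta> \<le> \<beta>0 \<longrightarrow> \<bar>t\<bar> \<le> 1 \<longrightarrow>
    (\<integral>\<^sup>+ g. ennreal (cavity_deviation (\<beta>\<^sup>2 * (1 - overlap_q \<beta> h)) (\<beta> / sqrt (real N)) h i N g t ^ (2 * k)) \<partial>disorder N) \<le> ennreal (K / real N ^ k)"
proof -
  obtain K0 where K0: "0 \<le> K0" "\<And>N V \<beta> h. finite V \<Longrightarrow> card V + 1 = N \<Longrightarrow> 0 < \<beta> \<Longrightarrow> \<beta> \<le> \<beta>0 \<Longrightarrow>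
    (LINT g|gaussians (pairs V). sk_gibbs2 (\<beta> / sqrt (real N)) h V g
      (\<lambda>a. (overlap N V (fst a) (snd a) - overlap_q \<beta> h) ^ (2 * k))) \<le> K0 / real N ^ k"
    using overlap_moments[OF \<beta>0, of k] by blast
  define n where "n = 2 * k"
  \<comment> \<open>Pairs of distinct replica labels, a label being the number of a quadruple and a position in it.\<close>
  define P where "P = {(l, l') \<in> ({..<n} \<times> {..<4::nat}) \<times> ({..<n} \<times> {..<4::nat}). l \<noteq> l'}"
  define K1 where "K1 = 2 ^ n * fact (2 * n) * (3 * real n + 1) ^ (2 * n) * exp (8 * (real n)\<^sup>2) * (2 ^ n :: real)"
  have K1: "0 \<le> K1" unfolding K1_def by (intro mult_nonneg_nonneg) auto
  have Pfin: "finite P" unfolding P_def by (rule finite_subset[of _ "({..<n} \<times> {..<4}) \<times> ({..<n} \<times> {..<4})"]) auto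
  have Pne: "((0, 0), (0, 1)) \<in> P" using k unfolding P_def n_def by auto
  show ?thesis
  proof (intro exI[of _ "K1 * (real (card P) * K0 + 1)"] conjI allI impI)
    show "0 \<le> K1 * (real (card P) * K0 + 1)" using K1 K0(1) by (intro mult_nonneg_nonneg) auto
    fix N i :: nat and \<beta> h t :: real
    assume i: "i \<in> {1..N}" and \<beta>: "0 < \<beta>" "\<beta> \<le> \<beta>0" and t: "\<bar>t\<bar> \<le> 1"
    let ?V = "{1..N} - {i}"
    let ?E = "cavity_edges i N"
    let ?S = "spin_pairs N"
    define C where "C = configs ?V"
    define b where "b = \<beta> / sqrt (real N)"
    define q where "q = overlap_q \<beta> h"
    define l where "l = cavity_field b i N"
    define w where "w = (\<lambda>g \<sigma>. exp (sk_energy b h ?V g \<sigma>) / (\<Sum>\<tau>\<in>C. exp (sk_energy b h ?V g \<tau>)))"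
    define Q where "Q = PiE {..<4::nat} (\<lambda>_. C)"
    define T where "T = PiE {..<n} (\<lambda>_. Q)"
    define W where "W = (\<lambda>g s. \<Prod>a<n. \<Prod>u<4::nat. w g (s a u :: nat \<Rightarrow> real))"
    define F where "F = (\<lambda>g s. \<Prod>a<n. ((l g (s a 0) - l g (s a 1))\<^sup>2 / 2 - \<beta>\<^sup>2 * (1 - q)) *
      exp (t * (l g (s a 0) + l g (s a 1) - l g (s a 2) - l g (s a (3::nat)))))"
    define dev where "dev = (\<lambda>c. (overlap N ?V (fst c) (snd c) - q) ^ (2 * k))"
    define D where "D = (\<lambda>s. \<Sum>c\<in>P. (overlap N ?V (s (fst (fst c)) (snd (fst c))) (s (fst (snd c)) (snd (snd c))) - q) ^ n)"
    have N: "real N > 0" "N \<ge> 1" using i by auto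
    have cardV: "card ?V + 1 = N" using i by simp
    have \<beta>1: "\<beta> < 1" "\<beta> \<le> 1 / 2" using \<beta> \<beta>0 by auto
    have q: "0 \<le> q" "q \<le> 1" unfolding q_def using overlap_q_fixed_point[OF \<beta>(1) \<beta>1(1)] by auto
    have C: "finite C" "C \<noteq> {}" unfolding C_def by auto
    have Q: "finite Q" unfolding Q_def using C by (intro finite_PiE) auto
    have T: "finite T" unfolding T_def using Q by (intro finite_PiE) auto
    have sT: "s a u \<in> C" if "s \<in> T" "a < n" "u < 4" for s a u
      using that unfolding T_def Q_def by (meson PiE_mem lessThan_iff)
    have S: "?S = pairs ?V \<union> ?E" "pairs ?V \<inter> ?E = {}" by (rule spin_pairs_cavity[OF i])+
    have w: "\<And>g x. 0 \<le> w g x" "\<And>g. (\<Sum>x\<in>C. w g x) = 1" unfolding w_def by (rule softmax_prob[OF C])+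
    have w1: "w g x \<le> 1" if "x \<in> C" for g x
      using member_le_sum[of x C "w g"] that C w by simp
    have wm: "(\<lambda>g. w g \<sigma>) \<in> borel_measurable (gaussians J)" if "pairs ?V \<subseteq> J" for \<sigma> J
      unfolding w_def
      by (intro borel_measurable_divide borel_measurable_sum
          measurable_compose[OF sk_energy_measurable[OF that] borel_measurable_exp])
    have Wm: "(\<lambda>g. W g s) \<in> borel_measurable (gaussians J)" if "pairs ?V \<subseteq> J" for s J
      unfolding W_def by (intro borel_measurable_prod wm that)
    have W01: "0 \<le> W g s" "W g s \<le> 1" if "s \<in> T" for g s
      unfolding W_def using w w1 sT[OF that] by (auto intro!: prod_nonneg prod_le_1)
    have Wg: "exp_growth J (\<lambda>g. W g s)" if "s \<in> T" for s J
      by (rule exp_growth_bounded[of _ 1]) (use W01[OF that] in \<open>simp add: abs_le_iff\<close>)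
    have lm: "(\<lambda>g. l g \<sigma>) \<in> borel_measurable (gaussians J)" if "?E \<subseteq> J" for \<sigma> J
      unfolding l_def by (rule cavity_field_measurable[OF that])
    have Fm: "(\<lambda>g. F g s) \<in> borel_measurable (gaussians J)" if "?E \<subseteq> J" for s J
      unfolding F_def
      by (intro borel_measurable_prod borel_measurable_times borel_measurable_diff borel_measurable_add
          borel_measurable_divide borel_measurable_power borel_measurable_const
          measurable_compose[OF _ borel_measurable_exp] lm[OF that])
    have lg: "exp_growth J (\<lambda>g. l g \<sigma>)" if "finite J" "?E \<subseteq> J" for \<sigma> J
      unfolding l_def cavity_field_def by (rule exp_growth_linear_subset[OF that])
    have eg: "exp_growth J (\<lambda>g. exp (t * (l g x + l g y - l g z - l g v)))" if "finite J" "?E \<subseteq> J" for x y z v J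
    proof -
      have "t * (l g x + l g y - l g z - l g v) = (\<Sum>p\<in>?E. (t * b * (x (far_end i p) + y (far_end i p)
          - z (far_end i p) - v (far_end i p))) * g p)" for g
        unfolding l_def cavity_field_def sum_distrib_left sum.distrib[symmetric] sum_subtractf[symmetric]
        by (intro sum.cong refl) (simp add: algebra_simps)
      then show ?thesis using exp_growth_exp_linear_subset[OF that] by simp
    qed
    have Fg: "exp_growth J (\<lambda>g. F g s)" if "finite J" "?E \<subseteq> J" for s J
      unfolding F_def power2_eq_square divide_inverse
      by (intro exp_growth_prod exp_growth_mult exp_growth_diff exp_growth_const lg[OF that] eg[OF that])
    have finS: "finite ?S" unfolding S by simp
    have WFi: "integrable (gaussians ?S) (\<lambda>g. W g s * F g s)" if "s \<in> T" for s
      by (intro exp_growth_integrable[OF finS] borel_measurable_times exp_growth_mult Wm Fm Wg[OF that] Fg finS)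
         (auto simp: S)
    have Y_le: "cavity_deviation (\<beta>\<^sup>2 * (1 - q)) b h i N g t ^ (2 * k) \<le> (\<Sum>s\<in>T. W g s * F g s)" for g
    proof -
      have "cavity_deviation (\<beta>\<^sup>2 * (1 - q)) b h i N g t ^ (2 * k)
        \<le> (\<Sum>x\<in>Q. (\<Prod>u<4. w g (x u)) *
          (((l g (x 0) - l g (x 1))\<^sup>2 / 2 - \<beta>\<^sup>2 * (1 - q)) * exp (t * (l g (x 0) + l g (x 1) - l g (x 2) - l g (x 3))))) ^ (2 * k)"
        unfolding cavity_deviation_def cavity_gibbs_def l_def[symmetric] w_def Q_def C_def[symmetric]
        by (rule tilted_variance_power_le[OF C])
      also have "\<dots> = (\<Prod>a<n. \<Sum>x\<in>Q. (\<Prod>u<4. w g (x u)) *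
          (((l g (x 0) - l g (x 1))\<^sup>2 / 2 - \<beta>\<^sup>2 * (1 - q)) * exp (t * (l g (x 0) + l g (x 1) - l g (x 2) - l g (x 3)))))"
        by (simp add: n_def)
      also have "\<dots> = (\<Sum>s\<in>T. \<Prod>a<n. (\<Prod>u<4. w g (s a u)) *
          (((l g (s a 0) - l g (s a 1))\<^sup>2 / 2 - \<beta>\<^sup>2 * (1 - q)) * exp (t * (l g (s a 0) + l g (s a 1) - l g (s a 2) - l g (s a 3)))))"
        unfolding T_def using Q by (intro prod_sum_PiE) auto
      also have "\<dots> = (\<Sum>s\<in>T. W g s * F g s)"
        unfolding W_def F_def by (intro sum.cong refl prod.distrib)
      finally show ?thesis .
    qed
    have inner: "\<bar>LINT g|gaussians ?E. F g s\<bar> \<le> K1 * (D s + 1 / real N ^ k)" if s: "s \<in> T" for s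
    proof -
      define \<rho> where "\<rho> = (\<lambda>((a, u), (a', u')). \<bar>overlap N ?V (s a u) (s a' u') - q\<bar>)"
      define \<epsilon> where "\<epsilon> = Max (\<rho> ` P)"
      have P: "a < n \<and> u < 4 \<and> a' < n \<and> u' < 4 \<and> (a, u) \<noteq> (a', u')" if "((a, u), (a', u')) \<in> P" for a u a' u'
        using that unfolding P_def by auto
      have le_eps: "\<bar>overlap N ?V (s a u) (s a' u') - q\<bar> \<le> \<epsilon>"
        if "a < n" "u < 4" "a' < n" "u' < 4" "(a, u) \<noteq> (a', u')" for a u a' u'
      proof -
        have "((a, u), (a', u')) \<in> P" using that unfolding P_def by auto
        then have "\<rho> ((a, u), (a', u')) \<le> \<epsilon>" unfolding \<epsilon>_def using Pfin by (intro Max_ge) auto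
        then show ?thesis by (simp add: \<rho>_def)
      qed
      have "\<epsilon> \<in> \<rho> ` P" unfolding \<epsilon>_def using Pfin Pne by (intro Max_in) auto
      then obtain a u a' u' where au: "((a, u), (a', u')) \<in> P" "\<epsilon> = \<bar>overlap N ?V (s a u) (s a' u') - q\<bar>"
        unfolding \<rho>_def by force
      have eps0: "0 \<le> \<epsilon>" using au(2) by simp
      have "\<bar>overlap N ?V (s a u) (s a' u')\<bar> \<le> 1"
        using P[OF au(1)] sT[OF s] cardV by (intro overlap_abs_le) (auto simp: C_def)
      then have eps2: "\<epsilon> \<le> 2" using au(2) q by linarith
      have "\<bar>LINT g|gaussians ?E. F g s\<bar>
          \<le> 2 ^ n * fact (2 * n) * (3 * real n + 1) ^ (2 * n) * exp (8 * (real n)\<^sup>2) * (\<epsilon> + 1 / real N) ^ n"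
        unfolding F_def l_def b_def
        by (rule replica_cavity_expectation[OF i \<beta>(1) \<beta>1(2) t _ le_eps eps0 eps2])
           (use sT[OF s] in \<open>auto simp: C_def\<close>)
      also have "\<dots> \<le> 2 ^ n * fact (2 * n) * (3 * real n + 1) ^ (2 * n) * exp (8 * (real n)\<^sup>2)
          * (2 ^ n * (D s + 1 / real N ^ k))"
      proof (rule mult_left_mono)
        have "(\<epsilon> + 1 / real N) ^ n \<le> 2 ^ n * (\<epsilon> ^ n + (1 / real N) ^ n)"
          using eps0 by (intro add_power_le) auto
        also have "\<dots> \<le> 2 ^ n * (D s + 1 / real N ^ k)"
        proof (intro mult_left_mono add_mono)
          have "\<epsilon> ^ n = (overlap N ?V (s a u) (s a' u') - q) ^ n"
            unfolding au(2) n_def by (simp add: power_even_abs)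
          also have "\<dots> \<le> D s"
            unfolding D_def using member_le_sum[OF au(1), of "\<lambda>c. (overlap N ?V (s (fst (fst c)) (snd (fst c))) (s (fst (snd c)) (snd (snd c))) - q) ^ n"]
              Pfin by (auto simp: n_def)
          finally show "\<epsilon> ^ n \<le> D s" .
          have "real N ^ k \<le> real N ^ n" using N(2) unfolding n_def by (intro power_increasing) auto
          then show "(1 / real N) ^ n \<le> 1 / real N ^ k"
            using N by (simp add: power_one_over frac_le)
        qed simp
        finally show "(\<epsilon> + 1 / real N) ^ n \<le> 2 ^ n * (D s + 1 / real N ^ k)" .
      qed (intro mult_nonneg_nonneg, auto)
      finally show ?thesis unfolding K1_def by (simp add: mult.assoc)
    qed
    have outer: "(\<Sum>s\<in>T. W g s * (overlap N ?V (s a u) (s a' u') - q) ^ n)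
        = sk_gibbs2 b h ?V g dev"
      if "((a, u), (a', u')) \<in> P" for a u a' u' g
    proof -
      have "(\<Sum>s\<in>T. W g s * (overlap N ?V (s a u) (s a' u') - q) ^ n)
          = (\<Sum>x\<in>C. \<Sum>y\<in>C. w g x * w g y * (overlap N ?V x y - q) ^ n)"
        unfolding T_def Q_def W_def
        by (rule replica_pair_marginal[OF C(1) w(2)]) (use that in \<open>auto simp: P_def\<close>)
      also have "\<dots> = sk_gibbs2 b h ?V g dev"
        unfolding sk_gibbs2_def C_def[symmetric]
        by (subst gibbs_pair[OF C, of _ "sk_energy b h ?V g"])
           (simp_all add: w_def n_def dev_def sum.cartesian_product case_prod_unfold)
      finally show ?thesis .
    qed
    have EW: "integrable (gaussians (pairs ?V)) (\<lambda>g. W g s)" if "s \<in> T" for s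
      by (intro exp_growth_integrable Wm Wg that) auto
    have W_sum: "(\<Sum>s\<in>T. W g s) = 1" for g
    proof -
      have "(\<Sum>x\<in>Q. \<Prod>u<4. w g (x u)) = 1"
        unfolding Q_def using prod_sum_PiE[of "{..<4::nat}" "\<lambda>_. C" "\<lambda>_. w g"] C w(2)[of g] by simp
      then show ?thesis
        unfolding T_def W_def using prod_sum_PiE[of "{..<n}" "\<lambda>_. Q" "\<lambda>_ x. \<Prod>u<4. w g (x u)"] Q by simp
    qed
    have "(LINT g|gaussians ?S. (\<Sum>s\<in>T. W g s * F g s))
        = (\<Sum>s\<in>T. (LINT g|gaussians (pairs ?V). W g s) * (LINT g|gaussians ?E. F g s))"
    proof -
      have "(LINT g|gaussians ?S. (\<Sum>s\<in>T. W g s * F g s)) = (\<Sum>s\<in>T. LINT g|gaussians ?S. W g s * F g s)"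
        using WFi by (intro Bochner_Integration.integral_sum)
      also have "\<dots> = (\<Sum>s\<in>T. (LINT g|gaussians (pairs ?V). W g s) * (LINT g|gaussians ?E. F g s))"
      proof (intro sum.cong refl)
        fix s assume s: "s \<in> T"
        show "(LINT g|gaussians ?S. W g s * F g s)
            = (LINT g|gaussians (pairs ?V). W g s) * (LINT g|gaussians ?E. F g s)"
          unfolding S(1)
        proof (rule gaussians_independent)
          show "integrable (gaussians (pairs ?V \<union> ?E)) (\<lambda>g. W g s * F g s)"
            using WFi[OF s] unfolding S(1) .
          show "W g s = W g' s" if "\<And>p. p \<in> pairs ?V \<Longrightarrow> g p = g' p" for g g'
          proof -
            have "sk_energy b h ?V g = sk_energy b h ?V g'"
              unfolding sk_energy_def using that by (intro ext arg_cong2[where f = "(+)"] sum.cong) auto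
            then show ?thesis by (simp add: W_def w_def)
          qed
          show "F g s = F g' s" if "\<And>p. p \<in> ?E \<Longrightarrow> g p = g' p" for g g'
          proof -
            have "l g = l g'"
              unfolding l_def cavity_field_def using that by (intro ext sum.cong) auto
            then show ?thesis by (simp add: F_def)
          qed
        qed (use S in auto)
      qed
      finally show ?thesis .
    qed
    also have "\<dots> \<le> (\<Sum>s\<in>T. (LINT g|gaussians (pairs ?V). W g s) * (K1 * (D s + 1 / real N ^ k)))"
    proof (intro sum_mono mult_left_mono)
      fix s assume s: "s \<in> T"
      show "(LINT g|gaussians ?E. F g s) \<le> K1 * (D s + 1 / real N ^ k)" using inner[OF s] by linarith
      show "0 \<le> (LINT g|gaussians (pairs ?V). W g s)" using W01[OF s] by (intro Bochner_Integration.integral_nonneg)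
    qed
    also have "\<dots> = (LINT g|gaussians (pairs ?V). K1 * ((\<Sum>s\<in>T. W g s * D s) + 1 / real N ^ k))"
    proof -
      have "(\<Sum>s\<in>T. (LINT g|gaussians (pairs ?V). W g s) * (K1 * (D s + 1 / real N ^ k)))
          = (LINT g|gaussians (pairs ?V). (\<Sum>s\<in>T. W g s * (K1 * (D s + 1 / real N ^ k))))"
        using EW by (subst Bochner_Integration.integral_sum) auto
      moreover have "(\<Sum>s\<in>T. W g s * (K1 * (D s + 1 / real N ^ k))) = K1 * ((\<Sum>s\<in>T. W g s * D s) + (\<Sum>s\<in>T. W g s) * (1 / real N ^ k))" for g
        by (simp only: sum_distrib_left sum_distrib_right sum.distrib[symmetric]) (simp add: algebra_simps)
      ultimately show ?thesis unfolding W_sum by simp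
    qed
    also have "\<dots> = (LINT g|gaussians (pairs ?V). K1 * ((\<Sum>c\<in>P. sk_gibbs2 b h ?V g
        dev) + 1 / real N ^ k))"
    proof -
      have "(\<Sum>s\<in>T. W g s * D s) = (\<Sum>c\<in>P. sk_gibbs2 b h ?V g dev)" for g
      proof -
        have "(\<Sum>s\<in>T. W g s * D s) = (\<Sum>c\<in>P. \<Sum>s\<in>T. W g s * (overlap N ?V (s (fst (fst c)) (snd (fst c))) (s (fst (snd c)) (snd (snd c))) - q) ^ n)"
          unfolding D_def sum_distrib_left by (rule sum.swap)
        also have "\<dots> = (\<Sum>c\<in>P. sk_gibbs2 b h ?V g dev)"
        proof (rule sum.cong[OF refl])
          fix c assume c: "c \<in> P"
          obtain a u a' u' where cc: "c = ((a, u), (a', u'))" by (metis surj_pair)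
          show "(\<Sum>s\<in>T. W g s * (overlap N ?V (s (fst (fst c)) (snd (fst c))) (s (fst (snd c)) (snd (snd c))) - q) ^ n)
              = sk_gibbs2 b h ?V g dev"
            using outer[of a u a' u' g] c unfolding cc by simp
        qed
        finally show ?thesis .
      qed
      then show ?thesis by simp
    qed
    also have "\<dots> = K1 * (real (card P) * (LINT g|gaussians (pairs ?V). sk_gibbs2 b h ?V g
        dev) + 1 / real N ^ k)"
    proof -
      interpret prob_space "gaussians (pairs ?V)" by (rule prob_space_gaussians)
      have "integrable (gaussians (pairs ?V)) (\<lambda>g. sk_gibbs2 b h ?V g dev)"
        by (rule sk_gibbs2_integrable) simp
      moreover have "(LINT g|gaussians (pairs ?V). K1 * (real (card P) * X g + 1 / real N ^ k))
          = K1 * (real (card P) * (LINT g|gaussians (pairs ?V). X g) + 1 / real N ^ k)"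
        if "integrable (gaussians (pairs ?V)) X" for X
        using that prob_space by (simp del: One_nat_def)
      ultimately show ?thesis unfolding sum_constant by blast
    qed
    also have "\<dots> \<le> K1 * (real (card P) * (K0 / real N ^ k) + 1 / real N ^ k)"
      using K1 K0(2)[OF _ cardV \<beta>, of h] unfolding b_def q_def dev_def
      by (intro mult_left_mono add_right_mono) auto
    also have "\<dots> = K1 * (real (card P) * K0 + 1) / real N ^ k"
      by (simp add: add_divide_distrib distrib_left)
    finally have fin: "(LINT g|gaussians ?S. (\<Sum>s\<in>T. W g s * F g s)) \<le> K1 * (real (card P) * K0 + 1) / real N ^ k" .
    have nn: "0 \<le> (\<Sum>s\<in>T. W g s * F g s)" for g
      using Y_le[of g] by (rule order_trans[rotated]) (simp add: zero_le_even_power)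
    have "(\<integral>\<^sup>+ g. ennreal (cavity_deviation (\<beta>\<^sup>2 * (1 - q)) b h i N g t ^ (2 * k)) \<partial>gaussians ?S) \<le> (\<integral>\<^sup>+ g. ennreal (\<Sum>s\<in>T. W g s * F g s) \<partial>gaussians ?S)"
      by (intro nn_integral_mono ennreal_leI Y_le)
    also have "\<dots> = ennreal (LINT g|gaussians ?S. (\<Sum>s\<in>T. W g s * F g s))"
      using WFi nn by (intro nn_integral_eq_integral) auto
    also have "\<dots> \<le> ennreal (K1 * (real (card P) * K0 + 1) / real N ^ k)" by (rule ennreal_leI[OF fin])
    finally show "(\<integral>\<^sup>+ g. ennreal (cavity_deviation (\<beta>\<^sup>2 * (1 - overlap_q \<beta> h)) (\<beta> / sqrt (real N)) h i N g t ^ (2 * k)) \<partial>disorder N) \<le> ennreal (K1 * (real (card P) * K0 + 1) / real N ^ k)"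
      unfolding disorder_def l_def b_def q_def by simp
  qed
qed

section \<open>The TAP equation\<close>

lemma gibbs_avg_eq_gibbs:
  "gibbs_avg \<beta> h N g f = gibbs (configs {1..N}) (sk_energy (\<beta> / sqrt (real N)) h {1..N} g) f"
proof -
  have H: "- hamiltonian \<beta> h N g \<sigma> = sk_energy (\<beta> / sqrt (real N)) h {1..N} g \<sigma>" for \<sigma>
  proof -
    have "(\<Sum>(i, j)\<in>spin_pairs N. coupling g i j * \<sigma> i * \<sigma> j) = (\<Sum>p\<in>spin_pairs N. \<sigma> (fst p) * \<sigma> (snd p) * g p)"
      by (intro sum.cong refl) (auto simp: spin_pairs_def coupling_def)
    then show ?thesis
      unfolding hamiltonian_def sk_energy_def spin_pairs_eq_pairs[symmetric]
      by (simp add: sum_distrib_left mult.assoc)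
  qed
  have S: "spin_configs N = configs {1..N}" by (simp add: spin_configs_def configs_def)
  show ?thesis
    unfolding gibbs_avg_def gibbs_weight_def partition_function_def gibbs_def H S
    by (simp add: sum_divide_distrib)
qed

lemma sum_configs_split:
  fixes F :: "(nat \<Rightarrow> real) \<Rightarrow> real"
  assumes "finite V" "i \<notin> V"
  shows "(\<Sum>\<sigma>\<in>configs (insert i V). F \<sigma>) = (\<Sum>\<rho>\<in>configs V. F (\<rho>(i := 1)) + F (\<rho>(i := -1)))"
proof -
  have "inj_on (\<lambda>(y, g). g(i := y)) ({-1, 1::real} \<times> configs V)"
  proof (rule inj_onI, clarify)
    fix y g y' g' assume g: "g \<in> configs V" "g' \<in> configs V" and eq: "g(i := y) = g'(i := y')"
    have "g x = g' x" for x
      using fun_cong[OF eq, of x] g assms(2) PiE_arb[of g V _ i] PiE_arb[of g' V _ i]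
      unfolding configs_def by (cases "x = i") auto
    then show "y = y' \<and> g = g'" using fun_cong[OF eq, of i] by auto
  qed
  moreover have "configs (insert i V) = (\<lambda>(y, g). g(i := y)) ` ({-1, 1} \<times> configs V)"
    unfolding configs_def PiE_insert_eq ..
  ultimately have "(\<Sum>\<sigma>\<in>configs (insert i V). F \<sigma>) = (\<Sum>(y, \<rho>)\<in>{-1, 1} \<times> configs V. F (\<rho>(i := y)))"
    by (simp add: sum.reindex case_prod_unfold)
  also have "\<dots> = (\<Sum>y\<in>{-1, 1}. \<Sum>\<rho>\<in>configs V. F (\<rho>(i := y)))"
    by (rule sum.cartesian_product[symmetric])
  finally show ?thesis by (simp add: sum.distrib)
qed

lemma cavity_field_upd: "cavity_field b i N g (\<rho>(i := y)) = cavity_field b i N g \<rho>"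
  unfolding cavity_field_def using far_end_mem[of _ i N] by (intro sum.cong refl) auto

lemma sk_energy_cavity:
  assumes "i \<in> {1..N}"
  shows "sk_energy b h {1..N} g (\<rho>(i := y))
    = sk_energy b h ({1..N} - {i}) g \<rho> + y * (cavity_field b i N g \<rho> + h)"
proof -
  let ?V = "{1..N} - {i}"
  let ?f = "\<lambda>p. b * ((\<rho>(i := y)) (fst p) * (\<rho>(i := y)) (snd p)) * g p"
  have "(\<Sum>p\<in>pairs {1..N}. ?f p) = (\<Sum>p\<in>pairs ?V. ?f p) + (\<Sum>p\<in>cavity_edges i N. ?f p)"
    unfolding spin_pairs_eq_pairs[symmetric] spin_pairs_cavity(1)[OF assms]
    using spin_pairs_cavity(2)[OF assms] by (intro sum.union_disjoint) auto
  also have "(\<Sum>p\<in>pairs ?V. ?f p) = (\<Sum>p\<in>pairs ?V. b * (\<rho> (fst p) * \<rho> (snd p)) * g p)"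
    by (intro sum.cong refl) (auto simp: pairs_def)
  also have "(\<Sum>p\<in>cavity_edges i N. ?f p) = y * cavity_field b i N g \<rho>"
    unfolding cavity_field_def sum_cavity_edges far_end_edge sum_distrib_left
    by (intro sum.cong refl) (auto simp: min_def max_def mult_ac)
  finally have E: "(\<Sum>p\<in>pairs {1..N}. ?f p)
      = (\<Sum>p\<in>pairs ?V. b * (\<rho> (fst p) * \<rho> (snd p)) * g p) + y * cavity_field b i N g \<rho>" .
  have "(\<Sum>j\<in>{1..N}. (\<rho>(i := y)) j) = y + (\<Sum>j\<in>?V. (\<rho>(i := y)) j)"
    using assms by (subst sum.remove[of _ i]) auto
  also have "(\<Sum>j\<in>?V. (\<rho>(i := y)) j) = (\<Sum>j\<in>?V. \<rho> j)" by (intro sum.cong) auto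
  finally show ?thesis unfolding sk_energy_def E by (simp add: algebra_simps)
qed

lemma gibbs_cavity:
  assumes "i \<in> {1..N}"
  defines "V \<equiv> {1..N} - {i}"
  defines "e \<equiv> \<lambda>b h g t \<rho>. exp (sk_energy b h V g \<rho> + t * cavity_field b i N g \<rho>)"
  shows "gibbs (configs {1..N}) (sk_energy b h {1..N} g) f
    = (exp h * (\<Sum>\<rho>\<in>configs V. f (\<rho>(i := 1)) * e b h g 1 \<rho>)
        + exp (- h) * (\<Sum>\<rho>\<in>configs V. f (\<rho>(i := -1)) * e b h g (-1) \<rho>))
      / (exp h * (\<Sum>\<rho>\<in>configs V. e b h g 1 \<rho>) + exp (- h) * (\<Sum>\<rho>\<in>configs V. e b h g (-1) \<rho>))"
proof -
  have V: "finite V" "i \<notin> V" "{1..N} = insert i V" using assms(1) by (auto simp: V_def)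
  have E: "exp (sk_energy b h {1..N} g (\<rho>(i := 1))) = exp h * e b h g 1 \<rho>"
    "exp (sk_energy b h {1..N} g (\<rho>(i := -1))) = exp (- h) * e b h g (-1) \<rho>" for \<rho>
    unfolding sk_energy_cavity[OF assms(1)] e_def V_def exp_add[symmetric]
    by (simp_all add: algebra_simps)
  have sum: "(\<Sum>\<sigma>\<in>configs {1..N}. F \<sigma> * exp (sk_energy b h {1..N} g \<sigma>))
      = exp h * (\<Sum>\<rho>\<in>configs V. F (\<rho>(i := 1)) * e b h g 1 \<rho>)
        + exp (- h) * (\<Sum>\<rho>\<in>configs V. F (\<rho>(i := -1)) * e b h g (-1) \<rho>)" for F
  proof -
    have "(\<Sum>\<sigma>\<in>configs {1..N}. F \<sigma> * exp (sk_energy b h {1..N} g \<sigma>))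
        = (\<Sum>\<rho>\<in>configs V. F (\<rho>(i := 1)) * exp (sk_energy b h {1..N} g (\<rho>(i := 1)))
            + F (\<rho>(i := -1)) * exp (sk_energy b h {1..N} g (\<rho>(i := -1))))"
      by (subst (1) V(3)) (rule sum_configs_split[OF V(1,2)])
    then show ?thesis
      unfolding E by (simp add: sum.distrib sum_distrib_left mult_ac)
  qed
  show ?thesis
    unfolding gibbs_def using sum[of f] sum[of "\<lambda>_. 1"] by simp
qed

text \<open>The two values of the spin at \<open>i\<close> split every Gibbs average of the whole system into two tilted averages
  of the cavity system, which is the situation of \<open>mean_field_error\<close>.\<close>

lemma tap_error_pointwise:
  fixes \<beta> h \<kappa> :: real
  assumes i: "i \<in> {1..N}"
  defines "b \<equiv> \<beta> / sqrt (real N)"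
  shows "(gibbs_avg \<beta> h N g (\<lambda>\<sigma>. \<sigma> i)
        - tanh (\<beta> / sqrt (real N)
                  * (\<Sum>j\<in>{1..N} - {i}. coupling g i j * gibbs_avg \<beta> h N g (\<lambda>\<sigma>. \<sigma> j))
                + h - \<kappa> * gibbs_avg \<beta> h N g (\<lambda>\<sigma>. \<sigma> i))) ^ (2 * k)
    \<le> 4 ^ k * (LINT t|uniform_sym. cavity_deviation \<kappa> b h i N g t ^ (2 * k))"
proof -
  let ?V = "{1..N} - {i}"
  define C where "C = configs ?V"
  define A where "A = sk_energy b h ?V g"
  define l where "l = cavity_field b i N g"
  define Z where "Z = (\<lambda>t. \<Sum>\<rho>\<in>C. exp (A \<rho> + t * l \<rho>))"
  define G where "G = (\<lambda>t. gibbs C (\<lambda>\<rho>. A \<rho> + t * l \<rho>))"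
  define m where "m = (exp h * Z 1 - exp (- h) * Z (-1)) / (exp h * Z 1 + exp (- h) * Z (-1))"
  have C: "finite C" "C \<noteq> {}" unfolding C_def by auto
  have Z: "Z t > 0" for t unfolding Z_def by (rule partition_sum_pos[OF C])
  have G: "(\<Sum>\<rho>\<in>C. l \<rho> * exp (A \<rho> + t * l \<rho>)) = Z t * G t l" for t
    using Z[of t] unfolding G_def gibbs_def Z_def by simp
  have avg: "gibbs_avg \<beta> h N g f
    = (exp h * (\<Sum>\<rho>\<in>C. f (\<rho>(i := 1)) * exp (A \<rho> + 1 * l \<rho>))
        + exp (- h) * (\<Sum>\<rho>\<in>C. f (\<rho>(i := -1)) * exp (A \<rho> + (-1) * l \<rho>)))
      / (exp h * Z 1 + exp (- h) * Z (-1))" for f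
    unfolding gibbs_avg_eq_gibbs b_def[symmetric] gibbs_cavity[OF i] Z_def C_def A_def l_def ..
  have m: "gibbs_avg \<beta> h N g (\<lambda>\<sigma>. \<sigma> i) = m"
    unfolding avg by (simp add: m_def Z_def sum_negf)
  have "\<beta> / sqrt (real N) * (\<Sum>j\<in>?V. coupling g i j * gibbs_avg \<beta> h N g (\<lambda>\<sigma>. \<sigma> j))
      = gibbs_avg \<beta> h N g l"
  proof -
    have "gibbs_avg \<beta> h N g l = (\<Sum>j\<in>?V. b * coupling g i j * gibbs_avg \<beta> h N g (\<lambda>\<sigma>. \<sigma> j))"
      unfolding gibbs_avg_def l_def cavity_field_def sum_cavity_edges far_end_edge sum_distrib_left sum_distrib_right
      by (subst sum.swap) (simp add: coupling_def mult_ac)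
    then show ?thesis by (simp add: sum_distrib_left b_def mult.assoc)
  qed
  also have "gibbs_avg \<beta> h N g l = (exp h * Z 1 * G 1 l + exp (- h) * Z (-1) * G (-1) l)
      / (exp h * Z 1 + exp (- h) * Z (-1))"
    unfolding avg l_def cavity_field_upd unfolding l_def[symmetric] G by (simp add: mult.assoc)
  finally have field: "\<beta> / sqrt (real N) * (\<Sum>j\<in>?V. coupling g i j * gibbs_avg \<beta> h N g (\<lambda>\<sigma>. \<sigma> j))
      = (exp h * Z 1 * G 1 l + exp (- h) * Z (-1) * G (-1) l) / (exp h * Z 1 + exp (- h) * Z (-1))" .
  show ?thesis
    unfolding m field cavity_deviation_def cavity_gibbs_def l_def[symmetric] A_def[symmetric] C_def[symmetric]
    unfolding m_def Z_def G_def
    by (rule mean_field_error[OF C])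
qed

theorem corollary1:
  fixes \<beta>0 :: real and k :: nat
  assumes "0 < \<beta>0" and "\<beta>0 < 1 / 2"
  shows "\<exists>K::real. \<forall>N\<ge>1. \<forall>i\<in>{1..N}. \<forall>\<beta> h :: real. 0 < \<beta> \<and> \<beta> \<le> \<beta>0 \<longrightarrow>
    (LINT g|disorder N.
       (gibbs_avg \<beta> h N g (\<lambda>\<sigma>. \<sigma> i)
        - tanh (\<beta> / sqrt (real N)
                  * (\<Sum>j\<in>{1..N} - {i}. coupling g i j * gibbs_avg \<beta> h N g (\<lambda>\<sigma>. \<sigma> j))
                + h
                - \<beta>\<^sup>2 * (1 - overlap_q \<beta> h) * gibbs_avg \<beta> h N g (\<lambda>\<sigma>. \<sigma> i))) ^ (2 * k))
    \<le> K / real N ^ k"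
proof (cases "k = 0")
  case True
  have "prob_space (disorder N)" for N unfolding disorder_def by (rule prob_space_gaussians)
  then have "measure (disorder N) (space (disorder N)) = 1" for N by (rule prob_space.prob_space)
  then show ?thesis using True by (intro exI[of _ 1]) simp
next
  case False
  then have "1 \<le> k" by simp
  from cavity_variance_moment[OF assms this] obtain K where K: "0 \<le> K" and
    bound: "\<forall>N i \<beta> h t. i \<in> {1..N} \<longrightarrow> 0 < \<beta> \<longrightarrow> \<beta> \<le> \<beta>0 \<longrightarrow> \<bar>t\<bar> \<le> 1 \<longrightarrow>
    (\<integral>\<^sup>+ g. ennreal (cavity_deviation (\<beta>\<^sup>2 * (1 - overlap_q \<beta> h)) (\<beta> / sqrt (real N)) h i N g t ^ (2 * k)) \<partial>disorder N) \<le> ennreal (K / real N ^ k)"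
    by (elim exE conjE) (rule that)
  show ?thesis
  proof (intro exI[of _ "4 ^ k * K"] allI ballI impI)
    fix N i :: nat and \<beta> h :: real
    assume i: "i \<in> {1..N}" and \<beta>: "0 < \<beta> \<and> \<beta> \<le> \<beta>0"
    let ?V = "{1..N} - {i}"
    define b where "b = \<beta> / sqrt (real N)"
    define \<kappa> where "\<kappa> = \<beta>\<^sup>2 * (1 - overlap_q \<beta> h)"
    define Y where "Y = cavity_deviation \<kappa> b h i N"
    define err where "err = (\<lambda>g. gibbs_avg \<beta> h N g (\<lambda>\<sigma>. \<sigma> i)
        - tanh (\<beta> / sqrt (real N)
                  * (\<Sum>j\<in>?V. coupling g i j * gibbs_avg \<beta> h N g (\<lambda>\<sigma>. \<sigma> j))
                + h - \<kappa> * gibbs_avg \<beta> h N g (\<lambda>\<sigma>. \<sigma> i)))"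
    interpret D: prob_space "disorder N" unfolding disorder_def by (rule prob_space_gaussians)
    interpret U: prob_space uniform_sym by (rule prob_space_uniform_sym)
    interpret DU: pair_sigma_finite "disorder N" uniform_sym
      by unfold_locales
    have S: "pairs ?V \<subseteq> spin_pairs N" "cavity_edges i N \<subseteq> spin_pairs N"
      using spin_pairs_cavity(1)[OF i] by auto
    let ?M = "disorder N \<Otimes>\<^sub>M uniform_sym"
    have Am: "(\<lambda>x. sk_energy b h ?V (fst x) \<sigma>) \<in> borel_measurable ?M" for \<sigma>
      unfolding disorder_def
      by (rule measurable_compose[OF measurable_fst sk_energy_measurable[OF S(1)]])
    have lm: "(\<lambda>x. cavity_field b i N (fst x) \<sigma>) \<in> borel_measurable ?M" for \<sigma>
      unfolding disorder_def
      by (rule measurable_compose[OF measurable_fst cavity_field_measurable[OF S(2)]])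
    have tm: "snd \<in> borel_measurable ?M"
      using measurable_snd[of "disorder N" uniform_sym] by (simp add: measurable_cong_sets[OF refl sets_uniform_sym])
    have Ym: "(\<lambda>x. Y (fst x) (snd x)) \<in> borel_measurable ?M"
      unfolding Y_def cavity_deviation_def cavity_gibbs_def gibbs_def
      by (intro borel_measurable_diff borel_measurable_power borel_measurable_divide borel_measurable_sum
          borel_measurable_times borel_measurable_add borel_measurable_const
          measurable_compose[OF _ borel_measurable_exp] Am lm tm)
    then have Yn: "case_prod (\<lambda>g t. ennreal (4 ^ k * Y g t ^ (2 * k))) \<in> borel_measurable ?M"
      unfolding case_prod_unfold
      by (intro measurable_compose[OF _ measurable_ennreal] borel_measurable_times borel_measurable_const
          borel_measurable_power)
    have Yt: "(\<lambda>t. Y g t) \<in> borel_measurable uniform_sym" if "g \<in> space (disorder N)" for g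
      using measurable_compose[OF measurable_Pair1'[OF that] Ym] by simp
    \<comment> \<open>A Bochner integral of a nonnegative function is at most the nonnegative integral, for which Tonelli's
      theorem exchanges the tilt and the disorder.\<close>
    have err_le: "ennreal (err g ^ (2 * k)) \<le> (\<integral>\<^sup>+ t. ennreal (4 ^ k * Y g t ^ (2 * k)) \<partial>uniform_sym)"
      if g: "g \<in> space (disorder N)" for g
    proof -
      have "err g ^ (2 * k) \<le> 4 ^ k * (LINT t|uniform_sym. Y g t ^ (2 * k))"
        unfolding err_def Y_def b_def by (rule tap_error_pointwise[OF i])
      also have "\<dots> = (LINT t|uniform_sym. 4 ^ k * Y g t ^ (2 * k))" by simp
      also have "\<dots> = enn2real (\<integral>\<^sup>+ t. ennreal (4 ^ k * Y g t ^ (2 * k)) \<partial>uniform_sym)"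
        using Yt[OF g] by (intro integral_eq_nn_integral) (auto simp: zero_le_even_power)
      finally have "ennreal (err g ^ (2 * k)) \<le> ennreal (enn2real (\<integral>\<^sup>+ t. ennreal (4 ^ k * Y g t ^ (2 * k)) \<partial>uniform_sym))"
        by (rule ennreal_leI)
      then show ?thesis by (auto simp: ennreal_enn2real_if split: if_splits)
    qed
    have "(\<integral>\<^sup>+ g. ennreal (err g ^ (2 * k)) \<partial>disorder N)
        \<le> (\<integral>\<^sup>+ g. (\<integral>\<^sup>+ t. ennreal (4 ^ k * Y g t ^ (2 * k)) \<partial>uniform_sym) \<partial>disorder N)"
      by (intro nn_integral_mono err_le)
    also have "\<dots> = (\<integral>\<^sup>+ t. (\<integral>\<^sup>+ g. ennreal (4 ^ k * Y g t ^ (2 * k)) \<partial>disorder N) \<partial>uniform_sym)"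
      by (rule DU.Fubini'[OF Yn, symmetric])
    also have "\<dots> \<le> (\<integral>\<^sup>+ t. ennreal (4 ^ k * K / real N ^ k) \<partial>uniform_sym)"
    proof (rule nn_integral_mono_AE)
      show "AE t in uniform_sym. (\<integral>\<^sup>+ g. ennreal (4 ^ k * Y g t ^ (2 * k)) \<partial>disorder N) \<le> ennreal (4 ^ k * K / real N ^ k)"
        using AE_uniform_sym
      proof eventually_elim
        case (elim t)
        have Yg: "(\<lambda>g. Y g t) \<in> borel_measurable (disorder N)"
          using measurable_compose[OF measurable_Pair2'[of t uniform_sym "disorder N"] Ym]
          by (simp add: uniform_sym_def)
        have "(\<integral>\<^sup>+ g. ennreal (4 ^ k * Y g t ^ (2 * k)) \<partial>disorder N)
            = (\<integral>\<^sup>+ g. ennreal (4 ^ k) * ennreal (Y g t ^ (2 * k)) \<partial>disorder N)"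
          by (intro nn_integral_cong ennreal_mult) (auto simp: zero_le_even_power)
        also have "\<dots> = ennreal (4 ^ k) * (\<integral>\<^sup>+ g. ennreal (Y g t ^ (2 * k)) \<partial>disorder N)"
          using Yg by (intro nn_integral_cmult) auto
        also have "\<dots> \<le> ennreal (4 ^ k) * ennreal (K / real N ^ k)"
          unfolding Y_def b_def \<kappa>_def using bound[rule_format, OF i _ _ elim, of \<beta> h] \<beta> by (intro mult_left_mono) auto
        also have "\<dots> = ennreal (4 ^ k * K / real N ^ k)"
          using K by (simp add: ennreal_mult[symmetric])
        finally show ?case .
      qed
    qed
    also have "\<dots> = ennreal (4 ^ k * K / real N ^ k)"
      using U.emeasure_space_1 by simp
    finally have "(LINT g|disorder N. err g ^ (2 * k)) \<le> 4 ^ k * K / real N ^ k"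
      using K by (intro integral_real_bounded) auto
    then show "(LINT g|disorder N.
       (gibbs_avg \<beta> h N g (\<lambda>\<sigma>. \<sigma> i)
        - tanh (\<beta> / sqrt (real N)
                  * (\<Sum>j\<in>{1..N} - {i}. coupling g i j * gibbs_avg \<beta> h N g (\<lambda>\<sigma>. \<sigma> j))
                + h
                - \<beta>\<^sup>2 * (1 - overlap_q \<beta> h) * gibbs_avg \<beta> h N g (\<lambda>\<sigma>. \<sigma> i))) ^ (2 * k))
    \<le> 4 ^ k * K / real N ^ k"
      unfolding err_def \<kappa>_def .
  qed
qed

end
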